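(* Let $d\ge1$ and let $X$ be one of Euclidean space $\mathbb{E}^d$, the unit sphere $\mathbb{S}^d$, or hyperbolic space $\mathbb{H}^d$. Suppose that every $d$-simplex $\Delta$ in $X$ satisfies $$\sum_{j=k}^{d-1}(-1)^j\binom{j+1}{k+1}\alpha_j(\Delta)=(-1)^d\left(\alpha_k(\Delta)-f_k(\Delta)\right)\qquad\text{for } 0\le k\le d-1.$$ Then every simplicial $d$-polytope $P$ in $X$ satisfies $$\sum_{j=k}^{d-1}(-1)^j\binom{j+1}{k+1}\alpha_j(P)=(-1)^d\left(\alpha_k(P)-f_k(P)\right)\qquad\text{for } 0\le k\le d-1.$$
   Context: A $d$-polytope in $\mathbb{E}^d$ or $\mathbb{H}^d$ is a bounded intersection, with nonempty interior, of finitely many closed half-spaces; a spherical $d$-polytope is the intersection of $\mathbb{S}^d\subset\mathbb{R}^{d+1}$ with a full-dimensional pointed polyhedral cone (finite intersection of closed linear half-spaces whose bounding hyperplanes meet only at the origin). A polytope is simplicial if all its facets are simplices (of the same geometry). $f_i(P)$ is the number of $i$-faces. For a nonempty face $F$ of $P$, the interior angle $\alpha(F,P)$ is the fraction of a sufficiently small intrinsic $(d-1)$-sphere (set of points equidistant from its center), centered at a point of the relative interior of $F$, that lies in $P$; $\alpha_i(P)$ is the sum of $\alpha(F,P)$ over all $i$-faces $F$ of $P$, $0\le i\le d$. *)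

theory Defs
  imports "HOL-Analysis.Analysis"
begin

text \<open>
  The three geometries of dimension \<open>d = DIM('a)\<close> are realised inside the vector space
  \<open>'a \<times> real\<close> of dimension \<open>d + 1\<close>: Euclidean space as the affine hyperplane at height 1,
  spherical space as the unit sphere, hyperbolic space as the upper sheet of the hyperboloid.
  In each model the \<open>k\<close>-dimensional (great, affine, hyperbolic) subspaces are the nonempty
  intersections with \<open>(k+1)\<close>-dimensional linear subspaces.
\<close>

datatype geometry = Euclidean | Spherical | Hyperbolic

fun points :: "geometry \<Rightarrow> ('a::euclidean_space \<times> real) set" where
  "points Euclidean = {p. snd p = 1}"
| "points Spherical = sphere 0 1"
| "points Hyperbolic = {p. snd p > 0 \<and> fst p \<bullet> fst p - (snd p)\<^sup>2 = -1}"

fun gdist :: "geometry \<Rightarrow> ('a::euclidean_space \<times> real) \<Rightarrow> ('a \<times> real) \<Rightarrow> real" where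
  "gdist Euclidean p q = dist p q"
| "gdist Spherical p q = arccos (p \<bullet> q)"
| "gdist Hyperbolic p q = arcosh (snd p * snd q - fst p \<bullet> fst q)"


subsection \<open>Polytopes, simplices and faces\<close>

text \<open>
  The requirement that the bounding hyperplane meets \<open>X\<close> excludes those linear functionals
  that have constant sign on \<open>X\<close> (vertical normals in the Euclidean case, normals that are not
  spacelike in the hyperbolic case) and hence do not bound a half-space of \<open>X\<close>.
\<close>

definition closed_half_space :: "geometry \<Rightarrow> ('a::euclidean_space \<times> real) set \<Rightarrow> bool" where
  "closed_half_space X H \<longleftrightarrow>
     (\<exists>a. a \<noteq> 0 \<and> (\<exists>p\<in>points X. a \<bullet> p = 0) \<and> H = {p \<in> points X. a \<bullet> p \<le> 0})"

definition bounded_polytope :: "geometry \<Rightarrow> ('a::euclidean_space \<times> real) set \<Rightarrow> bool" where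
  "bounded_polytope X P \<longleftrightarrow>
     (\<exists>\<H>. finite \<H> \<and> (\<forall>H\<in>\<H>. closed_half_space X H) \<and> P = points X \<inter> \<Inter>\<H>) \<and>
     (\<exists>x\<in>points X. \<exists>r. \<forall>p\<in>P. gdist X x p \<le> r) \<and>
     (top_of_set (points X)) interior_of P \<noteq> {}"

definition spherical_polytope :: "('a::euclidean_space \<times> real) set \<Rightarrow> bool" where
  "spherical_polytope P \<longleftrightarrow>
     (\<exists>N. finite N \<and> 0 \<notin> N \<and>
          {p. \<forall>a\<in>N. a \<bullet> p = 0} = {0} \<and>
          interior {p. \<forall>a\<in>N. a \<bullet> p \<le> 0} \<noteq> {} \<and>
          P = points Spherical \<inter> {p. \<forall>a\<in>N. a \<bullet> p \<le> 0})"

fun gpolytope :: "geometry \<Rightarrow> ('a::euclidean_space \<times> real) set \<Rightarrow> bool" where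
  "gpolytope Euclidean P = bounded_polytope Euclidean P"
| "gpolytope Spherical P = spherical_polytope P"
| "gpolytope Hyperbolic P = bounded_polytope Hyperbolic P"

text \<open>
  Points of \<open>X\<close> are in general position precisely if they are linearly independent in
  \<open>'a \<times> real\<close>, and their convex hull in \<open>X\<close> is the trace of the cone they generate.
\<close>

definition gsimplex :: "geometry \<Rightarrow> nat \<Rightarrow> ('a::euclidean_space \<times> real) set \<Rightarrow> bool" where
  "gsimplex X k S \<longleftrightarrow>
     (\<exists>V. V \<subseteq> points X \<and> independent V \<and> card V = k + 1 \<and>
          S = points X \<inter> convex_cone hull V)"

text \<open>
  Nonempty faces are the nonempty intersections with supporting hyperplanes; the choice
  \<open>a = 0\<close> contributes \<open>P\<close> itself. The dimension of a face in \<open>X\<close> is one less than the dimension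
  of its linear span.
\<close>

definition nonempty_face :: "('a::euclidean_space \<times> real) set \<Rightarrow> ('a \<times> real) set \<Rightarrow> bool" where
  "nonempty_face F P \<longleftrightarrow> F \<noteq> {} \<and> (\<exists>a. (\<forall>p\<in>P. a \<bullet> p \<le> 0) \<and> F = {p \<in> P. a \<bullet> p = 0})"

definition faces :: "nat \<Rightarrow> ('a::euclidean_space \<times> real) set \<Rightarrow> ('a \<times> real) set set" where
  "faces i P = {F. nonempty_face F P \<and> dim F = i + 1}"

definition num_faces :: "nat \<Rightarrow> ('a::euclidean_space \<times> real) set \<Rightarrow> nat" where
  "num_faces i P = card (faces i P)"

definition simplicial_polytope :: "geometry \<Rightarrow> ('a::euclidean_space \<times> real) set \<Rightarrow> bool" where
  "simplicial_polytope X P \<longleftrightarrow>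
     gpolytope X P \<and> (\<forall>F\<in>faces (DIM('a) - 1) P. gsimplex X (DIM('a) - 1) F)"


subsection \<open>Interior angles\<close>

text \<open>
  Intrinsic \<open>d\<close>-dimensional volume of \<open>B \<subseteq> points X\<close>. On the sphere this is polar integration.
  On the hyperboloid it is the same computation, since Lorentz transformations preserve Lebesgue
  measure; at height 1 it is the volume formula for a pyramid.
\<close>

definition gvolume :: "('a::euclidean_space \<times> real) set \<Rightarrow> real" where
  "gvolume B = (DIM('a) + 1) * measure lebesgue {t *\<^sub>R p | t p. 0 \<le> t \<and> t \<le> 1 \<and> p \<in> B}"

definition geodesic_segment ::
    "geometry \<Rightarrow> ('a::euclidean_space \<times> real) \<Rightarrow> ('a \<times> real) \<Rightarrow> ('a \<times> real) set" where
  "geodesic_segment X x y = points X \<inter> convex_cone hull {x, y}"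

definition gsphere ::
    "geometry \<Rightarrow> ('a::euclidean_space \<times> real) \<Rightarrow> real \<Rightarrow> ('a \<times> real) set" where
  "gsphere X x r = {y \<in> points X. gdist X x y = r}"

text \<open>
  The fraction of the sphere of radius \<open>r\<close> about \<open>x\<close> that lies in \<open>P\<close>, with respect to the
  \<open>(d-1)\<close>-dimensional area, expressed as a cone measure: a part \<open>A\<close> of the sphere is measured by
  the volume swept out by the geodesic radii ending in \<open>A\<close>. By integration in geodesic polar
  coordinates about \<open>x\<close> this volume is a constant (depending on \<open>r\<close> only) times the area of \<open>A\<close>;
  equivalently, it is the rotation-invariant probability measure on the sphere. For \<open>d = 1\<close> the
  sphere consists of two points, each of measure 1/2.
\<close>

definition sphere_fraction ::
    "geometry \<Rightarrow> ('a::euclidean_space \<times> real) \<Rightarrow> real \<Rightarrow> ('a \<times> real) set \<Rightarrow> real" where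
  "sphere_fraction X x r P =
     gvolume (\<Union>y \<in> gsphere X x r \<inter> P. geodesic_segment X x y) /
     gvolume (\<Union>y \<in> gsphere X x r. geodesic_segment X x y)"

definition rel_interior_in ::
    "geometry \<Rightarrow> ('a::euclidean_space \<times> real) set \<Rightarrow> ('a \<times> real) set" where
  "rel_interior_in X F = (top_of_set (points X \<inter> span F)) interior_of F"

text \<open>
  For a face \<open>F\<close> of a polytope the fraction is constant for all sufficiently small radii, and this
  constant does not depend on which point of the relative interior of \<open>F\<close> is taken as centre.
\<close>

definition interior_angle ::
    "geometry \<Rightarrow> ('a::euclidean_space \<times> real) set \<Rightarrow> ('a \<times> real) set \<Rightarrow> real" where
  "interior_angle X F P =
     (let x = (SOME x. x \<in> rel_interior_in X F)
      in THE c. \<forall>\<^sub>F r in at_right 0. sphere_fraction X x r P = c)"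

definition angle_sum :: "geometry \<Rightarrow> nat \<Rightarrow> ('a::euclidean_space \<times> real) set \<Rightarrow> real" where
  "angle_sum X i P = (\<Sum>F\<in>faces i P. interior_angle X F P)"

end

theory Submission
  imports Defs
begin

text \<open>
  Star the polytope from an interior point \<open>c\<close>: the simplices \<open>conv (c, G)\<close> over the facets \<open>G\<close>
  tile \<open>P\<close>. Around a boundary face the angles of these simplices add up to the angle of \<open>P\<close>, and
  around a face through \<open>c\<close> they add up to 1. Summing the relations of the simplices therefore
  gives the relation for \<open>P\<close>, up to a linear identity between the face numbers of \<open>P\<close> that follows
  from the Dehn--Sommerville equations.

  Both the additivity of angles and the Dehn--Sommerville equations come from one fact about the
  triangulation: from a relative interior point of one of its faces, a generic vector that points
  into \<open>P\<close> points into exactly one simplex. All geometry takes place in the linear space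
  \<open>'a \<times> real\<close>, where polytopes are traces of polyhedral cones.
\<close>

subsection \<open>Simplicial cones and their dual bases\<close>

text \<open>A face of the star lies in the boundary or contains \<open>c\<close>, so summing over
  the simplices misses the relation for \<open>P\<close> by an alternating sum of the numbers
  \<open>n j\<close> of boundary vertex sets of size \<open>j\<close>, weighted by binomial(j+1,
  k+1). Pascal's rule splits this sum into two Dehn-Sommerville sums, with binomial(j, k) and
  binomial(j, k+1). The symmetry behind those equations is the reversal of a generic vector:
  \<open>w\<close> and \<open>- w\<close> cut the boundary complex into opposite families of
  intervals, so no shelling has to be constructed.

  The obstacle is metric: angles are fractions of small geodesic spheres about a centre given only
  by choice, in three geometries. A volume-preserving linear map carries the pole to the centre, and
  the fraction becomes the part of a Euclidean unit ball that lies in a slice of the tangent cone.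
  Additivity of angles is then additivity of Lebesgue measure, because the directions that are not
  generic form a null set.\<close>

definition dual :: "'b::euclidean_space set \<Rightarrow> 'b \<Rightarrow> 'b" where
  "dual B v = (SOME a. a \<bullet> v = 1 \<and> (\<forall>w\<in>B - {v}. a \<bullet> w = 0))"

text \<open>The coordinate functional of \<open>v\<close> extends linearly to the whole space and is
  represented there by a vector, namely \<open>adjoint f 1\<close>. Off \<open>span B\<close> the
  choice is arbitrary, so later criteria restrict to the span or assume a basis.\<close>

lemma dual:
  fixes B :: "'b::euclidean_space set"
  assumes "independent B" "v \<in> B" "w \<in> B"
  shows "dual B v \<bullet> w = of_bool (w = v)"
proof -
  obtain f :: "'b \<Rightarrow> real" where f: "linear f" "\<forall>w\<in>B. f w = of_bool (w = v)"
    using linear_independent_extend[OF assms(1), of "\<lambda>w. of_bool (w = v)"] by blast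
  have "\<exists>a. \<forall>x. f x = a \<bullet> x"
  proof (intro exI allI)
    fix x
    show "f x = adjoint f 1 \<bullet> x"
      using adjoint_works[OF f(1), of x 1] by (simp add: inner_commute)
  qed
  then obtain a where a: "\<And>x. f x = a \<bullet> x" by blast
  have "\<exists>a. a \<bullet> v = 1 \<and> (\<forall>w\<in>B - {v}. a \<bullet> w = 0)"
    using f a assms(2) by (intro exI[of _ a]) auto
  from someI_ex[OF this, folded dual_def] show ?thesis using assms by auto
qed

lemma dual_sum:
  fixes B :: "'b::euclidean_space set"
  assumes "independent B" "v \<in> B" "A \<subseteq> B"
  shows "dual B v \<bullet> (\<Sum>w\<in>A. u w *\<^sub>R w) = (if v \<in> A then u v else 0)"
proof -
  have fin: "finite A" using assms finiteI_independent finite_subset by blast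
  have "dual B v \<bullet> (\<Sum>w\<in>A. u w *\<^sub>R w) = (\<Sum>w\<in>A. if w = v then u w else 0)"
    unfolding inner_sum_right using assms
    by (intro sum.cong) (auto simp: dual subset_iff)
  then show ?thesis using fin by (simp add: sum.delta')
qed

lemma dual_expansion:
  fixes B :: "'b::euclidean_space set"
  assumes "independent B" "p \<in> span B"
  shows "p = (\<Sum>v\<in>B. (dual B v \<bullet> p) *\<^sub>R v)"
proof -
  have fin: "finite B" using assms finiteI_independent by blast
  obtain u where u: "p = (\<Sum>v\<in>B. u v *\<^sub>R v)"
    using assms(2) span_finite[OF fin] by auto
  have "dual B v \<bullet> p = u v" if "v \<in> B" for v
    using dual_sum[OF assms(1) that order_refl, of u] that by (simp add: u)
  then show ?thesis by (subst u) (auto intro: sum.cong)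
qed

lemma convex_cone_hull_sum:
  assumes "finite A" "\<And>v. v \<in> A \<Longrightarrow> v \<in> V" "\<And>v. v \<in> A \<Longrightarrow> 0 \<le> u v"
  shows "(\<Sum>v\<in>A. u v *\<^sub>R v) \<in> convex_cone hull V"
  using assms
  by (induction A rule: finite_induct)
     (simp_all add: convex_cone_hull_contains_0 convex_cone_hull_add convex_cone_hull_mul hull_inc)

lemma mem_convex_cone_hull_iff:
  fixes B :: "'b::euclidean_space set"
  assumes "independent B"
  shows "p \<in> convex_cone hull B \<longleftrightarrow> p \<in> span B \<and> (\<forall>v\<in>B. 0 \<le> dual B v \<bullet> p)"
proof
  have fin: "finite B" using assms finiteI_independent by blast
  let ?C = "{p \<in> span B. \<forall>v\<in>B. 0 \<le> dual B v \<bullet> p}"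
  have "convex_cone ?C"
    by (auto simp: convex_cone_iff inner_right_distrib span_add span_mul span_zero)
  moreover have "B \<subseteq> ?C" using assms by (auto simp: dual span_base)
  ultimately have "convex_cone hull B \<subseteq> ?C" by (simp add: hull_minimal)
  then show "p \<in> convex_cone hull B \<Longrightarrow> p \<in> span B \<and> (\<forall>v\<in>B. 0 \<le> dual B v \<bullet> p)" by blast
  show "p \<in> span B \<and> (\<forall>v\<in>B. 0 \<le> dual B v \<bullet> p) \<Longrightarrow> p \<in> convex_cone hull B"
    using convex_cone_hull_sum[OF fin, of B "\<lambda>v. dual B v \<bullet> p"] dual_expansion[OF assms, of p]
    by auto
qed

lemma mem_convex_cone_hull_subset_iff:
  fixes B :: "'b::euclidean_space set"
  assumes "independent B" "W \<subseteq> B"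
  shows "p \<in> convex_cone hull W \<longleftrightarrow> p \<in> convex_cone hull B \<and> (\<forall>v\<in>B - W. dual B v \<bullet> p = 0)"
proof
  assume p: "p \<in> convex_cone hull W"
  have W: "independent W" using assms independent_mono by blast
  have "p = (\<Sum>v\<in>W. (dual W v \<bullet> p) *\<^sub>R v)"
    using p mem_convex_cone_hull_iff[OF W] dual_expansion[OF W] by blast
  then have "dual B v \<bullet> p = 0" if "v \<in> B - W" for v
    using dual_sum[OF assms(1) _ assms(2), of v "\<lambda>v. dual W v \<bullet> p"] that by auto
  then show "p \<in> convex_cone hull B \<and> (\<forall>v\<in>B - W. dual B v \<bullet> p = 0)"
    using p hull_mono[OF assms(2)] by blast
next
  have fin: "finite B" using assms finiteI_independent by blast
  assume p: "p \<in> convex_cone hull B \<and> (\<forall>v\<in>B - W. dual B v \<bullet> p = 0)"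
  have "p = (\<Sum>v\<in>B. (dual B v \<bullet> p) *\<^sub>R v)"
    using p mem_convex_cone_hull_iff[OF assms(1)] dual_expansion[OF assms(1)] by blast
  also have "\<dots> = (\<Sum>v\<in>W. (dual B v \<bullet> p) *\<^sub>R v)"
    using p assms fin by (intro sum.mono_neutral_right) auto
  also have "\<dots> \<in> convex_cone hull W"
    using p assms mem_convex_cone_hull_iff[OF assms(1)] fin
    by (intro convex_cone_hull_sum) (auto intro: finite_subset)
  finally show "p \<in> convex_cone hull W" .
qed

text \<open>A sum of nonnegative coordinates vanishes only if each of them does, so the negated sum
  of the dual vectors of the missing generators is one functional that cuts out the face.\<close>

lemma convex_cone_hull_exposed:
  fixes B :: "'b::euclidean_space set"
  assumes "independent B" "W \<subseteq> B"
  defines "b \<equiv> - (\<Sum>v\<in>B - W. dual B v)"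
  shows "p \<in> convex_cone hull B \<Longrightarrow> b \<bullet> p \<le> 0"
    and "convex_cone hull W = convex_cone hull B \<inter> {p. b \<bullet> p = 0}"
proof -
  have fin: "finite B" using assms finiteI_independent by blast
  have b: "b \<bullet> p = - (\<Sum>v\<in>B - W. dual B v \<bullet> p)" for p
    by (simp add: b_def inner_sum_left)
  show "b \<bullet> p \<le> 0" if "p \<in> convex_cone hull B" for p
    using that mem_convex_cone_hull_iff[OF assms(1)] by (auto simp: b intro!: sum_nonneg)
  have "b \<bullet> p = 0 \<longleftrightarrow> (\<forall>v\<in>B - W. dual B v \<bullet> p = 0)" if "p \<in> convex_cone hull B" for p
    unfolding b neg_equal_0_iff_equal using that mem_convex_cone_hull_iff[OF assms(1)] fin
    by (intro sum_nonneg_eq_0_iff) auto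
  then show "convex_cone hull W = convex_cone hull B \<inter> {p. b \<bullet> p = 0}"
    using mem_convex_cone_hull_subset_iff[OF assms(1,2)] by blast
qed

lemma convex_cone_hull_face_of:
  fixes B :: "'b::euclidean_space set"
  assumes "independent B" "W \<subseteq> B"
  shows "convex_cone hull W face_of convex_cone hull B"
  unfolding convex_cone_hull_exposed(2)[OF assms]
  by (rule face_of_Int_supporting_hyperplane_le[OF convex_convex_cone_hull])
     (use convex_cone_hull_exposed(1)[OF assms] in blast)

lemma mem_simplicial_cone_iff:
  fixes B :: "'b::euclidean_space set"
  assumes "independent B" "card B = DIM('b)"
  shows "p \<in> convex_cone hull B \<longleftrightarrow> (\<forall>v\<in>B. 0 \<le> dual B v \<bullet> p)"
proof -
  have "span B = UNIV"
    using assms by (metis dim_eq_full dim_eq_card_independent)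
  then show ?thesis using mem_convex_cone_hull_iff[OF assms(1)] by simp
qed

text \<open>\<open>x + y\<close> is the midpoint of \<open>2 *\<^sub>R x\<close> and
  \<open>2 *\<^sub>R y\<close>, which puts \<open>2 *\<^sub>R x\<close> into the face; halving
  towards 0, which also lies in the face, returns to \<open>x\<close>. For \<open>x = y\<close> the
  open segment is empty, hence the separate case.\<close>

lemma summand_in_face_of_cone:
  assumes F: "F face_of C" and C: "convex_cone C" and x: "x \<in> C" "y \<in> C" "x + y \<in> F"
  shows "x \<in> F"
proof (cases "x = y")
  case True
  have F0: "0 \<in> F"
  proof (cases "x + y = 0")
    case False
    have "0 \<in> C" "2 *\<^sub>R (x + y) \<in> C" 
      using C x by (auto simp: convex_cone_iff)
    moreover have "x + y \<in> open_segment 0 (2 *\<^sub>R (x + y))"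
      using False unfolding in_segment by (intro conjI exI[of _ "1/2"]) auto
    ultimately show ?thesis using F x(3) unfolding face_of_def by blast
  qed (use x in simp)
  have "convex F" using F face_of_imp_convex by blast
  then have "(1/2) *\<^sub>R 0 + (1/2) *\<^sub>R (x + y) \<in> F"
    using F0 x(3) by (intro convexD) auto
  also have "(1/2) *\<^sub>R 0 + (1/2) *\<^sub>R (x + y) = x"
    using True by (simp flip: scaleR_2)
  finally show ?thesis .
next
  case False
  have *: "2 *\<^sub>R x \<in> C" "2 *\<^sub>R y \<in> C" using C x by (auto simp: convex_cone_iff)
  have "x + y \<in> open_segment (2 *\<^sub>R x) (2 *\<^sub>R y)"
    using False unfolding in_segment by (intro conjI exI[of _ "1/2"]) auto
  then have F2: "2 *\<^sub>R x \<in> F" using * F x(3) unfolding face_of_def by blast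
  have F0: "0 \<in> F"
  proof (cases "x = 0")
    case False
    have "0 \<in> C" "4 *\<^sub>R x \<in> C" 
      using C x by (auto simp: convex_cone_iff)
    moreover have "2 *\<^sub>R x \<in> open_segment 0 (4 *\<^sub>R x)"
      using False unfolding in_segment by (intro conjI exI[of _ "1/2"]) auto
    ultimately show ?thesis using F F2 unfolding face_of_def by blast
  qed (use F2 in simp)
  have "convex F" using F face_of_imp_convex by blast
  then have "(1/2) *\<^sub>R 0 + (1/2) *\<^sub>R (2 *\<^sub>R x) \<in> F"
    using F0 F2 by (intro convexD) auto
  then show ?thesis by simp
qed

subsection \<open>Starring a cone with simplicial facets\<close>

text \<open>\<open>\<G>\<close> holds the generator sets of the facets, not the facets themselves.
  Generators matter only up to positive multiples; \<open>normalized\<close> fixes one per extreme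
  ray, so that facets sharing a ray share a vertex. \<open>- c \<notin> K\<close> makes every line
  in direction \<open>c\<close> leave \<open>K\<close> backwards.\<close>

locale simplicial_cone =
  fixes K :: "'b::euclidean_space set" and \<G> :: "'b set set" and c :: 'b
  assumes polyhedron: "polyhedron K" and convex_cone: "convex_cone K"
    and c: "c \<in> interior K" "- c \<notin> K"
    and finite_facets: "finite \<G>"
    and indep: "G \<in> \<G> \<Longrightarrow> independent G"
    and card_facet: "G \<in> \<G> \<Longrightarrow> card G + 1 = DIM('b)"
    and facet: "G \<in> \<G> \<Longrightarrow> convex_cone hull G facet_of K"
    and facet_cases: "F facet_of K \<Longrightarrow> \<exists>G\<in>\<G>. F = convex_cone hull G"
    and normalized: "v \<in> \<Union>\<G> \<Longrightarrow> t > 0 \<Longrightarrow> t *\<^sub>R v \<in> \<Union>\<G> \<Longrightarrow> t = 1"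
begin

lemma facet_normal:
  assumes "G \<in> \<G>"
  obtains a where "a \<bullet> c < 0" "\<And>p. p \<in> K \<Longrightarrow> a \<bullet> p \<le> 0"
    "\<And>p. p \<in> convex_cone hull G \<longleftrightarrow> p \<in> K \<and> a \<bullet> p = 0"
proof -
  let ?F = "convex_cone hull G"
  have "?F exposed_face_of K"
    using facet[OF assms] polyhedron facet_of_imp_face_of exposed_face_of_polyhedron by blast
  moreover have "?F \<noteq> {}" by (rule convex_cone_hull_nonempty)
  moreover have "?F \<noteq> K" using facet[OF assms] by (metis facet_of_irrefl)
  ultimately obtain a b where a: "a \<noteq> 0" "K \<subseteq> {x. a \<bullet> x \<le> b}" "?F = K \<inter> {x. a \<bullet> x = b}"
    unfolding exposed_face_of by blast
  have "0 \<in> ?F" by (rule convex_cone_hull_contains_0)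
  then have b: "b = 0" using a by auto
  obtain e where e: "e > 0" "ball c e \<subseteq> K" using c(1) mem_interior by blast
  \<comment> \<open>A step of length \<open>e / 2\<close> along the normal stays in
    \<open>K\<close>, so the functional is still nonpositive there and must have been strictly
    negative at \<open>c\<close>.\<close>
  have "c + (e / (2 * norm a)) *\<^sub>R a \<in> ball c e"
    using e a(1) by (simp add: dist_norm)
  then have "a \<bullet> (c + (e / (2 * norm a)) *\<^sub>R a) \<le> 0" using e a(2) b by auto
  moreover have "(e / (2 * norm a)) * (a \<bullet> a) > 0" using e a(1) by simp
  ultimately have "a \<bullet> c < 0" by (simp add: inner_right_distrib)
  then show thesis using a b by (intro that[of a]) auto
qed

section \<open>Position of points relative to the starred simplices\<close>

lemma c_notin_facet: "G \<in> \<G> \<Longrightarrow> c \<notin> G"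
  by (metis facet_normal hull_inc less_irrefl)

lemma facet_hull_subset: "G \<in> \<G> \<Longrightarrow> convex_cone hull G \<subseteq> K"
  using facet facet_of_imp_subset by blast

lemma independent_insert_c:
  assumes "G \<in> \<G>" shows "independent (insert c G)"
proof -
  obtain a where a: "a \<bullet> c < 0" "\<And>p. p \<in> convex_cone hull G \<longleftrightarrow> p \<in> K \<and> a \<bullet> p = 0"
    using facet_normal[OF assms] by metis
  have "span G \<subseteq> {p. a \<bullet> p = 0}"
    using a(2) by (intro span_minimal subspace_hyperplane) (auto intro: hull_inc)
  then have "c \<notin> span G" using a(1) by auto
  then show ?thesis using indep[OF assms] by (simp add: independent_insert)
qed

lemma card_insert_c: "G \<in> \<G> \<Longrightarrow> card (insert c G) = DIM('b)"
  using c_notin_facet card_facet finiteI_independent[OF indep] by simp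

lemma hull_insert_c_iff:
  "G \<in> \<G> \<Longrightarrow> p \<in> convex_cone hull (insert c G) \<longleftrightarrow> (\<forall>v\<in>insert c G. 0 \<le> dual (insert c G) v \<bullet> p)"
  by (rule mem_simplicial_cone_iff[OF independent_insert_c card_insert_c])

lemma hull_insert_c_subset: "G \<in> \<G> \<Longrightarrow> convex_cone hull (insert c G) \<subseteq> K"
  using convex_cone facet_hull_subset c(1) interior_subset
  by (intro hull_minimal) (auto intro: hull_inc)

lemma hull_insert_c_decompose:
  assumes "G \<in> \<G>" "p \<in> convex_cone hull (insert c G)"
  obtains q \<mu> where "q \<in> convex_cone hull G" "\<mu> \<ge> 0" "p = q + \<mu> *\<^sub>R c"
proof -
  let ?d = "dual (insert c G)"
  have ge: "\<forall>v\<in>insert c G. 0 \<le> ?d v \<bullet> p" using assms hull_insert_c_iff by blast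
  have "p = (\<Sum>v\<in>insert c G. (?d v \<bullet> p) *\<^sub>R v)"
    using dual_expansion[OF independent_insert_c[OF assms(1)]] assms(2)
      mem_convex_cone_hull_iff[OF independent_insert_c[OF assms(1)]] by blast
  also have "\<dots> = (\<Sum>v\<in>G. (?d v \<bullet> p) *\<^sub>R v) + (?d c \<bullet> p) *\<^sub>R c"
    using c_notin_facet[OF assms(1)] finiteI_independent[OF indep[OF assms(1)]] by simp
  finally show thesis
    using ge finiteI_independent[OF indep[OF assms(1)]]
    by (intro that[of "\<Sum>v\<in>G. (?d v \<bullet> p) *\<^sub>R v" "?d c \<bullet> p"] convex_cone_hull_sum) auto
qed

text \<open>A line in direction \<open>c\<close> meets the boundary only once. The normal of the
  facet holding one of the points vanishes there, is nonpositive at the other and negative at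
  \<open>c\<close>, which compares the two multiples of \<open>c\<close>; the second facet gives the
  reverse comparison.\<close>

lemma boundary_decomposition_unique:
  assumes "G \<in> \<G>" "G' \<in> \<G>" "p \<in> convex_cone hull G" "p' \<in> convex_cone hull G'"
    and eq: "p + \<mu> *\<^sub>R c = p' + \<mu>' *\<^sub>R c"
  shows "p = p'"
proof -
  have le: "\<nu> \<le> \<nu>'" if "H \<in> \<G>" "q' \<in> K" "q \<in> convex_cone hull H" "q + \<nu>' *\<^sub>R c = q' + \<nu> *\<^sub>R c"
    for H q q' \<nu> \<nu>'
  proof -
    obtain a where a: "a \<bullet> c < 0" "\<And>p. p \<in> K \<Longrightarrow> a \<bullet> p \<le> 0"
      "\<And>p. p \<in> convex_cone hull H \<longleftrightarrow> p \<in> K \<and> a \<bullet> p = 0"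
      using facet_normal[OF \<open>H \<in> \<G>\<close>] by metis
    have "a \<bullet> (q + \<nu>' *\<^sub>R c) = a \<bullet> (q' + \<nu> *\<^sub>R c)" using that by simp
    then have "(\<nu>' - \<nu>) * (a \<bullet> c) \<le> 0"
      using a(2)[OF that(2)] a(3)[of q] that(3) by (simp add: inner_right_distrib left_diff_distrib)
    then show ?thesis using a(1) by (simp add: mult_le_0_iff)
  qed
  have "\<mu> = \<mu>'"
    using le[OF assms(1) _ assms(3) eq] le[OF assms(2) _ assms(4) eq[symmetric]]
      assms facet_hull_subset by (meson antisym subsetD)
  then show ?thesis using eq by simp
qed

text \<open>
  A vertex \<open>v\<close> of a facet spans an extreme ray of \<open>K\<close>, so it can lie in another facet only as one of
  the normalized generators.
\<close>

lemma facet_contains_support: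
  assumes "G \<in> \<G>" "G' \<in> \<G>" "W \<subseteq> G" "\<And>v. v \<in> W \<Longrightarrow> 0 < u v"
    and mem: "(\<Sum>v\<in>W. u v *\<^sub>R v) \<in> convex_cone hull G'"
  shows "W \<subseteq> G'"
proof
  fix v assume v: "v \<in> W"
  obtain a where a: "\<And>p. p \<in> K \<Longrightarrow> a \<bullet> p \<le> 0"
      "\<And>p. p \<in> convex_cone hull G' \<longleftrightarrow> p \<in> K \<and> a \<bullet> p = 0"
    using facet_normal[OF \<open>G' \<in> \<G>\<close>] by metis
  have finW: "finite W" using assms finiteI_independent[OF indep] finite_subset by blast
  have WK: "w \<in> K" if "w \<in> W" for w
    using that assms facet_hull_subset hull_inc by (metis subsetD)
  \<comment> \<open>The point lies on the facet hyperplane while every generator has nonpositive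
    value and positive weight, so each generator lies on that hyperplane.\<close>
  have "(\<Sum>w\<in>W. - (u w * (a \<bullet> w))) = 0"
    using a(2) mem by (simp add: inner_sum_right sum_negf)
  moreover have "0 \<le> - (u w * (a \<bullet> w))" if "w \<in> W" for w
    using a(1)[OF WK[OF that]] assms(4)[OF that] by (simp add: mult_nonneg_nonpos)
  ultimately have "u v * (a \<bullet> v) = 0" using finW v by (simp add: sum_nonneg_eq_0_iff)
  then have "a \<bullet> v = 0" using assms(4)[OF v] by simp
  then have vG': "v \<in> convex_cone hull G'" using a(2) WK v by blast
  let ?d = "dual G'"
  have fin: "finite G'" using assms finiteI_independent[OF indep] by blast
  have ge: "\<forall>w\<in>G'. 0 \<le> ?d w \<bullet> v" and v_eq: "v = (\<Sum>w\<in>G'. (?d w \<bullet> v) *\<^sub>R w)"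
    using vG' mem_convex_cone_hull_iff[OF indep[OF assms(2)]] dual_expansion[OF indep[OF assms(2)]]
    by blast+
  have v0: "v \<noteq> 0" using v assms indep dependent_zero by blast
  obtain w where w: "w \<in> G'" "?d w \<bullet> v \<noteq> 0"
    using v0 v_eq by (metis (no_types, lifting) scaleR_eq_0_iff sum.neutral)
  have "convex_cone hull {v} face_of convex_cone hull G"
    using v assms indep by (intro convex_cone_hull_face_of) auto
  then have face: "convex_cone hull {v} face_of K"
    using face_of_trans facet[OF assms(1)] facet_of_imp_face_of by blast
  \<comment> \<open>Some coordinate of \<open>v\<close> with respect to \<open>G'\<close> is
    nonzero. The corresponding summand must lie on the extreme ray of \<open>v\<close>, so the
    generator \<open>w\<close> is a positive multiple of \<open>v\<close>.\<close>
  have "(?d w \<bullet> v) *\<^sub>R w \<in> convex_cone hull {v}"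
  proof (rule summand_in_face_of_cone[OF face convex_cone])
    show "(?d w \<bullet> v) *\<^sub>R w \<in> K"
      using ge w facet_hull_subset[OF assms(2)] convex_cone hull_inc[of w G' convex_cone]
      by (auto intro!: convex_cone_scaleR)
    show "(\<Sum>w\<in>G' - {w}. (?d w \<bullet> v) *\<^sub>R w) \<in> K"
      using ge fin facet_hull_subset[OF assms(2)]
      by (auto intro!: subsetD[OF facet_hull_subset[OF assms(2)]] convex_cone_hull_sum)
    show "(?d w \<bullet> v) *\<^sub>R w + (\<Sum>w\<in>G' - {w}. (?d w \<bullet> v) *\<^sub>R w) \<in> convex_cone hull {v}"
      using v_eq hull_inc[of v "{v}" convex_cone] sum.remove[OF fin w(1), of "\<lambda>w. (?d w \<bullet> v) *\<^sub>R w"]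
      by simp
  qed
  moreover have "independent {v}" using v0 by simp
  ultimately obtain s where s: "s \<ge> 0" "(?d w \<bullet> v) *\<^sub>R w = s *\<^sub>R v"
    using mem_convex_cone_hull_iff[of "{v}"] dual_expansion[of "{v}"] by fastforce
  have pos: "?d w \<bullet> v > 0" using ge w by (simp add: order_less_le)
  then have w_eq: "w = (s / (?d w \<bullet> v)) *\<^sub>R v"
    using s(2) by (metis (no_types, opaque_lifting) divide_inverse_commute less_irrefl scaleR_one
        left_inverse scaleR_scaleR)
  have "w \<noteq> 0" using w assms indep dependent_zero by blast
  then have "s \<noteq> 0" using w_eq by auto
  then have "s / (?d w \<bullet> v) > 0" using pos s(1) by simp
  then have "s / (?d w \<bullet> v) = 1"
    using w_eq normalized[of v "s / (?d w \<bullet> v)"] v w assms by auto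
  then show "v \<in> G'" using w_eq w by simp
qed

text \<open>Stripping the multiple of \<open>c\<close> from a point leaves the same boundary point
  whichever simplex is used, which reduces the claim to facets.\<close>

lemma simplex_contains_support:
  assumes "G \<in> \<G>" "G' \<in> \<G>" "W \<subseteq> insert c G" "\<And>v. v \<in> W \<Longrightarrow> 0 < u v"
    and mem: "(\<Sum>v\<in>W. u v *\<^sub>R v) \<in> convex_cone hull (insert c G')"
  shows "W \<subseteq> insert c G'"
proof -
  have fin: "finite W"
    using assms finiteI_independent[OF independent_insert_c] finite_subset by blast
  let ?p = "\<Sum>v\<in>W - {c}. u v *\<^sub>R v"
  obtain \<mu> where \<mu>: "(\<Sum>v\<in>W. u v *\<^sub>R v) = ?p + \<mu> *\<^sub>R c"
  proof (cases "c \<in> W")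
    case True
    then show thesis using fin that[of "u c"] by (simp add: sum.remove add.commute)
  next
    case False
    then show thesis using that[of 0] by simp
  qed
  obtain q \<nu> where q: "q \<in> convex_cone hull G'" "(\<Sum>v\<in>W. u v *\<^sub>R v) = q + \<nu> *\<^sub>R c"
    using hull_insert_c_decompose[OF assms(2) mem] by metis
  have "?p \<in> convex_cone hull G"
    using assms fin by (intro convex_cone_hull_sum) (auto simp: less_imp_le)
  then have "?p = q"
    using boundary_decomposition_unique[OF assms(1,2) _ q(1)] \<mu> q(2) by metis
  then have "W - {c} \<subseteq> G'"
    using assms q(1) by (intro facet_contains_support[of G G' _ u]) auto
  then show ?thesis by blast
qed

text \<open>A point with all coordinates positive has the full vertex set as support, so the other
  simplex contains all these vertices; equal cardinalities do the rest.\<close>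

lemma open_simplices_disjoint:
  assumes "G \<in> \<G>" "G' \<in> \<G>" "q \<in> convex_cone hull (insert c G')"
    and "\<And>v. v \<in> insert c G \<Longrightarrow> 0 < dual (insert c G) v \<bullet> q"
  shows "G = G'"
proof -
  have "q \<in> convex_cone hull (insert c G)"
    using assms(4) by (simp add: hull_insert_c_iff[OF assms(1)] less_imp_le)
  then have "q = (\<Sum>v\<in>insert c G. (dual (insert c G) v \<bullet> q) *\<^sub>R v)"
    using dual_expansion mem_convex_cone_hull_iff independent_insert_c[OF assms(1)] by blast
  then have "insert c G \<subseteq> insert c G'"
    using assms simplex_contains_support[OF assms(1,2) order_refl, of "\<lambda>v. dual (insert c G) v \<bullet> q"]
    by simp
  then have "G \<subseteq> G'" using c_notin_facet[OF assms(1)] by blast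
  then show ?thesis
    using card_facet[OF assms(1)] card_facet[OF assms(2)] finiteI_independent[OF indep[OF assms(2)]]
    by (simp add: card_subset_eq)
qed

text \<open>Moving from \<open>q\<close> against \<open>c\<close> must leave \<open>K\<close>:
  otherwise all \<open>inverse (real (Suc n)) *\<^sub>R q - c\<close> lie in \<open>K\<close>, and
  closedness yields \<open>- c \<in> K\<close>. The segment crosses the frontier on some facet, and
  adding back the multiple of \<open>c\<close> returns to \<open>q\<close> inside the simplex over
  that facet.\<close>

lemma simplices_cover:
  assumes "q \<in> K" obtains G where "G \<in> \<G>" "q \<in> convex_cone hull (insert c G)"
proof -
  have cl: "closed K" using polyhedron polyhedron_imp_closed by blast
  have "\<exists>t>0. q - t *\<^sub>R c \<notin> K"
  proof (rule ccontr)
    assume *: "\<not> (\<exists>t>0. q - t *\<^sub>R c \<notin> K)"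
    have "inverse (real (Suc n)) *\<^sub>R q - c \<in> K" for n
    proof -
      have "inverse (real (Suc n)) *\<^sub>R (q - real (Suc n) *\<^sub>R c) \<in> K"
        using * convex_cone by (intro convex_cone_scaleR) auto
      then show ?thesis by (simp add: scaleR_diff_right del: of_nat_Suc)
    qed
    moreover have "(\<lambda>n. inverse (real (Suc n)) *\<^sub>R q - c) \<longlonglongrightarrow> 0 *\<^sub>R q - c"
      by (intro tendsto_intros LIMSEQ_inverse_real_of_nat)
    ultimately have "0 *\<^sub>R q - c \<in> K"
      by (rule closed_sequentially[OF cl])
    then have "- c \<in> K" by simp
    then show False using c(2) by blast
  qed
  then obtain t where t: "t > 0" "q - t *\<^sub>R c \<notin> K" by blast
  have "closed_segment q (q - t *\<^sub>R c) \<inter> frontier K \<noteq> {}"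
    using assms t by (intro connected_Int_frontier) auto
  then obtain s where s: "0 \<le> s" "s \<le> 1" "(1 - s) *\<^sub>R q + s *\<^sub>R (q - t *\<^sub>R c) \<in> frontier K"
    unfolding in_segment closed_segment_def by blast
  define p where "p = q - (s * t) *\<^sub>R c"
  have "p \<in> frontier K" using s(3) by (simp add: p_def algebra_simps)
  then have "p \<in> K - rel_interior K"
    using cl c(1) rel_interior_nonempty_interior[of K] by (auto simp: frontier_def)
  then obtain F where "F facet_of K" "p \<in> F"
    using rel_boundary_of_polyhedron[OF polyhedron] by blast
  then obtain G where G: "G \<in> \<G>" "p \<in> convex_cone hull G" using facet_cases by blast
  have "p + (s * t) *\<^sub>R c \<in> convex_cone hull (insert c G)"
    using G(2) s t hull_mono[of G "insert c G" convex_cone] hull_inc[of c "insert c G" convex_cone]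
    by (intro convex_cone_hull_add convex_cone_hull_mul) auto
  then show thesis using G that by (simp add: p_def)
qed

text \<open>For small \<epsilon> the point \<open>x + \<epsilon> *\<^sub>R w\<close> lies in some
  simplex, and in none that misses \<open>x\<close>. Coordinates off \<open>W\<close> vanish at
  \<open>x\<close>, so their signs near \<open>x\<close> are those of \<open>w\<close>; genericity
  makes them strict. Two candidates would both contain \<open>x + \<epsilon> *\<^sub>R w\<close> in
  their open simplices and hence coincide.\<close>

lemma unique_simplex_towards:
  assumes W: "G0 \<in> \<G>" "W \<subseteq> insert c G0"
    and x: "x = (\<Sum>v\<in>W. u v *\<^sub>R v)" "\<And>v. v \<in> W \<Longrightarrow> 0 < u v"
    and w: "\<forall>\<^sub>F \<epsilon> in at_right 0. x + \<epsilon> *\<^sub>R w \<in> K"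
    and generic: "\<And>G v. G \<in> \<G> \<Longrightarrow> W \<subseteq> insert c G \<Longrightarrow> v \<in> insert c G - W \<Longrightarrow>
      dual (insert c G) v \<bullet> w \<noteq> 0"
  shows "\<exists>!G. G \<in> \<G> \<and> W \<subseteq> insert c G \<and> (\<forall>v\<in>insert c G - W. 0 < dual (insert c G) v \<bullet> w)"
proof -
  have lim: "((\<lambda>\<epsilon>. x + \<epsilon> *\<^sub>R w) \<longlongrightarrow> x + 0 *\<^sub>R w) (at_right 0)"
    by (intro tendsto_intros)
  have coord: "dual (insert c G) v \<bullet> x = (if v \<in> W then u v else 0)"
    if "G \<in> \<G>" "W \<subseteq> insert c G" "v \<in> insert c G" for G v
    unfolding x using dual_sum[OF independent_insert_c[OF that(1)]] that by blast
  \<comment> \<open>The simplicial cones are closed and finite in number, so one \<epsilon> avoids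
    all those that do not contain \<open>x\<close>.\<close>
  have "\<forall>\<^sub>F \<epsilon> in at_right 0. \<forall>G\<in>\<G>. x \<notin> convex_cone hull (insert c G) \<longrightarrow>
      x + \<epsilon> *\<^sub>R w \<notin> convex_cone hull (insert c G)"
  proof (intro eventually_ball_finite ballI finite_facets)
    fix G assume G: "G \<in> \<G>"
    have "closed (convex_cone hull (insert c G))"
    proof -
      have "convex_cone hull (insert c G) = (\<Inter>v\<in>insert c G. {p. dual (insert c G) v \<bullet> p \<ge> 0})"
        using hull_insert_c_iff[OF G] by auto
      then show ?thesis by (auto intro!: closed_INT closed_halfspace_ge)
    qed
    then have op: "open (- (convex_cone hull (insert c G)))" by (simp add: open_Compl)
    show "\<forall>\<^sub>F \<epsilon> in at_right 0. x \<notin> convex_cone hull (insert c G) \<longrightarrow>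
        x + \<epsilon> *\<^sub>R w \<notin> convex_cone hull (insert c G)"
    proof (cases "x \<in> convex_cone hull (insert c G)")
      case False
      then show ?thesis using topological_tendstoD[OF lim op] by simp
    qed simp
  qed
  then have "\<forall>\<^sub>F \<epsilon> in at_right 0. \<epsilon> > 0 \<and> x + \<epsilon> *\<^sub>R w \<in> K \<and>
      (\<forall>G\<in>\<G>. x \<notin> convex_cone hull (insert c G) \<longrightarrow> x + \<epsilon> *\<^sub>R w \<notin> convex_cone hull (insert c G))"
    using w eventually_at_right_less by (simp add: eventually_conj_iff)
  then obtain \<epsilon> :: real where \<epsilon>: "\<epsilon> > 0" "x + \<epsilon> *\<^sub>R w \<in> K"
      "\<forall>G\<in>\<G>. x \<notin> convex_cone hull (insert c G) \<longrightarrow> x + \<epsilon> *\<^sub>R w \<notin> convex_cone hull (insert c G)"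
    using eventually_happens'[OF trivial_limit_at_right_real] by blast
  obtain G where G: "G \<in> \<G>" "x + \<epsilon> *\<^sub>R w \<in> convex_cone hull (insert c G)"
    using simplices_cover[OF \<epsilon>(2)] by blast
  have WG: "W \<subseteq> insert c G"
    using simplex_contains_support[OF W(1) G(1) W(2), of u] \<epsilon>(3) G x by blast
  have "0 < dual (insert c G) v \<bullet> w" if v: "v \<in> insert c G - W" for v
  proof -
    have "0 \<le> dual (insert c G) v \<bullet> (x + \<epsilon> *\<^sub>R w)" using hull_insert_c_iff G v by blast
    then have "0 \<le> dual (insert c G) v \<bullet> w"
      using coord[OF G(1) WG, of v] v \<epsilon>(1) by (auto simp: inner_right_distrib zero_le_mult_iff)
    then show ?thesis using generic[OF G(1) WG v] by simp
  qed
  moreover have "H = H'" if H: "H \<in> \<G> \<and> W \<subseteq> insert c H \<and> (\<forall>v\<in>insert c H - W. 0 < dual (insert c H) v \<bullet> w)"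
      "H' \<in> \<G> \<and> W \<subseteq> insert c H' \<and> (\<forall>v\<in>insert c H' - W. 0 < dual (insert c H') v \<bullet> w)" for H H'
  proof -
    have ev: "\<forall>\<^sub>F \<epsilon> in at_right 0. \<forall>v\<in>insert c G. 0 < dual (insert c G) v \<bullet> (x + \<epsilon> *\<^sub>R w)"
      if G: "G \<in> \<G> \<and> W \<subseteq> insert c G \<and> (\<forall>v\<in>insert c G - W. 0 < dual (insert c G) v \<bullet> w)" for G
    proof (intro eventually_ball_finite ballI)
      show "finite (insert c G)" using G finiteI_independent[OF independent_insert_c] by auto
      fix v assume v: "v \<in> insert c G"
      show "\<forall>\<^sub>F \<epsilon> in at_right 0. 0 < dual (insert c G) v \<bullet> (x + \<epsilon> *\<^sub>R w)"
      proof (cases "v \<in> W")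
        case True
        have "((\<lambda>\<epsilon>. dual (insert c G) v \<bullet> (x + \<epsilon> *\<^sub>R w)) \<longlongrightarrow> dual (insert c G) v \<bullet> (x + 0 *\<^sub>R w)) (at_right 0)"
          by (intro tendsto_intros lim)
        moreover have "0 < dual (insert c G) v \<bullet> (x + 0 *\<^sub>R w)"
          using coord[of G v] G v True x(2) by simp
        ultimately show ?thesis by (rule order_tendstoD)
      next
        case False
        then have "dual (insert c G) v \<bullet> (x + \<epsilon> *\<^sub>R w) > 0" if "\<epsilon> > 0" for \<epsilon>
          using coord[of G v] G v that by (simp add: inner_right_distrib)
        then show ?thesis by (metis (mono_tags, lifting) eventually_at_right_less eventually_mono)
      qed
    qed
    obtain \<epsilon> where "\<forall>v\<in>insert c H. 0 < dual (insert c H) v \<bullet> (x + \<epsilon> *\<^sub>R w)"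
        "\<forall>v\<in>insert c H'. 0 < dual (insert c H') v \<bullet> (x + \<epsilon> *\<^sub>R w)"
      using eventually_happens[OF eventually_conj[OF ev[OF H(1)] ev[OF H(2)]]] by auto
    then show ?thesis
      using H hull_insert_c_iff[of H']
      by (intro open_simplices_disjoint[of H H' "x + \<epsilon> *\<^sub>R w"]) (auto simp: less_imp_le)
  qed
  ultimately show ?thesis using G(1) WG by blast
qed

end

subsection \<open>The Dehn--Sommerville equations\<close>

text \<open>Toggling a fixed element of \<open>G - A\<close> pairs the sets of the interval with
  opposite signs; nothing can be toggled when \<open>A = G\<close>.\<close>

lemma sum_alternating_interval:
  assumes "finite G" "A \<subseteq> G"
  shows "(\<Sum>W | A \<subseteq> W \<and> W \<subseteq> G. (-1) ^ card W) = (if A = G then (-1) ^ card G else (0::real))"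
proof (cases "A = G")
  case True
  then have "{W. A \<subseteq> W \<and> W \<subseteq> G} = {G}" by blast
  then show ?thesis using True by simp
next
  case False
  then obtain v where v: "v \<in> G" "v \<notin> A" using assms by blast
  let ?I = "{W. A \<subseteq> W \<and> W \<subseteq> G - {v}}"
  have fin: "finite ?I" using assms by (auto intro: finite_subset[of _ "Pow G"])
  have inj: "inj_on (insert v) ?I" by (auto simp: inj_on_def)
  have "{W. A \<subseteq> W \<and> W \<subseteq> G} = ?I \<union> insert v ` ?I"
  proof (intro equalityI subsetI)
    fix W assume W: "W \<in> {W. A \<subseteq> W \<and> W \<subseteq> G}"
    show "W \<in> ?I \<union> insert v ` ?I"
    proof (cases "v \<in> W")
      case True
      then have "W = insert v (W - {v})" "W - {v} \<in> ?I" using W v by auto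
      then show ?thesis by blast
    qed (use W in auto)
  qed (use v in auto)
  then have "(\<Sum>W | A \<subseteq> W \<and> W \<subseteq> G. (-1) ^ card W) =
      (\<Sum>W\<in>?I. (-1) ^ card W) + (\<Sum>W\<in>insert v ` ?I. (-1) ^ card W :: real)"
    using fin by (simp add: sum.union_disjoint) (subst sum.union_disjoint; auto)
  also have "(\<Sum>W\<in>insert v ` ?I. (-1) ^ card W :: real) = (\<Sum>W\<in>?I. (-1) ^ card (insert v W))"
    using inj by (simp add: sum.reindex)
  also have "\<dots> = (\<Sum>W\<in>?I. - ((-1) ^ card W))"
  proof (intro sum.cong refl)
    fix W assume W: "W \<in> ?I"
    then have "finite W" using assms finite_subset by auto
    then moreover have "v \<notin> W" using W by blast
    ultimately show "(-1) ^ card (insert v W) = - ((-1) ^ card W :: real)" by simp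
  qed
  finally show ?thesis using False by (simp add: sum_negf)
qed

text \<open>Writing the binomial as the number of \<open>m\<close>-subsets \<open>A\<close> of
  \<open>W\<close> and summing over \<open>W\<close> first leaves an alternating sum over the
  interval from \<open>R \<union> A\<close> to \<open>G\<close>. It survives only for
  \<open>R \<union> A = G\<close>, that is, for \<open>A\<close> above \<open>G - R\<close>: this is
  where an interval turns into its opposite.\<close>

lemma sum_alternating_interval_choose:
  assumes "finite G" "R \<subseteq> G"
  shows "(\<Sum>W | R \<subseteq> W \<and> W \<subseteq> G. (-1) ^ card W * real (card W choose m)) =
    (-1) ^ card G * real (card {A. G - R \<subseteq> A \<and> A \<subseteq> G \<and> card A = m})"
proof -
  let ?I = "{W. R \<subseteq> W \<and> W \<subseteq> G}" and ?S = "{A. A \<subseteq> G \<and> card A = m}"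
  have fin: "finite ?I" "finite ?S" using assms by (auto intro: finite_subset[of _ "Pow G"])
  have "(\<Sum>W\<in>?I. (-1) ^ card W * real (card W choose m)) =
      (\<Sum>W\<in>?I. \<Sum>A\<in>?S. if A \<subseteq> W then (-1) ^ card W else 0)"
  proof (intro sum.cong refl)
    fix W assume W: "W \<in> ?I"
    then have "finite W" using assms finite_subset by auto
    then have "card W choose m = card {A. A \<subseteq> W \<and> card A = m}" by (simp add: n_subsets)
    also have "{A. A \<subseteq> W \<and> card A = m} = {A \<in> ?S. A \<subseteq> W}" using W by auto
    finally show "(-1) ^ card W * real (card W choose m) =
        (\<Sum>A\<in>?S. if A \<subseteq> W then (-1) ^ card W else 0)"
      using fin by (simp flip: sum.inter_filter)
  qed
  also have "\<dots> = (\<Sum>A\<in>?S. \<Sum>W\<in>?I. if A \<subseteq> W then (-1) ^ card W else 0)"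
    by (rule sum.swap)
  also have "\<dots> = (\<Sum>A\<in>?S. if R \<union> A = G then (-1) ^ card G else 0)"
  proof (intro sum.cong refl)
    fix A assume A: "A \<in> ?S"
    have "(\<Sum>W\<in>?I. if A \<subseteq> W then (-1) ^ card W else 0) =
        (\<Sum>W | R \<union> A \<subseteq> W \<and> W \<subseteq> G. (-1) ^ card W :: real)"
      using fin by (simp flip: sum.inter_filter) (auto intro!: sum.cong)
    then show "(\<Sum>W\<in>?I. if A \<subseteq> W then (-1) ^ card W else 0) =
        (if R \<union> A = G then (-1) ^ card G else (0::real))"
      using sum_alternating_interval[of G "R \<union> A"] assms A by simp
  qed
  also have "\<dots> = (-1) ^ card G * real (card {A \<in> ?S. R \<union> A = G})"
    using fin by (simp flip: sum.inter_filter)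
  also have "{A \<in> ?S. R \<union> A = G} = {A. G - R \<subseteq> A \<and> A \<subseteq> G \<and> card A = m}"
    using assms by auto
  finally show ?thesis .
qed

text \<open>The uniqueness hypothesis says that the intervals from \<open>R G\<close> to
  \<open>G\<close> partition the complex.\<close>

lemma sum_over_partitioned_complex:
  fixes \<G> :: "'v set set"
  assumes fin: "finite \<G>" "\<And>G. G \<in> \<G> \<Longrightarrow> finite G"
    and ex1: "\<And>G W. G \<in> \<G> \<Longrightarrow> W \<subseteq> G \<Longrightarrow> \<exists>!H. H \<in> \<G> \<and> R H \<subseteq> W \<and> W \<subseteq> H"
  shows "(\<Sum>W\<in>\<Union>(Pow ` \<G>). f W) = (\<Sum>G\<in>\<G>. \<Sum>W | R G \<subseteq> W \<and> W \<subseteq> G. f W)"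
proof -
  have unique: "G = H" if "G \<in> \<G>" "H \<in> \<G>" "R G \<subseteq> W" "W \<subseteq> G" "R H \<subseteq> W" "W \<subseteq> H" for G H W
    using ex1[OF that(1,4)] that by blast
  have "\<Union>(Pow ` \<G>) = (\<Union>G\<in>\<G>. {W. R G \<subseteq> W \<and> W \<subseteq> G})"
  proof (intro equalityI subsetI)
    fix W assume "W \<in> \<Union>(Pow ` \<G>)"
    then obtain G where "G \<in> \<G>" "W \<subseteq> G" by blast
    from ex1_implies_ex[OF ex1[OF this]] show "W \<in> (\<Union>G\<in>\<G>. {W. R G \<subseteq> W \<and> W \<subseteq> G})" by blast
  qed auto
  then have "(\<Sum>W\<in>\<Union>(Pow ` \<G>). f W) = (\<Sum>W\<in>(\<Union>G\<in>\<G>. {W. R G \<subseteq> W \<and> W \<subseteq> G}). f W)" by simp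
  also have "\<dots> = (\<Sum>G\<in>\<G>. \<Sum>W | R G \<subseteq> W \<and> W \<subseteq> G. f W)"
  proof (rule sum.UNION_disjoint)
    show "\<forall>G\<in>\<G>. finite {W. R G \<subseteq> W \<and> W \<subseteq> G}"
      using fin by (auto intro!: finite_subset[of _ "Pow _"])
    show "\<forall>G\<in>\<G>. \<forall>H\<in>\<G>. G \<noteq> H \<longrightarrow> {W. R G \<subseteq> W \<and> W \<subseteq> G} \<inter> {W. R H \<subseteq> W \<and> W \<subseteq> H} = {}"
      using unique by blast
  qed (fact fin)
  finally show ?thesis .
qed

text \<open>
  In a shelling, \<open>R G\<close> is the least new face of the facet \<open>G\<close>; the opposite partition corresponds to
  the reversed shelling.
\<close>

lemma dehn_sommerville_of_opposite_partitions:
  fixes \<G> :: "'v set set"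
  assumes fin: "finite \<G>" "\<And>G. G \<in> \<G> \<Longrightarrow> finite G" and card: "\<And>G. G \<in> \<G> \<Longrightarrow> card G = n"
    and R: "\<And>G. G \<in> \<G> \<Longrightarrow> R G \<subseteq> G"
    and ex1: "\<And>G W. G \<in> \<G> \<Longrightarrow> W \<subseteq> G \<Longrightarrow> \<exists>!H. H \<in> \<G> \<and> R H \<subseteq> W \<and> W \<subseteq> H"
      "\<And>G W. G \<in> \<G> \<Longrightarrow> W \<subseteq> G \<Longrightarrow> \<exists>!H. H \<in> \<G> \<and> H - R H \<subseteq> W \<and> W \<subseteq> H"
  shows "(\<Sum>W\<in>\<Union>(Pow ` \<G>). (-1) ^ card W * real (card W choose m)) =
    (-1) ^ n * real (card {W \<in> \<Union>(Pow ` \<G>). card W = m})"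
proof -
  let ?N = "\<lambda>G. {A. G - R G \<subseteq> A \<and> A \<subseteq> G \<and> card A = m}"
  have finK: "finite (\<Union>(Pow ` \<G>))" using fin by auto
  have "(\<Sum>W\<in>\<Union>(Pow ` \<G>). (-1) ^ card W * real (card W choose m)) =
      (\<Sum>G\<in>\<G>. \<Sum>W | R G \<subseteq> W \<and> W \<subseteq> G. (-1) ^ card W * real (card W choose m))"
    by (rule sum_over_partitioned_complex[OF fin ex1(1)])
  also have "\<dots> = (\<Sum>G\<in>\<G>. (-1) ^ n * real (card (?N G)))"
    using sum_alternating_interval_choose[OF fin(2) R] card by (intro sum.cong) auto
  also have "\<dots> = (-1) ^ n * (\<Sum>G\<in>\<G>. \<Sum>W | G - R G \<subseteq> W \<and> W \<subseteq> G. of_bool (card W = m))"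
  proof (subst sum_distrib_left, intro sum.cong refl)
    fix G assume G: "G \<in> \<G>"
    then have "finite {W. G - R G \<subseteq> W \<and> W \<subseteq> G}"
      using fin by (auto intro!: finite_subset[of _ "Pow _"])
    moreover have "?N G = {W. G - R G \<subseteq> W \<and> W \<subseteq> G} \<inter> {W. card W = m}" by auto
    ultimately have "real (card (?N G)) = (\<Sum>W | G - R G \<subseteq> W \<and> W \<subseteq> G. of_bool (card W = m))"
      by (simp add: of_bool_def flip: sum.inter_filter) 
    then show "(-1) ^ n * real (card (?N G)) =
        (-1) ^ n * (\<Sum>W | G - R G \<subseteq> W \<and> W \<subseteq> G. of_bool (card W = m))" by simp
  qed
  \<comment> \<open>The intervals above \<open>G - R G\<close> partition the complex as well, so
    each set of size \<open>m\<close> has been counted exactly once.\<close>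
  also have "\<dots> = (-1) ^ n * (\<Sum>W\<in>\<Union>(Pow ` \<G>). of_bool (card W = m))"
    using sum_over_partitioned_complex[OF fin ex1(2), where f = "\<lambda>W. of_bool (card W = m) :: real"] by simp
  also have "(\<Sum>W\<in>\<Union>(Pow ` \<G>). of_bool (card W = m)) = real (card {W \<in> \<Union>(Pow ` \<G>). card W = m})"
    using finK by (simp add: of_bool_def flip: sum.inter_filter)
  finally show ?thesis .
qed

section \<open>Generic vectors and the boundary complex of the cone\<close>

lemma exists_off_hyperplanes:
  fixes A :: "'b::euclidean_space set"
  assumes "finite A" "0 \<notin> A"
  obtains w where "\<And>a. a \<in> A \<Longrightarrow> a \<bullet> w \<noteq> 0"
proof -
  have "negligible (\<Union>a\<in>A. {w. a \<bullet> w = 0})"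
    using assms by (intro negligible_Union) (auto intro!: negligible_hyperplane)
  then have "(\<Union>a\<in>A. {w. a \<bullet> w = 0}) \<noteq> UNIV" by (metis non_negligible_UNIV)
  then show thesis using that by blast
qed

context simplicial_cone
begin

text \<open>A set of size \<open>j\<close> stands for a boundary face of dimension
  \<open>j - 1\<close>. The empty set belongs to the complex as soon as there is a facet; after
  insertion of \<open>c\<close> it accounts for the vertex \<open>c\<close> of the star.\<close>

abbreviation boundary_complex where "boundary_complex \<equiv> \<Union>(Pow ` \<G>)"

lemma finite_facet: "G \<in> \<G> \<Longrightarrow> finite G"
  using indep finiteI_independent by blast

lemma add_c_in_interior:
  assumes "p \<in> K" "\<mu> > 0" shows "p + \<mu> *\<^sub>R c \<in> interior K"
proof -
  obtain e where e: "e > 0" "ball c e \<subseteq> K" using c(1) mem_interior by blast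
  have "ball (p + \<mu> *\<^sub>R c) (\<mu> * e) \<subseteq> K"
  proof
    fix y assume y: "y \<in> ball (p + \<mu> *\<^sub>R c) (\<mu> * e)"
    let ?z = "c + inverse \<mu> *\<^sub>R (y - (p + \<mu> *\<^sub>R c))"
    have "norm (inverse \<mu> *\<^sub>R (y - (p + \<mu> *\<^sub>R c))) < e"
      using y assms(2) unfolding norm_scaleR mem_ball dist_norm
      by (simp add: norm_minus_commute field_simps)
    then have "?z \<in> ball c e" by (simp add: dist_norm)
    then have "?z \<in> K" using e by blast
    then have "p + \<mu> *\<^sub>R ?z \<in> K"
      using assms by (intro convex_cone_add[OF convex_cone assms(1)] convex_cone_scaleR[OF convex_cone]) auto
    then show "y \<in> K" using assms(2) by (simp add: scaleR_add_right)
  qed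
  then show ?thesis using assms e by (auto simp: mem_interior intro!: exI[of _ "\<mu> * e"])
qed

lemma eventually_towards_of_interior:
  fixes x w :: 'b
  assumes "x \<in> interior S" shows "\<forall>\<^sub>F \<epsilon> in at_right 0. x + \<epsilon> *\<^sub>R w \<in> S"
proof -
  have "((\<lambda>\<epsilon>. x + \<epsilon> *\<^sub>R w) \<longlongrightarrow> x + 0 *\<^sub>R w) (at_right 0)"
    by (intro tendsto_intros)
  then have "\<forall>\<^sub>F \<epsilon> in at_right 0. x + \<epsilon> *\<^sub>R w \<in> interior S"
    using assms by (intro topological_tendstoD) auto
  then show ?thesis by (rule eventually_mono) (use interior_subset in blast)
qed

text \<open>
  Each facet \<open>G\<close> is restricted to the vertices at which a fixed generic vector \<open>w\<close> has negative
  coordinates with respect to \<open>insert c G\<close>. For a face \<open>W\<close>, the vector \<open>w\<close> points from the relative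
  interior of the cone over \<open>insert c W\<close> into exactly one of the simplices.
\<close>

lemma dehn_sommerville:
  "(\<Sum>W\<in>boundary_complex. (-1) ^ card W * real (card W choose m)) =
    (-1) ^ (DIM('b) - 1) * real (card {W \<in> boundary_complex. card W = m})"
proof -
  let ?A = "\<Union>G\<in>\<G>. dual (insert c G) ` insert c G"
  have "dual (insert c G) v \<noteq> 0" if "G \<in> \<G>" "v \<in> insert c G" for G v
    using dual[OF independent_insert_c[OF that(1)] that(2) that(2)] by auto
  then have "0 \<notin> ?A" by fastforce
  moreover have "finite ?A" using finite_facets finite_facet by auto
  ultimately obtain w where w: "\<And>a. a \<in> ?A \<Longrightarrow> a \<bullet> w \<noteq> 0" using exists_off_hyperplanes by metis
  define R where "R G = {v \<in> G. dual (insert c G) v \<bullet> w < 0}" for G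
  \<comment> \<open>Stated for an arbitrary generic \<open>w'\<close>, since it serves both
    \<open>w\<close> and \<open>- w\<close>.\<close>
  have ex1: "\<exists>!H. H \<in> \<G> \<and> {v \<in> H. dual (insert c H) v \<bullet> w' < 0} \<subseteq> W \<and> W \<subseteq> H"
    if G: "G \<in> \<G>" "W \<subseteq> G" and w': "\<And>a. a \<in> ?A \<Longrightarrow> a \<bullet> w' \<noteq> 0" for G W w'
  proof -
    have cW: "c \<notin> W" "finite W" using G c_notin_facet finite_subset[OF _ finite_facet] by auto
    have "(\<Sum>v\<in>W. v) \<in> K"
      using convex_cone_hull_sum[of W G "\<lambda>_. 1"] G cW facet_hull_subset[of G] by auto
    \<comment> \<open>The summand \<open>c\<close> moves the base point into
      \<open>interior K\<close>, where every vector points into \<open>K\<close>; only genericity of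
      \<open>w'\<close> is left to use.\<close>
    then have "(\<Sum>v\<in>W. v) + 1 *\<^sub>R c \<in> interior K"
      by (intro add_c_in_interior) auto
    then have "(\<Sum>v\<in>insert c W. 1 *\<^sub>R v) \<in> interior K"
      using cW by (simp add: add.commute)
    then have "\<forall>\<^sub>F \<epsilon> in at_right 0. (\<Sum>v\<in>insert c W. 1 *\<^sub>R v) + \<epsilon> *\<^sub>R w' \<in> K"
      by (rule eventually_towards_of_interior)
    then have "\<exists>!H. H \<in> \<G> \<and> insert c W \<subseteq> insert c H \<and>
        (\<forall>v\<in>insert c H - insert c W. 0 < dual (insert c H) v \<bullet> w')"
      using G w' by (intro unique_simplex_towards[of G "insert c W" _ "\<lambda>_. 1"]) auto
    moreover have "(H \<in> \<G> \<and> insert c W \<subseteq> insert c H \<and> (\<forall>v\<in>insert c H - insert c W. 0 < dual (insert c H) v \<bullet> w'))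
        \<longleftrightarrow> (H \<in> \<G> \<and> {v \<in> H. dual (insert c H) v \<bullet> w' < 0} \<subseteq> W \<and> W \<subseteq> H)" for H
    proof (cases "H \<in> \<G>")
      case H: True
      have "insert c W \<subseteq> insert c H \<longleftrightarrow> W \<subseteq> H" "insert c H - insert c W = H - W"
        using cW c_notin_facet[OF H] by auto
      moreover have "0 < dual (insert c H) v \<bullet> w' \<longleftrightarrow> \<not> dual (insert c H) v \<bullet> w' < 0" if "v \<in> H" for v
        using w'[of "dual (insert c H) v"] H that by fastforce
      ultimately show ?thesis by auto
    qed simp
    ultimately show ?thesis by simp
  qed
  show ?thesis
  proof (rule dehn_sommerville_of_opposite_partitions[OF finite_facets finite_facet])
    show "R G \<subseteq> G" for G by (auto simp: R_def)
    show "card G = DIM('b) - 1" if "G \<in> \<G>" for G using card_facet[OF that] by simp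
    show "\<exists>!H. H \<in> \<G> \<and> R H \<subseteq> W \<and> W \<subseteq> H" if "G \<in> \<G>" "W \<subseteq> G" for G W
      unfolding R_def by (rule ex1[OF that w])
    \<comment> \<open>No coordinate of \<open>w\<close> is zero, so the vertices outside
      \<open>R H\<close> are those with positive coordinate, which is negative for
      \<open>- w\<close>.\<close>
    have "H - R H = {v \<in> H. dual (insert c H) v \<bullet> - w < 0}" if "H \<in> \<G>" for H
    proof -
      have "0 < dual (insert c H) v \<bullet> w \<longleftrightarrow> \<not> dual (insert c H) v \<bullet> w < 0" if "v \<in> H" for v
        using w[of "dual (insert c H) v"] \<open>H \<in> \<G>\<close> that by fastforce
      then show ?thesis by (auto simp: R_def)
    qed
    then have eq: "(H \<in> \<G> \<and> H - R H \<subseteq> W \<and> W \<subseteq> H) \<longleftrightarrow>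
        (H \<in> \<G> \<and> {v \<in> H. dual (insert c H) v \<bullet> - w < 0} \<subseteq> W \<and> W \<subseteq> H)" for H W
      by (cases "H \<in> \<G>") simp_all
    show "\<exists>!H. H \<in> \<G> \<and> H - R H \<subseteq> W \<and> W \<subseteq> H" if "G \<in> \<G>" "W \<subseteq> G" for G W
      unfolding eq by (rule ex1[OF that]) (use w in simp)
  qed
qed

end

subsection \<open>Volume-preserving isometries moving a point to the pole\<close>

lemma emeasure_lborel_slices_fst:
  fixes A :: "('a::euclidean_space \<times> 'b::euclidean_space) set"
  assumes "A \<in> sets borel"
  shows "emeasure lborel A = (\<integral>\<^sup>+s. emeasure lborel ((\<lambda>u. (u, s)) -` A) \<partial>lborel)"
proof -
  have "A \<in> sets (lborel \<Otimes>\<^sub>M lborel)" using assms by (simp only: lborel_prod sets_lborel)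
  from lborel_pair.emeasure_pair_measure_alt2[OF this] show ?thesis by (simp only: lborel_prod)
qed

lemma emeasure_lborel_slices_snd:
  fixes A :: "('a::euclidean_space \<times> 'b::euclidean_space) set"
  assumes "A \<in> sets borel"
  shows "emeasure lborel A = (\<integral>\<^sup>+u. emeasure lborel (Pair u -` A) \<partial>lborel)"
proof -
  have "A \<in> sets (lborel \<Otimes>\<^sub>M lborel)" using assms by (simp only: lborel_prod sets_lborel)
  from lborel.emeasure_pair_measure_alt[OF this] show ?thesis by (simp only: lborel_prod)
qed

lemma emeasure_lborel_translate:
  fixes A :: "'a::euclidean_space set"
  assumes "A \<in> sets borel"
  shows "emeasure lborel ((\<lambda>x. x + c) -` A) = emeasure lborel A"
proof -
  have "emeasure (distr lborel borel ((+) c)) A = emeasure lborel ((+) c -` A)"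
    using assms by (subst emeasure_distr) auto
  moreover have "(+) c -` A = (\<lambda>x. x + c) -` A" by (auto simp: add.commute)
  ultimately show ?thesis by (simp add: lborel_distr_plus)
qed

text \<open>On each slice with fixed second component the shear is a translation, so Tonelli
  applies.\<close>

lemma distr_lborel_shear_fst:
  fixes v :: "'a::euclidean_space"
  shows "distr lborel borel (\<lambda>p::'a \<times> real. (fst p + snd p *\<^sub>R v, snd p)) = lborel"
proof (rule measure_eqI)
  let ?f = "\<lambda>p::'a \<times> real. (fst p + snd p *\<^sub>R v, snd p)"
  fix A assume "A \<in> sets (distr lborel borel ?f)"
  then have A: "A \<in> sets borel" by simp
  have f: "?f \<in> borel_measurable borel"
    by (intro borel_measurable_continuous_onI continuous_intros)
  then have fA: "?f -` A \<in> sets borel" using A measurable_sets[OF f A] by simp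
  have sl: "(\<lambda>u. (u, s)) -` A \<in> sets borel" for s
    using A by (intro measurable_sets_borel[OF _ A] borel_measurable_continuous_onI continuous_intros)
  have "emeasure (distr lborel borel ?f) A = emeasure lborel (?f -` A)"
    using f A by (subst emeasure_distr) auto
  also have "\<dots> = (\<integral>\<^sup>+s. emeasure lborel ((\<lambda>u. (u, s)) -` ?f -` A) \<partial>lborel)"
    by (rule emeasure_lborel_slices_fst[OF fA])
  also have "\<dots> = (\<integral>\<^sup>+s. emeasure lborel ((\<lambda>u. (u, s)) -` A) \<partial>lborel)"
  proof (intro nn_integral_cong)
    fix s :: real
    have "(\<lambda>u. (u, s)) -` ?f -` A = (\<lambda>u. u + s *\<^sub>R v) -` (\<lambda>u. (u, s)) -` A" by auto
    then show "emeasure lborel ((\<lambda>u. (u, s)) -` ?f -` A) = emeasure lborel ((\<lambda>u. (u, s)) -` A)"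
      using emeasure_lborel_translate[OF sl] by simp
  qed
  also have "\<dots> = emeasure lborel A" by (rule emeasure_lborel_slices_fst[OF A, symmetric])
  finally show "emeasure (distr lborel borel ?f) A = emeasure lborel A" .
qed simp

lemma distr_lborel_shear_snd:
  fixes w :: "'a::euclidean_space"
  shows "distr lborel borel (\<lambda>p::'a \<times> real. (fst p, snd p + w \<bullet> fst p)) = lborel"
proof (rule measure_eqI)
  let ?f = "\<lambda>p::'a \<times> real. (fst p, snd p + w \<bullet> fst p)"
  fix A assume "A \<in> sets (distr lborel borel ?f)"
  then have A: "A \<in> sets borel" by simp
  have f: "?f \<in> borel_measurable borel"
    by (intro borel_measurable_continuous_onI continuous_intros)
  then have fA: "?f -` A \<in> sets borel" using A measurable_sets[OF f A] by simp
  have sl: "Pair u -` A \<in> sets borel" for u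
    using A by (intro measurable_sets_borel[OF _ A] borel_measurable_continuous_onI continuous_intros)
  have "emeasure (distr lborel borel ?f) A = emeasure lborel (?f -` A)"
    using f A by (subst emeasure_distr) auto
  also have "\<dots> = (\<integral>\<^sup>+u. emeasure lborel (Pair u -` ?f -` A) \<partial>lborel)"
    by (rule emeasure_lborel_slices_snd[OF fA])
  also have "\<dots> = (\<integral>\<^sup>+u. emeasure lborel (Pair u -` A) \<partial>lborel)"
  proof (intro nn_integral_cong)
    fix u :: 'a
    have "Pair u -` ?f -` A = (\<lambda>s. s + w \<bullet> u) -` Pair u -` A" by auto
    then show "emeasure lborel (Pair u -` ?f -` A) = emeasure lborel (Pair u -` A)"
      using emeasure_lborel_translate[OF sl] by simp
  qed
  also have "\<dots> = emeasure lborel A" by (rule emeasure_lborel_slices_snd[OF A, symmetric])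
  finally show "emeasure (distr lborel borel ?f) A = emeasure lborel A" .
qed simp

lemma distr_lborel_compose:
  assumes "distr lborel borel f = lborel" "distr lborel borel g = lborel"
    "f \<in> borel_measurable borel" "g \<in> borel_measurable borel"
  shows "distr lborel borel (f \<circ> g) = lborel"
proof -
  have "distr (distr lborel borel g) borel f = distr lborel borel (f \<circ> g)"
    using assms by (intro distr_distr) auto
  then show ?thesis using assms by simp
qed

text \<open>
  A rotation or boost of a plane is a product of three shears; this makes it volume preserving.
\<close>

lemma volume_preserving_form_isometry:
  fixes x :: "'a::euclidean_space \<times> real" and \<kappa> :: real
  defines "Q \<equiv> \<lambda>p q. \<kappa> * (fst p \<bullet> fst q) + snd p * snd q"
  assumes x: "Q x x = 1" "snd x \<noteq> -1"
  obtains L :: "'a \<times> real \<Rightarrow> 'a \<times> real" where "linear L" "bij L" "distr lborel borel L = lborel" "L (0, 1) = x"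
    "\<And>p q. Q (L p) (L q) = Q p q"
proof -
  \<comment> \<open>The product of shears sends the pole to
    \<open>(v + (1 + w \<bullet> v) *\<^sub>R v, 1 + w \<bullet> v)\<close>. Matching this with
    \<open>x\<close> forces \<open>v\<close> to be \<open>fst x\<close> divided by
    \<open>1 + snd x\<close>; the choice of \<open>w\<close> then gives the right height and
    invariance of \<open>Q\<close>. Here \<kappa> = 1 is the sphere and \<kappa> = -1 the
    hyperboloid.\<close>
  define m where "m = 1 + snd x"
  define v where "v = (1 / m) *\<^sub>R fst x"
  define w where "w = - \<kappa> *\<^sub>R fst x"
  define A where "A = (\<lambda>v (p::'a \<times> real). (fst p + snd p *\<^sub>R v, snd p))"
  define B where "B = (\<lambda>w (p::'a \<times> real). (fst p, snd p + w \<bullet> fst p))"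
  have m: "m \<noteq> 0" using x(2) by (simp add: m_def)
  have fst_x: "fst x = m *\<^sub>R v" using m by (simp add: v_def)
  have snd_x: "snd x = m - 1" by (simp add: m_def)
  have "m * (m * \<kappa> * (v \<bullet> v) - (2 - m)) = Q x x - 1"
    by (simp add: Q_def fst_x snd_x algebra_simps)
  \<comment> \<open>This is \<open>Q x x = 1\<close> divided by \<open>m\<close>, the only relation
    between the parameters that the invariance computation uses.\<close>
  then have mV: "m * \<kappa> * (v \<bullet> v) = 2 - m" using m x(1) by simp
  have lin: "linear (A v)" "linear (B w)" for v w
    by (auto simp: A_def B_def intro!: linearI simp: algebra_simps inner_simps)
  have meas: "A v \<in> borel_measurable borel" "B w \<in> borel_measurable borel" for v w
    by (auto simp: A_def B_def intro!: borel_measurable_continuous_onI continuous_intros)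
  have inv: "A v \<circ> A (- v) = id" "B w \<circ> B (- w) = id" for v w
    by (auto simp: A_def B_def fun_eq_iff)
  have "A v (A (-v) p) = p" "B w (B (-w) p) = p" for v w p
    using inv by (metis comp_apply id_apply)+
  then have "bij (A v)" "bij (B w)" for v w
    by (metis bijI' minus_minus)+
  then have bij: "bij (A v \<circ> B w \<circ> A v)" by (intro bij_comp)
  have "linear (A v \<circ> B w \<circ> A v)" by (intro linear_compose lin)
  moreover note bij
  moreover have "distr lborel borel (A v \<circ> B w \<circ> A v) = lborel"
    using distr_lborel_shear_fst[of v] distr_lborel_shear_snd[of w] meas
    by (intro distr_lborel_compose measurable_comp[of _ borel borel]) (auto simp: A_def B_def)
  moreover have "(A v \<circ> B w \<circ> A v) (0, 1) = x"
  proof -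
    have "1 + w \<bullet> v = snd x"
      using mV by (simp add: w_def fst_x snd_x algebra_simps)
    moreover have "v + snd x *\<^sub>R v = fst x"
      by (simp add: fst_x snd_x algebra_simps)
    ultimately show ?thesis by (simp add: A_def B_def prod_eq_iff)
  qed
  moreover have "Q ((A v \<circ> B w \<circ> A v) p) ((A v \<circ> B w \<circ> A v) q) = Q p q" for p q
  proof -
    define a b s t V where "a = v \<bullet> fst p" "b = v \<bullet> fst q" "s = snd p" "t = snd q" "V = v \<bullet> v"
    define s' where "s' = s - \<kappa> * m * (a + s * V)"
    define t' where "t' = t - \<kappa> * m * (b + t * V)"
    have p: "(A v \<circ> B w \<circ> A v) p = (fst p + (s + s') *\<^sub>R v, s')"
    proof -
      have "s + w \<bullet> (fst p + s *\<^sub>R v) = s'"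
        by (simp add: w_def fst_x s'_def a_b_s_t_V_def inner_right_distrib algebra_simps)
      then show ?thesis by (simp add: A_def B_def a_b_s_t_V_def(3,4) scaleR_add_left)
    qed
    have q: "(A v \<circ> B w \<circ> A v) q = (fst q + (t + t') *\<^sub>R v, t')"
    proof -
      have "t + w \<bullet> (fst q + t *\<^sub>R v) = t'"
        by (simp add: w_def fst_x t'_def a_b_s_t_V_def inner_right_distrib algebra_simps)
      then show ?thesis by (simp add: A_def B_def a_b_s_t_V_def(3,4) scaleR_add_left)
    qed
    have "Q ((A v \<circ> B w \<circ> A v) p) ((A v \<circ> B w \<circ> A v) q) =
        \<kappa> * (fst p \<bullet> fst q + (t + t') * a + (s + s') * b + (s + s') * (t + t') * V) + s' * t'"
      unfolding p q by (simp add: Q_def inner_simps a_b_s_t_V_def inner_commute algebra_simps)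
    also have "\<dots> = \<kappa> * (fst p \<bullet> fst q) + s * t"
      using mV unfolding s'_def t'_def a_b_s_t_V_def(5)[symmetric] by algebra
    finally show ?thesis by (simp add: Q_def a_b_s_t_V_def)
  qed
  ultimately show thesis by (rule that)
qed

text \<open>A Euclidean translation is a shear of the hyperplane at height 1; in the curved
  geometries the map is the rotation or boost built above.\<close>

lemma point_isometry:
  fixes x :: "'a::euclidean_space \<times> real"
  assumes x: "x \<in> points X"
  obtains L :: "'a \<times> real \<Rightarrow> 'a \<times> real" where "linear L" "bij L" "distr lborel borel L = lborel" "L (0, 1) = x"
    "\<And>p. L p \<in> points X \<longleftrightarrow> p \<in> points X" "\<And>p. p \<in> points X \<Longrightarrow> gdist X x (L p) = gdist X (0, 1) p"
proof (cases X)
  case Euclidean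
  define L where "L = (\<lambda>p::'a \<times> real. (fst p + snd p *\<^sub>R fst x, snd p))"
  have "linear L" by (auto simp: L_def intro!: linearI simp: algebra_simps)
  moreover have "bij L"
    by (rule o_bij[of "\<lambda>p. (fst p - snd p *\<^sub>R fst x, snd p)"]) (auto simp: L_def)
  moreover have "distr lborel borel L = lborel"
    unfolding L_def by (rule distr_lborel_shear_fst)
  moreover have "L (0, 1) = x" using x Euclidean by (simp add: L_def prod_eq_iff)
  moreover have "L p \<in> points X \<longleftrightarrow> p \<in> points X" for p
    using Euclidean by (simp add: L_def)
  moreover have "gdist X x (L p) = gdist X (0, 1) p" if "p \<in> points X" for p
    using Euclidean that x
    by (cases x; cases p) (auto simp: L_def dist_Pair_Pair dist_norm)
  ultimately show thesis by (intro that[of L]) auto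
next
  case Spherical
  show thesis
  proof (cases "snd x = -1")
    \<comment> \<open>At the antipode of the pole the shear parameters would divide by
      \<open>1 + snd x = 0\<close>; negation takes their place.\<close>
    case True
    have "x \<bullet> x = 1" using x Spherical by (simp add: norm_eq_1)
    then have "fst x = 0" using True by (simp add: inner_prod_def)
    then have xe: "x = - (0, 1)" using True by (simp add: prod_eq_iff)
    have "distr lborel borel (uminus :: 'a \<times> real \<Rightarrow> _) = lborel"
      using lborel_affine[of "-1" "0 :: 'a \<times> real"] by (simp add: density_1)
    moreover have "linear (uminus :: 'a \<times> real \<Rightarrow> _)" by (auto intro: linearI)
    moreover have "bij (uminus :: 'a \<times> real \<Rightarrow> _)" by (rule bij_uminus)
    ultimately show thesis
      using Spherical xe by (intro that[of uminus]) auto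
  next
    case False
    have "1 * (fst x \<bullet> fst x) + snd x * snd x = 1"
      using x Spherical by (simp add: norm_eq_1 inner_prod_def)
    from volume_preserving_form_isometry[of 1, OF this False]
    obtain L :: "'a \<times> real \<Rightarrow> _" where L: "linear L" "bij L" "distr lborel borel L = lborel" "L (0, 1) = x"
      "\<And>p q. 1 * (fst (L p) \<bullet> fst (L q)) + snd (L p) * snd (L q) = 1 * (fst p \<bullet> fst q) + snd p * snd q"
      by metis
    have inner: "L p \<bullet> L q = p \<bullet> q" for p q
      using L(5)[of p q] by (simp add: inner_prod_def)
    have "L p \<in> points X \<longleftrightarrow> p \<in> points X" for p
      using inner[of p p] Spherical by (simp add: norm_eq_1)
    moreover have "gdist X x (L p) = gdist X (0, 1) p" for p
      using inner[of "(0, 1)" p] L(4) Spherical by simp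
    ultimately show thesis using L by (intro that[of L]) auto
  qed
next
  case Hyperbolic
  have x': "snd x > 0" "fst x \<bullet> fst x - (snd x)\<^sup>2 = -1" using x Hyperbolic by auto
  then have "-1 * (fst x \<bullet> fst x) + snd x * snd x = 1" "snd x \<noteq> -1"
    by (auto simp: power2_eq_square)
  from volume_preserving_form_isometry[of "-1", OF this]
  obtain L :: "'a \<times> real \<Rightarrow> _" where L: "linear L" "bij L" "distr lborel borel L = lborel" "L (0, 1) = x"
    "\<And>p q. -1 * (fst (L p) \<bullet> fst (L q)) + snd (L p) * snd (L q) = -1 * (fst p \<bullet> fst q) + snd p * snd q"
    by metis
  have "L p \<in> points X \<longleftrightarrow> p \<in> points X" for p
  proof -
    have q: "fst (L p) \<bullet> fst (L p) - (snd (L p))\<^sup>2 = fst p \<bullet> fst p - (snd p)\<^sup>2"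
      using L(5)[of p p] by (simp add: power2_eq_square)
    have s: "snd p = snd x * snd (L p) - fst x \<bullet> fst (L p)"
      using L(5)[of "(0, 1)" p] L(4) by simp
    \<comment> \<open>Invariance of the form alone would allow a change of sheet. Both
      \<open>x\<close> and \<open>L p\<close> are timelike, so in the expression for
      \<open>snd p\<close> the product of heights dominates the inner product and fixes the
      sign.\<close>
    have "snd (L p) > 0 \<longleftrightarrow> snd p > 0" if "fst p \<bullet> fst p - (snd p)\<^sup>2 = -1"
    proof -
      have "norm (fst x) < snd x"
        using x' by (simp add: norm_lt_square)
      moreover have "norm (fst (L p)) < \<bar>snd (L p)\<bar>"
        using q that by (auto simp: norm_lt_square) (smt (verit) inner_ge_zero)
      ultimately have "norm (fst x) * norm (fst (L p)) < snd x * \<bar>snd (L p)\<bar>"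
        by (intro mult_strict_mono') auto
      moreover have "\<bar>fst x \<bullet> fst (L p)\<bar> \<le> norm (fst x) * norm (fst (L p))"
        by (rule Cauchy_Schwarz_ineq2)
      ultimately have *: "\<bar>fst x \<bullet> fst (L p)\<bar> < snd x * \<bar>snd (L p)\<bar>" by linarith
      show ?thesis
      proof (cases "snd (L p) > 0")
        case True then show ?thesis using * s by simp
      next
        case False
        then have "snd x * \<bar>snd (L p)\<bar> = - (snd x * snd (L p))" by simp
        then show ?thesis using * s False by linarith
      qed
    qed
    then show ?thesis using q Hyperbolic by auto
  qed
  moreover have "gdist X x (L p) = gdist X (0, 1) p" for p
    using L(5)[of "(0, 1)" p] L(4) Hyperbolic by simp
  ultimately show thesis using L by (intro that[of L]) auto
qed

subsection \<open>Volumes of cones over radial sets\<close>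

lemma emeasure_cone_cball:
  fixes T :: "'a::euclidean_space set"
  assumes T: "T \<in> sets borel" "\<And>t u. t > 0 \<Longrightarrow> t *\<^sub>R u \<in> T \<longleftrightarrow> u \<in> T" and \<rho>: "\<rho> > 0"
  shows "emeasure lborel (T \<inter> cball 0 \<rho>) = ennreal (\<rho> ^ DIM('a)) * emeasure lborel (T \<inter> cball 0 1)"
proof -
  let ?f = "\<lambda>x::'a. 0 + \<rho> *\<^sub>R x"
  have B: "T \<inter> cball 0 \<rho> \<in> sets borel" using T by auto
  have "emeasure lborel (T \<inter> cball 0 \<rho>) =
      emeasure (density (distr lborel borel ?f) (\<lambda>_. \<bar>\<rho>\<bar> ^ DIM('a))) (T \<inter> cball 0 \<rho>)"
    using lborel_affine[of \<rho> "0::'a"] \<rho> by simp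
  also have "\<dots> = ennreal (\<rho> ^ DIM('a)) * emeasure lborel (?f -` (T \<inter> cball 0 \<rho>))"
    using B \<rho> by (subst emeasure_density_const) (auto simp: emeasure_distr)
  also have "?f -` (T \<inter> cball 0 \<rho>) = T \<inter> cball 0 1"
    using T(2) \<rho> by (auto simp: dist_norm)
  finally show ?thesis .
qed

text \<open>For a cone with apex 0 this is its normalized solid angle.\<close>

definition ball_fraction :: "'a::euclidean_space set \<Rightarrow> real" where
  "ball_fraction T = measure lborel (T \<inter> cball 0 1) / measure lborel (cball 0 1 :: 'a set)"

lemma measure_lborel_cball_pos: "measure lborel (cball (0::'a::euclidean_space) 1) > 0"
  using content_cball_pos[of 1 "0::'a"] by simp

text \<open>Two measures on the line are compared: the images under the norm of Lebesgue measure on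
  \<open>T\<close> and of a multiple of Lebesgue measure. They agree on all half-lines
  \<open>{..a}\<close> because a cone fills the same fraction of every centred ball, hence on all
  Borel sets.\<close>

lemma emeasure_cone_radial:
  fixes T :: "'a::euclidean_space set"
  assumes T: "T \<in> sets borel" "\<And>t u. t > 0 \<Longrightarrow> t *\<^sub>R u \<in> T \<longleftrightarrow> u \<in> T" and A: "A \<in> sets borel"
  shows "emeasure lborel (T \<inter> norm -` A) = ennreal (ball_fraction T) * emeasure lborel (norm -` A :: 'a set)"
proof -
  let ?M = "distr (density lborel (indicator T)) borel (norm :: 'a \<Rightarrow> real)"
  let ?N = "density (distr lborel borel (norm :: 'a \<Rightarrow> real)) (\<lambda>_. ennreal (ball_fraction T))"
  have M: "emeasure ?M B = emeasure lborel (T \<inter> norm -` B)" if B: "B \<in> sets borel" for B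
  proof -
    have nB: "norm -` B \<in> sets (borel :: 'a measure)"
      using B by (intro measurable_sets_borel[OF _ B]) auto
    have "emeasure ?M B = emeasure (density lborel (indicator T)) (norm -` B)"
      using B by (subst emeasure_distr) auto
    also have "\<dots> = (\<integral>\<^sup>+x. indicator T x * indicator (norm -` B) x \<partial>lborel)"
      using T nB by (subst emeasure_density) auto
    also have "\<dots> = (\<integral>\<^sup>+x. indicator (T \<inter> norm -` B) x \<partial>lborel)"
      by (intro nn_integral_cong) (auto simp: indicator_def)
    also have "\<dots> = emeasure lborel (T \<inter> norm -` B)"
      using T nB by (intro nn_integral_indicator) auto
    finally show ?thesis .
  qed
  have N: "emeasure ?N B = ennreal (ball_fraction T) * emeasure lborel (norm -` B :: 'a set)"
    if B: "B \<in> sets borel" for B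
    using B by (subst emeasure_density_const) (auto simp: emeasure_distr)
  have vim: "norm -` {..a} = cball (0::'a) a" for a by auto
  have fin: "emeasure lborel (T \<inter> cball 0 a) < \<infinity>" for a
    using emeasure_mono[of "T \<inter> cball 0 a" "cball 0 a" lborel] emeasure_lborel_cball_finite[of "0::'a" a]
    by (auto simp: order_le_less_trans)
  have one: "emeasure lborel (T \<inter> cball 0 1) =
      ennreal (ball_fraction T) * emeasure lborel (cball 0 1 :: 'a set)"
  proof -
    have "measure lborel (T \<inter> cball 0 1) = ball_fraction T * measure lborel (cball 0 1 :: 'a set)"
      using measure_lborel_cball_pos[where 'a = 'a] by (simp add: ball_fraction_def)
    moreover have "emeasure lborel (T \<inter> cball 0 1) = ennreal (measure lborel (T \<inter> cball 0 1))"
      "emeasure lborel (cball (0::'a) 1) = ennreal (measure lborel (cball (0::'a) 1))"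
      using fin[of 1] emeasure_lborel_cball_finite[of "0::'a" 1]
      by (auto intro!: emeasure_eq_ennreal_measure)
    ultimately show ?thesis
      by (simp add: ennreal_mult'')
  qed
  have "?M = ?N"
  proof (rule measure_eqI_generator_eq[where \<Omega> = UNIV and E = "range atMost" and A = "\<lambda>n. {..real n}"])
    show "Int_stable (range (atMost :: real \<Rightarrow> _))"
    proof -
      have "{..a} \<inter> {..b} = {..min a b}" for a b :: real by auto
      then show ?thesis by (auto simp: Int_stable_def)
    qed
    show "sets ?M = sigma_sets UNIV (range atMost)" "sets ?N = sigma_sets UNIV (range atMost)"
      using borel_eq_atMost by (metis sets_density sets_distr sets_measure_of top_greatest Pow_UNIV)+
    show "(\<Union>n. {..real n}) = UNIV" using real_arch_simple by fastforce
    show "emeasure ?M {..real n} \<noteq> \<infinity>" for n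
      using M[of "{..real n}"] fin[of "real n"] vim by auto
    fix B :: "real set" assume "B \<in> range atMost"
    then obtain a where B: "B = {..a}" by blast
    consider "a < 0" | "a = 0" | "a > 0" by linarith
    then have "emeasure lborel (T \<inter> cball 0 a) = ennreal (ball_fraction T) * emeasure lborel (cball (0::'a) a)"
    proof cases
      case 2
      have "emeasure lborel (T \<inter> {0}) \<le> emeasure lborel {0::'a}"
        by (intro emeasure_mono) auto
      then show ?thesis using 2 by simp
    next
      case 3
      then show ?thesis
        using emeasure_cone_cball[OF T 3] emeasure_cone_cball[of "UNIV :: 'a set" a] one
        by (simp add: mult.left_commute)
    qed simp
    then show "emeasure ?M B = emeasure ?N B"
      using M[of B] N[of B] vim by (simp add: B)
  qed auto
  then show ?thesis using M[OF A] N[OF A] by simp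
qed

text \<open>Each slice of \<open>D\<close> at fixed height is rotationally symmetric, so its radial
  profile can be read off along one unit vector \<open>b\<close>, and the radial statement applies
  slice by slice.\<close>

lemma emeasure_cone_times_radial:
  fixes T :: "'a::euclidean_space set" and D :: "('a \<times> real) set"
  assumes T: "T \<in> sets borel" "\<And>t u. t > 0 \<Longrightarrow> t *\<^sub>R u \<in> T \<longleftrightarrow> u \<in> T"
    and D: "D \<in> sets borel" "\<And>u u' s. norm u = norm u' \<Longrightarrow> (u, s) \<in> D \<longleftrightarrow> (u', s) \<in> D"
  shows "emeasure lborel {p \<in> D. fst p \<in> T} = ennreal (ball_fraction T) * emeasure lborel D"
proof -
  obtain b :: 'a where b: "b \<in> Basis" using nonempty_Basis by blast
  define A where "A s = {\<rho>. (\<rho> *\<^sub>R b, s) \<in> D}" for s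
  have A: "A s \<in> sets borel" for s
  proof -
    have "A s = (\<lambda>\<rho>. (\<rho> *\<^sub>R b, s)) -` D" by (auto simp: A_def)
    then show ?thesis
      using measurable_sets_borel[OF borel_measurable_continuous_onI D(1), of "\<lambda>\<rho>. (\<rho> *\<^sub>R b, s)"]
      by (simp add: continuous_intros)
  qed
  have slice: "(\<lambda>u. (u, s)) -` D = norm -` A s" for s
  proof -
    have "(u, s) \<in> D \<longleftrightarrow> (norm u *\<^sub>R b, s) \<in> D" for u
      using b by (intro D(2)) simp
    then show ?thesis by (auto simp: A_def)
  qed
  have TD: "{p \<in> D. fst p \<in> T} \<in> sets borel"
  proof -
    have "{p \<in> D. fst p \<in> T} = D \<inter> fst -` T" by auto
    moreover have "fst -` T \<in> sets (borel :: ('a \<times> real) measure)"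
      by (rule measurable_sets_borel[OF borel_measurable_continuous_onI T(1)]) (intro continuous_intros)
    ultimately show ?thesis using D by simp
  qed
  have meas: "(\<lambda>s. emeasure lborel ((\<lambda>u. (u, s)) -` D)) \<in> borel_measurable lborel"
  proof -
    have "D \<in> sets (lborel \<Otimes>\<^sub>M lborel)" using D by (simp only: lborel_prod sets_lborel)
    then show ?thesis by (rule lborel_pair.measurable_emeasure_Pair2)
  qed
  have "emeasure lborel {p \<in> D. fst p \<in> T} =
      (\<integral>\<^sup>+s. emeasure lborel ((\<lambda>u. (u, s)) -` {p \<in> D. fst p \<in> T}) \<partial>lborel)"
    by (rule emeasure_lborel_slices_fst[OF TD])
  also have "\<dots> = (\<integral>\<^sup>+s. ennreal (ball_fraction T) * emeasure lborel ((\<lambda>u. (u, s)) -` D) \<partial>lborel)"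
  proof (intro nn_integral_cong)
    fix s :: real
    have "(\<lambda>u. (u, s)) -` {p \<in> D. fst p \<in> T} = T \<inter> norm -` A s" using slice by auto
    then show "emeasure lborel ((\<lambda>u. (u, s)) -` {p \<in> D. fst p \<in> T}) =
        ennreal (ball_fraction T) * emeasure lborel ((\<lambda>u. (u, s)) -` D)"
      using emeasure_cone_radial[OF T A] slice by simp
  qed
  also have "\<dots> = ennreal (ball_fraction T) * (\<integral>\<^sup>+s. emeasure lborel ((\<lambda>u. (u, s)) -` D) \<partial>lborel)"
    by (intro nn_integral_cmult meas)
  also have "\<dots> = ennreal (ball_fraction T) * emeasure lborel D"
    using emeasure_lborel_slices_fst[OF D(1)] by simp
  finally show ?thesis .
qed

lemma ball_fraction_nonneg: "ball_fraction T \<ge> 0"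
  by (simp add: ball_fraction_def)

subsection \<open>Sphere fractions as fractions of the tangent cone\<close>

text \<open>
  \<open>gdom X\<close> is the open cone of positive multiples of points of \<open>X\<close>, and \<open>gnorm X\<close> the positively
  homogeneous function of degree one on it that is 1 exactly on \<open>X\<close>.
\<close>

fun gnorm :: "geometry \<Rightarrow> ('a::euclidean_space \<times> real) \<Rightarrow> real" where
  "gnorm Euclidean p = snd p"
| "gnorm Spherical p = norm p"
| "gnorm Hyperbolic p = sqrt ((snd p)\<^sup>2 - fst p \<bullet> fst p)"

fun gdom :: "geometry \<Rightarrow> ('a::euclidean_space \<times> real) set" where
  "gdom Euclidean = {p. snd p > 0}"
| "gdom Spherical = - {0}"
| "gdom Hyperbolic = {p. norm (fst p) < snd p}"

text \<open>The geodesic sphere of radius \<open>r\<close> about the pole is the Euclidean sphere of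
  radius \<open>gsin X r\<close> at height \<open>gcos X r\<close>.\<close>

fun gsin :: "geometry \<Rightarrow> real \<Rightarrow> real" where
  "gsin Euclidean r = r" | "gsin Spherical r = sin r" | "gsin Hyperbolic r = sinh r"

fun gcos :: "geometry \<Rightarrow> real \<Rightarrow> real" where
  "gcos Euclidean r = 1" | "gcos Spherical r = cos r" | "gcos Hyperbolic r = cosh r"

section \<open>Radial projection onto the space and geodesic spheres about the pole\<close>

lemma gnorm_scaleR: "t \<ge> 0 \<Longrightarrow> gnorm X (t *\<^sub>R p) = t * gnorm X p"
proof (cases X)
  case Hyperbolic
  assume "t \<ge> 0"
  have "(snd (t *\<^sub>R p))\<^sup>2 - fst (t *\<^sub>R p) \<bullet> fst (t *\<^sub>R p) = t\<^sup>2 * ((snd p)\<^sup>2 - fst p \<bullet> fst p)"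
    by (simp add: power2_eq_square algebra_simps)
  then show ?thesis using Hyperbolic \<open>t \<ge> 0\<close> by (simp add: real_sqrt_mult)
qed simp_all

lemma continuous_on_gnorm: "continuous_on S (gnorm X)"
  by (cases X) (simp_all, (intro continuous_intros)+)

lemma open_gdom: "open (gdom X)"
  by (cases X) (auto intro!: open_Collect_less continuous_intros simp: open_Compl)

lemma gnorm_pos: "p \<in> gdom X \<Longrightarrow> gnorm X p > 0"
  by (cases X) (auto simp: norm_lt_square)

lemma points_iff_gnorm: "p \<in> points X \<longleftrightarrow> p \<in> gdom X \<and> gnorm X p = 1"
proof (cases X)
  case Hyperbolic
  have "norm (fst p) < snd p \<and> sqrt ((snd p)\<^sup>2 - fst p \<bullet> fst p) = 1 \<longleftrightarrow>
      snd p > 0 \<and> fst p \<bullet> fst p - (snd p)\<^sup>2 = -1"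
    by (auto simp: norm_lt_square)
  then show ?thesis using Hyperbolic by auto
qed auto

lemma gdom_scaleR: "t > 0 \<Longrightarrow> t *\<^sub>R p \<in> gdom X \<longleftrightarrow> p \<in> gdom X"
  by (cases X) (auto simp: zero_less_mult_iff)

lemma normalize_in_points: "p \<in> gdom X \<Longrightarrow> inverse (gnorm X p) *\<^sub>R p \<in> points X"
  using gnorm_pos[of p X] by (simp add: points_iff_gnorm gdom_scaleR gnorm_scaleR)

lemma points_scaleR_unique: "p \<in> points X \<Longrightarrow> t *\<^sub>R p \<in> points X \<Longrightarrow> t > 0 \<Longrightarrow> t = 1"
  using gnorm_scaleR[of t X p] by (simp add: points_iff_gnorm)

lemma gsin_gcos_pos:
  assumes "0 < r" "r < pi / 2" shows "gsin X r > 0" "gcos X r > 0"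
  using assms by (cases X; simp add: sin_gt_zero cos_gt_zero)+

lemma gsin_gcos_limit: "(gsin X \<longlongrightarrow> 0) (at_right 0)" "(gcos X \<longlongrightarrow> 1) (at_right 0)"
proof -
  have eqs: "gsin Euclidean = (\<lambda>r. r)" "gsin Spherical = sin" "gsin Hyperbolic = sinh"
    "gcos Euclidean = (\<lambda>r. 1)" "gcos Spherical = cos" "gcos Hyperbolic = cosh"
    by (simp_all add: fun_eq_iff)
  have "isCont (sinh :: real \<Rightarrow> real) 0" "isCont (cosh :: real \<Rightarrow> real) 0"
    by (simp_all add: isCont_sinh isCont_cosh)
  then have "isCont (gsin X) 0" "isCont (gcos X) 0"
    by (cases X; simp add: eqs)+
  moreover have "gsin X 0 = 0" "gcos X 0 = 1" by (cases X; simp)+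
  ultimately show "(gsin X \<longlongrightarrow> 0) (at_right 0)" "(gcos X \<longlongrightarrow> 1) (at_right 0)"
    by (auto simp: isCont_def filterlim_at_split)
qed

lemma gsphere_at_pole:
  assumes r: "0 < r" "r < pi / 2"
  shows "gsphere X (0::'a::euclidean_space, 1) r = {p. norm (fst p) = gsin X r \<and> snd p = gcos X r}"
proof (cases X)
  case Euclidean
  then show ?thesis by (auto simp: gsphere_def dist_Pair_Pair prod_eq_iff dist_norm) 
next
  case Spherical
  have "p \<in> gsphere X (0::'a, 1) r \<longleftrightarrow> norm (fst p) = sin r \<and> snd p = cos r" for p
  proof -
    have "norm (fst p) = sin r \<and> snd p = cos r \<longleftrightarrow> norm p = 1 \<and> snd p = cos r"
    proof -
      have "norm p = 1 \<longleftrightarrow> (norm (fst p))\<^sup>2 + (snd p)\<^sup>2 = 1"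
        by (simp add: norm_prod_def)
      moreover have "(sin r)\<^sup>2 + (cos r)\<^sup>2 = 1" by simp
      moreover have "sin r \<ge> 0" using r by (simp add: sin_gt_zero less_imp_le)
      ultimately show ?thesis
        by (metis add_right_cancel norm_ge_zero power2_eq_imp_eq)
    qed
    moreover have "arccos (snd p) = r \<longleftrightarrow> snd p = cos r" if "norm p = 1"
    proof -
      have "\<bar>snd p\<bar> \<le> 1" using that norm_snd_le[of "snd p" "fst p"] by simp
      then show ?thesis using r by (auto simp: arccos_cos)
    qed
    moreover have "(0, 1) \<bullet> p = snd p" by (simp add: inner_prod_def)
    ultimately show ?thesis using Spherical by (auto simp: gsphere_def)
  qed
  then show ?thesis using Spherical by auto
next
  case Hyperbolic
  have "p \<in> gsphere X (0::'a, 1) r \<longleftrightarrow> norm (fst p) = sinh r \<and> snd p = cosh r" for p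
  proof -
    have *: "norm (fst p) = sinh r \<and> snd p = cosh r \<longleftrightarrow>
        (snd p > 0 \<and> fst p \<bullet> fst p - (snd p)\<^sup>2 = -1) \<and> snd p = cosh r"
    proof -
      have "(norm (fst p))\<^sup>2 = fst p \<bullet> fst p" by (simp add: dot_square_norm)
      moreover have "(cosh r)\<^sup>2 = (sinh r)\<^sup>2 + 1" by (rule cosh_square_eq)
      moreover have "sinh r \<ge> 0" using r by simp
      moreover have "cosh r > 0" by simp
      ultimately show ?thesis
        by (smt (verit) norm_ge_zero power2_eq_imp_eq)
    qed
    have "arcosh (snd p) = r \<longleftrightarrow> snd p = cosh r" if "snd p > 0" "fst p \<bullet> fst p - (snd p)\<^sup>2 = -1"
    proof -
      have "0 \<le> fst p \<bullet> fst p" by simp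
      then have "1\<^sup>2 \<le> (snd p)\<^sup>2" using that(2) unfolding one_power2 by linarith
      then have "snd p \<ge> 1" using that(1) by (meson less_imp_le power2_le_imp_le)
      then show ?thesis using r by (auto simp: arcosh_cosh_real)
    qed
    then show ?thesis using Hyperbolic * by (auto simp: gsphere_def)
  qed
  then show ?thesis using Hyperbolic by auto
qed

lemma mem_convex_cone_hull_2:
  "p \<in> convex_cone hull {x, y} \<longleftrightarrow> (\<exists>\<alpha>\<ge>0. \<exists>\<beta>\<ge>0. p = \<alpha> *\<^sub>R x + \<beta> *\<^sub>R y)"
proof
  let ?C = "{p. \<exists>\<alpha>\<ge>0. \<exists>\<beta>\<ge>0. p = \<alpha> *\<^sub>R x + \<beta> *\<^sub>R y}"
  have "convex_cone ?C"
    unfolding convex_cone_iff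
  proof (intro conjI ballI allI impI)
    show "0 \<in> ?C" by (auto intro!: exI[of _ 0])
    show "p + q \<in> ?C" if "p \<in> ?C" "q \<in> ?C" for p q
    proof -
      from that obtain a b a' b' where "a \<ge> 0" "b \<ge> 0" "a' \<ge> 0" "b' \<ge> 0"
        "p = a *\<^sub>R x + b *\<^sub>R y" "q = a' *\<^sub>R x + b' *\<^sub>R y" by blast
      moreover from this have "p + q = (a + a') *\<^sub>R x + (b + b') *\<^sub>R y" by (simp add: algebra_simps)
      ultimately show ?thesis using add_nonneg_nonneg by blast
    qed
    show "t *\<^sub>R p \<in> ?C" if "p \<in> ?C" "t \<ge> 0" for p t
    proof -
      from that obtain a b where "a \<ge> 0" "b \<ge> 0" "p = a *\<^sub>R x + b *\<^sub>R y" by blast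
      moreover from this have "t *\<^sub>R p = (t * a) *\<^sub>R x + (t * b) *\<^sub>R y" by (simp add: algebra_simps)
      ultimately show ?thesis using that(2) mult_nonneg_nonneg by blast
    qed
  qed
  moreover have "x = 1 *\<^sub>R x + 0 *\<^sub>R y" "y = 0 *\<^sub>R x + 1 *\<^sub>R y" by simp_all
  then have "{x, y} \<subseteq> ?C" using zero_le_one order_refl[of "0::real"] by blast
  ultimately have "convex_cone hull {x, y} \<subseteq> ?C" by (simp add: hull_minimal)
  then show "p \<in> convex_cone hull {x, y} \<Longrightarrow> \<exists>\<alpha>\<ge>0. \<exists>\<beta>\<ge>0. p = \<alpha> *\<^sub>R x + \<beta> *\<^sub>R y" by blast
next
  assume "\<exists>\<alpha>\<ge>0. \<exists>\<beta>\<ge>0. p = \<alpha> *\<^sub>R x + \<beta> *\<^sub>R y"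
  then obtain \<alpha> \<beta> where "\<alpha> \<ge> 0" "\<beta> \<ge> 0" "p = \<alpha> *\<^sub>R x + \<beta> *\<^sub>R y" by blast
  then show "p \<in> convex_cone hull {x, y}"
    by (auto intro!: convex_cone_hull_add convex_cone_hull_mul intro: hull_inc)
qed

text \<open>
  Up to the null set \<open>fst p = 0\<close>, the set swept out by the segments from the origin to the geodesic
  ball of radius \<open>r\<close> about the pole \<open>(0, 1)\<close>.
\<close>

definition pole_sector :: "geometry \<Rightarrow> real \<Rightarrow> ('a::euclidean_space \<times> real) set" where
  "pole_sector X r = {p. norm (fst p) * gcos X r \<le> snd p * gsin X r \<and> gnorm X p \<le> 1}"

lemma pole_sector_in_gdom:
  assumes r: "0 < r" "r < pi / 2" and p: "p \<in> pole_sector X r" "fst p \<noteq> 0"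
  shows "p \<in> gdom X"
proof -
  have pos: "gsin X r > 0" "gcos X r > 0" using gsin_gcos_pos[OF r] by auto
  have le: "norm (fst p) * gcos X r \<le> snd p * gsin X r" using p by (simp add: pole_sector_def)
  have "norm (fst p) * gcos X r > 0" using p pos by simp
  then have sp: "snd p > 0" using le pos by (smt (verit) zero_less_mult_iff)
  show ?thesis
  proof (cases X)
    case Hyperbolic
    have "sinh r < cosh r" by (rule sinh_less_cosh_real)
    then have "snd p * sinh r < snd p * cosh r" using sp by simp
    moreover have "norm (fst p) * cosh r \<le> snd p * sinh r" using le Hyperbolic by simp
    ultimately have "norm (fst p) * cosh r < snd p * cosh r" by linarith
    then have "norm (fst p) < snd p" by simp
    then show ?thesis using Hyperbolic by simp
  qed (use sp p in auto)
qed

text \<open>After pulling back by \<open>L\<close>, a swept point is a nonnegative combination of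
  the pole and a point \<open>y\<close> of the geodesic sphere. Off the axis the direction of
  \<open>fst p\<close> determines \<open>y\<close>; the first sector inequality expresses a
  nonnegative pole coefficient, the second the bound \<open>t \<le> 1\<close>. \<open>K\<close>
  enters only through its trace on the sphere, given by the cone \<open>T\<close>.\<close>

lemma mem_swept_iff:
  fixes L :: "'a::euclidean_space \<times> real \<Rightarrow> 'a \<times> real"
  assumes r: "0 < r" "r < pi / 2"
    and L: "linear L" "bij L" "L (0, 1) = x" "\<And>p. L p \<in> points X \<longleftrightarrow> p \<in> points X"
      "\<And>p. p \<in> points X \<Longrightarrow> gdist X x (L p) = gdist X (0, 1) p"
    and K: "\<And>u. norm u = gsin X r \<Longrightarrow> L (u, gcos X r) \<in> K \<longleftrightarrow> L (u, 0) \<in> T"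
    and T: "\<And>t w. t > 0 \<Longrightarrow> t *\<^sub>R w \<in> T \<longleftrightarrow> w \<in> T"
    and p: "fst p \<noteq> 0"
  shows "L p \<in> {t *\<^sub>R q | t q. 0 \<le> t \<and> t \<le> 1 \<and> q \<in> (\<Union>y \<in> gsphere X x r \<inter> K. geodesic_segment X x y)} \<longleftrightarrow>
    p \<in> pole_sector X r \<and> L (fst p, 0) \<in> T"
proof -
  let ?sn = "gsin X r" and ?cs = "gcos X r"
  have pos: "?sn > 0" "?cs > 0" using gsin_gcos_pos[OF r] by auto
  note lin = linear_scale[OF L(1)] linear_add[OF L(1)]
  have injL: "L a = L b \<longleftrightarrow> a = b" for a b using L(2) by (simp add: bij_is_inj inj_eq)
  have LT: "L (t *\<^sub>R u, 0) \<in> T \<longleftrightarrow> L (u, 0) \<in> T" if "t > 0" for t u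
    using T[OF that, of "L (u, 0)"] lin(1)[of t "(u, 0)"] by simp
  have sphere: "L y \<in> gsphere X x r \<longleftrightarrow> norm (fst y) = ?sn \<and> snd y = ?cs" for y
  proof -
    have "L y \<in> gsphere X x r \<longleftrightarrow> y \<in> gsphere X (0, 1) r"
      unfolding gsphere_def mem_Collect_eq L(4) using L(5)[of y] by metis
    then show ?thesis using gsphere_at_pole[OF r, where 'a = 'a and X = X] by simp
  qed
  show ?thesis
  proof
    assume "L p \<in> {t *\<^sub>R q | t q. 0 \<le> t \<and> t \<le> 1 \<and> q \<in> (\<Union>y \<in> gsphere X x r \<inter> K. geodesic_segment X x y)}"
    then obtain t q y' where t: "0 \<le> t" "t \<le> 1" "L p = t *\<^sub>R q"
      and y': "y' \<in> gsphere X x r" "y' \<in> K" and "q \<in> geodesic_segment X x y'" by blast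
    then obtain \<alpha> \<beta> where q: "q \<in> points X" "\<alpha> \<ge> 0" "\<beta> \<ge> 0" "q = \<alpha> *\<^sub>R x + \<beta> *\<^sub>R y'"
      unfolding geodesic_segment_def Int_iff mem_convex_cone_hull_2 by blast
    obtain y where y: "y' = L y" using L(2) by (metis bij_pointE)
    have ny: "norm (fst y) = ?sn" "snd y = ?cs" using sphere y y'(1) by auto
    define q0 where "q0 = \<alpha> *\<^sub>R (0, 1) + \<beta> *\<^sub>R y"
    have Lq0: "L q0 = q" using q(4) y by (simp only: q0_def lin L(3))
    then have p_eq: "p = t *\<^sub>R q0" using t(3) lin(1) injL by metis
    have q0: "q0 \<in> points X" using Lq0 q(1) L(4) by metis
    have fp: "fst p = (t * \<beta>) *\<^sub>R fst y" and sp: "snd p = t * (\<alpha> + \<beta> * ?cs)"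
      by (simp_all add: p_eq q0_def ny)
    have tb: "t * \<beta> > 0" using p fp t(1) q(3) by (auto simp: less_le)
    have "norm (fst p) * ?cs = t * (\<beta> * ?cs) * ?sn"
      using fp ny t(1) q(3) by (simp add: abs_mult)
    also have "\<dots> \<le> snd p * ?sn"
      using t(1) q(2) pos unfolding sp by (intro mult_right_mono mult_left_mono) auto
    finally have "norm (fst p) * ?cs \<le> snd p * ?sn" .
    moreover have "gnorm X p \<le> 1"
      using q0 t gnorm_scaleR[of t X q0] by (simp add: p_eq points_iff_gnorm)
    moreover have "L (fst p, 0) \<in> T"
    proof -
      have "y = (fst y, ?cs)" using ny(2) by (simp add: prod_eq_iff)
      then have "L (fst y, 0) \<in> T" using K[OF ny(1)] y y'(2) by simp
      then show ?thesis using LT[OF tb] fp by simp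
    qed
    ultimately show "p \<in> pole_sector X r \<and> L (fst p, 0) \<in> T" by (simp add: pole_sector_def)
  next
    assume *: "p \<in> pole_sector X r \<and> L (fst p, 0) \<in> T"
    define \<rho> where "\<rho> = gnorm X p"
    have dom: "p \<in> gdom X" using pole_sector_in_gdom[OF r _ p] * by blast
    have \<rho>: "\<rho> > 0" "\<rho> \<le> 1" using gnorm_pos[OF dom] * by (auto simp: \<rho>_def pole_sector_def)
    define q where "q = inverse \<rho> *\<^sub>R p"
    have q: "q \<in> points X" using normalize_in_points[OF dom] by (simp add: q_def \<rho>_def)
    \<comment> \<open>\<open>y\<close> is the point of the geodesic sphere in the direction of
      \<open>fst p\<close>. Comparing components of q = \<alpha> (0, 1) + \<beta> y gives \<beta>
      from the first and \<alpha> from the second, and \<alpha> \<ge> 0 is the sector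
      inequality.\<close>
    define y where "y = ((?sn / norm (fst p)) *\<^sub>R fst p, ?cs)"
    have ny: "norm (fst y) = ?sn" "snd y = ?cs" using p pos by (simp_all add: y_def)
    define \<beta> where "\<beta> = norm (fst p) / (\<rho> * ?sn)"
    define \<alpha> where "\<alpha> = (snd p - norm (fst p) * ?cs / ?sn) / \<rho>"
    have "\<beta> \<ge> 0" using \<rho> pos by (simp add: \<beta>_def)
    moreover have "\<alpha> \<ge> 0"
      using * \<rho> pos by (simp add: \<alpha>_def pole_sector_def field_simps)
    moreover have "q = \<alpha> *\<^sub>R (0, 1) + \<beta> *\<^sub>R y"
      using \<rho> pos p by (simp add: prod_eq_iff q_def y_def \<alpha>_def \<beta>_def field_simps)
    then have "L q = \<alpha> *\<^sub>R x + \<beta> *\<^sub>R L y" by (simp only: lin L(3))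
    moreover have "L q \<in> points X" using q L(4) by simp
    ultimately have seg: "L q \<in> geodesic_segment X x (L y)"
      unfolding geodesic_segment_def Int_iff mem_convex_cone_hull_2 by blast
    have "L (fst y, 0) \<in> T"
      using * LT[of "?sn / norm (fst p)" "fst p"] p pos by (simp add: y_def)
    then have "L y \<in> K" using K[OF ny(1)] ny(2) by (metis prod.collapse)
    moreover have "L y \<in> gsphere X x r" using sphere ny by blast
    moreover have "L p = \<rho> *\<^sub>R L q" using \<rho> lin by (simp add: q_def)
    ultimately show "L p \<in> {t *\<^sub>R q | t q. 0 \<le> t \<and> t \<le> 1 \<and>
        q \<in> (\<Union>y \<in> gsphere X x r \<inter> K. geodesic_segment X x y)}"
      using seg \<rho> less_imp_le by blast
  qed
qed

text \<open>The cone of feasible directions at \<open>x\<close>, for \<open>x\<close> in the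
  polyhedral cone with outer normals \<open>N\<close>: only constraints active at \<open>x\<close>
  count.\<close>

definition tangent_cone :: "'b::real_inner set \<Rightarrow> 'b \<Rightarrow> 'b set" where
  "tangent_cone N x = {w. \<forall>a\<in>N. a \<bullet> x = 0 \<longrightarrow> a \<bullet> w \<le> 0}"

lemma closed_tangent_cone: "closed (tangent_cone N x)"
proof -
  have "tangent_cone N x = (\<Inter>a\<in>{a\<in>N. a \<bullet> x = 0}. {w. a \<bullet> w \<le> 0})"
    by (auto simp: tangent_cone_def)
  then show ?thesis by (auto intro!: closed_INT closed_halfspace_le)
qed

lemma closed_tangent_cone_slice:
  fixes L :: "'a::euclidean_space \<times> real \<Rightarrow> 'a \<times> real"
  assumes "linear L" shows "closed {u. L (u, 0) \<in> tangent_cone N x}"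
proof -
  have "continuous_on UNIV L"
    using assms by (intro linear_continuous_on) (simp add: linear_conv_bounded_linear)
  then have "continuous_on UNIV (\<lambda>u. L (u, 0))"
    by (rule continuous_on_compose2) (auto intro!: continuous_intros)
  then have "closed ((\<lambda>u. L (u, 0)) -` tangent_cone N x)"
    by (intro closed_vimage closed_tangent_cone)
  then show ?thesis by (simp add: vimage_def)
qed

text \<open>\<open>S\<close> and \<open>L\<close> followed by the set \<open>E\<close> differ only
  inside the image of the axis \<open>fst p = 0\<close>. That image lies in a hyperplane, so
  measurability of \<open>S\<close> need not be known beforehand.\<close>

lemma measure_swept_set:
  fixes L :: "'a::euclidean_space \<times> real \<Rightarrow> 'a \<times> real"
  assumes L: "linear L" "bij L" "distr lborel borel L = lborel"
    and E: "E \<in> sets borel" "bounded E"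
    and S: "\<And>p. fst p \<noteq> 0 \<Longrightarrow> L p \<in> S \<longleftrightarrow> p \<in> E"
  shows "measure lebesgue S = measure lborel E"
proof -
  define M where "M = inv L"
  have M: "linear M" "\<And>p. L (M p) = p" "\<And>p. M (L p) = p"
    using L by (auto simp: M_def linear_linear bij_is_surj surj_f_inv_f bij_is_inj intro!: inj_linear_imp_inv_linear)
  have vim: "L ` E = M -` E" 
  proof -
    have "q \<in> L ` E \<longleftrightarrow> M q \<in> E" for q by (metis M(2,3) imageE imageI)
    then show ?thesis by blast
  qed
  have ME: "M -` E \<in> sets borel"
    using measurable_sets_borel[OF _ E(1), of M] linear_continuous_on[of M] M(1)
    by (metis borel_measurable_continuous_onI linear_conv_bounded_linear)
  have "emeasure lborel (M -` E) = emeasure (distr lborel borel L) (M -` E)" using L by simp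
  also have "\<dots> = emeasure lborel (L -` M -` E)"
    using ME L(1) by (subst emeasure_distr)
      (auto intro!: borel_measurable_continuous_onI linear_continuous_on simp: linear_conv_bounded_linear)
  also have "L -` M -` E = E" using M(3) by (simp add: vimage_def)
  finally have em: "measure lborel (L ` E) = measure lborel E" by (simp add: vim measure_def)
  \<comment> \<open>Any basis vector will do: the functional \<open>(b, 0)\<close> vanishes on the
    axis, and transporting it by the inverse of \<open>L\<close> gives the normal of a hyperplane
    containing the image.\<close>
  obtain b :: 'a where b: "b \<in> Basis" using nonempty_Basis by blast
  define a where "a = adjoint M (b, 0)"
  have a: "a \<bullet> q = (b, 0) \<bullet> M q" for q
    using adjoint_works[OF M(1), of q "(b, 0)"] by (simp add: a_def inner_commute)
  have "a \<bullet> L (b, 0) = 1" using b by (simp add: a M(3))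
  then have "a \<noteq> 0" by auto
  then have "negligible {q. a \<bullet> q = 0}" by (simp add: negligible_hyperplane)
  moreover have "L ` E - S \<union> (S - L ` E) \<subseteq> {q. a \<bullet> q = 0}"
  proof
    fix q assume q: "q \<in> L ` E - S \<union> (S - L ` E)"
    have "fst (M q) = 0" using q S[of "M q"] M vim by auto
    then have "(b, 0) \<bullet> M q = 0" by (simp add: inner_prod_def)
    then show "q \<in> {q. a \<bullet> q = 0}" by (simp add: a)
  qed
  ultimately have neg: "negligible (L ` E - S \<union> (S - L ` E))" by (rule negligible_subset)
  have "bounded (L ` E)" using E(2) L(1) bounded_linear_image linear_conv_bounded_linear by blast
  moreover have "L ` E \<in> sets borel" using ME vim by simp
  ultimately have "L ` E \<in> lmeasurable"
    by (intro bounded_set_imp_lmeasurable) auto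
  then have "measure lebesgue S = measure lebesgue (L ` E)"
    using neg by (rule measure_negligible_symdiff)
  also have "\<dots> = measure lborel (L ` E)" using ME vim by simp
  finally show ?thesis using em by simp
qed

section \<open>Measurability, boundedness and positive volume of the polar sector\<close>

lemma pole_sector_borel: "pole_sector X r \<in> sets (borel :: ('a::euclidean_space \<times> real) measure)"
proof -
  have "closed (pole_sector X r :: ('a \<times> real) set)"
    unfolding pole_sector_def
    by (intro closed_Collect_conj closed_Collect_le continuous_intros continuous_on_gnorm)
  then show ?thesis by simp
qed

lemma pole_sector_bounded:
  assumes r: "0 < r" "r < pi / 2" shows "bounded (pole_sector X r :: ('a::euclidean_space \<times> real) set)"
proof -
  have pos: "gsin X r > 0" "gcos X r > 0" using gsin_gcos_pos[OF r] by auto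
  \<comment> \<open>A crude bound common to the three geometries: the quotient is the Euclidean
    radius, 1 bounds the spherical case, and \<open>cosh r\<close> is the height of the hyperbolic
    cap.\<close>
  have "norm (fst p) \<le> gsin X r / gcos X r + 1 + cosh r \<and> norm (snd p) \<le> 1 + cosh r"
    if "p \<in> pole_sector X r" for p :: "'a \<times> real"
  proof -
    have p: "norm (fst p) * gcos X r \<le> snd p * gsin X r" "gnorm X p \<le> 1"
      using that by (auto simp: pole_sector_def)
    have sp: "snd p \<ge> 0"
      using p(1) pos by (smt (verit) mult_nonneg_nonneg norm_ge_zero zero_le_mult_iff)
    have quot: "gsin X r / gcos X r \<ge> 0" using pos by simp
    show ?thesis
    proof (cases X)
      case Euclidean
      then have "snd p * r \<le> 1 * r" using p r by (intro mult_right_mono) auto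
      then have "norm (fst p) \<le> r" "norm (snd p) \<le> 1" "gsin X r / gcos X r = r"
        using Euclidean p sp by auto
      then show ?thesis using cosh_real_pos[of r] by linarith
    next
      case Spherical
      then have "norm (fst p) \<le> 1" "norm (snd p) \<le> 1"
        using p(2) norm_fst_le[of "fst p" "snd p"] norm_snd_le[of "snd p" "fst p"] by auto
      then show ?thesis using quot cosh_real_pos[of r] by linarith
    next
      case Hyperbolic
      have "(norm (fst p) * cosh r)\<^sup>2 \<le> (snd p * sinh r)\<^sup>2"
        using p(1) Hyperbolic by (intro power_mono) auto
      then have "(norm (fst p))\<^sup>2 * (cosh r)\<^sup>2 \<le> (snd p)\<^sup>2 * ((cosh r)\<^sup>2 - 1)"
        by (simp add: power_mult_distrib cosh_square_eq)
      moreover have "((snd p)\<^sup>2 - (norm (fst p))\<^sup>2) * (cosh r)\<^sup>2 \<le> 1 * (cosh r)\<^sup>2"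
        using p(2) Hyperbolic by (intro mult_right_mono) (auto simp: dot_square_norm)
      ultimately have "(snd p)\<^sup>2 \<le> (cosh r)\<^sup>2" by (simp add: algebra_simps)
      then have s_le: "snd p \<le> cosh r" by (rule power2_le_imp_le) simp
      have "norm (fst p) * cosh r \<le> snd p * cosh r"
        using p(1) Hyperbolic sp sinh_less_cosh_real[of r]
        by (smt (verit) gcos.simps(3) gsin.simps(3) mult_left_mono)
      then have "norm (fst p) \<le> snd p" by simp
      then show ?thesis using s_le sp quot by simp
    qed
  qed
  then have "(pole_sector X r :: ('a \<times> real) set) \<subseteq> cball 0 (gsin X r / gcos X r + 1 + cosh r) \<times> cball (0::real) (1 + cosh r)"
    unfolding subset_iff mem_Times_iff mem_cball_0 by blast
  then show "bounded (pole_sector X r :: ('a \<times> real) set)"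
    using bounded_Times bounded_cball bounded_subset by blast
qed

lemma pole_sector_measure_pos:
  assumes r: "0 < r" "r < pi / 2"
  shows "measure lborel (pole_sector X r :: ('a::euclidean_space \<times> real) set) > 0"
proof -
  let ?U = "{p :: 'a \<times> real. norm (fst p) * gcos X r < snd p * gsin X r \<and> gnorm X p < 1}"
  have "open ?U"
    by (intro open_Collect_conj open_Collect_less continuous_intros continuous_on_gnorm)
  moreover have "(0, 1/2) \<in> ?U"
    using gsin_gcos_pos[OF r, of X] by (cases X) (auto simp: norm_Pair power2_eq_square real_sqrt_mult)
  ultimately have "\<not> negligible (pole_sector X r :: ('a \<times> real) set)"
    using open_not_negligible[of ?U] negligible_subset[of "pole_sector X r" ?U]
    by (fastforce simp: pole_sector_def)
  then have "measure lebesgue (pole_sector X r :: ('a \<times> real) set) \<noteq> 0"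
    using negligible_iff_measure bounded_set_imp_lmeasurable[OF pole_sector_bounded[OF r]] pole_sector_borel
    by (metis sets_completionI_sets sets_lborel)
  then show ?thesis using pole_sector_borel[of X r, where 'a = 'a] by (simp add: less_le measure_completion)
qed

text \<open>On a small sphere about \<open>x\<close> the inactive constraints hold automatically and
  the active ones depend on the direction only, so the polytope may be replaced by its tangent cone.
  Numerator and denominator become volumes of the same rotationally symmetric sector, with and
  without the cone condition on \<open>fst p\<close>.\<close>

lemma eventually_sphere_fraction:
  fixes N :: "('a::euclidean_space \<times> real) set" and L :: "'a \<times> real \<Rightarrow> 'a \<times> real"
  assumes N: "finite N" and x: "x \<in> points X" "\<forall>a\<in>N. a \<bullet> x \<le> 0"
    and L: "linear L" "bij L" "distr lborel borel L = lborel" "L (0, 1) = x"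
    "\<And>p. L p \<in> points X \<longleftrightarrow> p \<in> points X" "\<And>p. p \<in> points X \<Longrightarrow> gdist X x (L p) = gdist X (0, 1) p"
  shows "\<forall>\<^sub>F r in at_right 0. sphere_fraction X x r (points X \<inter> {p. \<forall>a\<in>N. a \<bullet> p \<le> 0}) =
    ball_fraction {u. L (u, 0) \<in> tangent_cone N x}"
proof -
  define K where "K = {p. \<forall>a\<in>N. a \<bullet> p \<le> 0}"
  define T where "T = tangent_cone N x"
  define T0 where "T0 = {u. L (u, 0) \<in> T}"
  note lin = linear_scale[OF L(1)] linear_add[OF L(1)]
  obtain B where B: "B > 0" "\<And>p. norm (L p) \<le> B * norm p" using linear_bounded_pos[OF L(1)] by blast
  \<comment> \<open>For a direction \<open>u\<close> of norm \<open>gsin X r\<close>,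
    \<open>norm a * B * gsin X r\<close> bounds \<open>a \<bullet> L (u, 0)\<close>, and
    \<open>x\<close> contributes with factor \<open>gcos X r\<close>. As \<open>r\<close> tends to 0
    the total tends to \<open>a \<bullet> x < 0\<close>.\<close>
  have "\<forall>\<^sub>F r in at_right 0. \<forall>a\<in>N. a \<bullet> x < 0 \<longrightarrow> norm a * B * gsin X r + gcos X r * (a \<bullet> x) < 0"
  proof (intro eventually_ball_finite N ballI)
    fix a assume "a \<in> N"
    have "((\<lambda>r. norm a * B * gsin X r + gcos X r * (a \<bullet> x)) \<longlongrightarrow> norm a * B * 0 + 1 * (a \<bullet> x)) (at_right 0)"
      by (intro tendsto_intros gsin_gcos_limit)
    then show "\<forall>\<^sub>F r in at_right 0. a \<bullet> x < 0 \<longrightarrow> norm a * B * gsin X r + gcos X r * (a \<bullet> x) < 0"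
      by (cases "a \<bullet> x < 0") (auto dest: order_tendstoD)
  qed
  moreover have "\<forall>\<^sub>F r in at_right 0. 0 < r \<and> r < pi / 2"
    using eventually_at_right_less[of 0] eventually_at_right_real[of 0 "pi / 2"] pi_gt_zero
    by (auto elim: eventually_mono)
  ultimately show ?thesis
  proof eventually_elim
    case (elim r)
    then have r: "0 < r" "r < pi / 2" by auto
    note pos = gsin_gcos_pos[OF r]
    have Kiff: "L (u, gcos X r) \<in> K \<longleftrightarrow> L (u, 0) \<in> T" if u: "norm u = gsin X r" for u
    proof -
      have "(u, gcos X r) = (u, 0) + gcos X r *\<^sub>R (0, 1)" by simp
      then have Lu: "L (u, gcos X r) = L (u, 0) + gcos X r *\<^sub>R x" by (metis lin L(4))
      have "a \<bullet> L (u, gcos X r) \<le> 0 \<longleftrightarrow> (a \<bullet> x = 0 \<longrightarrow> a \<bullet> L (u, 0) \<le> 0)" if a: "a \<in> N" for a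
      proof (cases "a \<bullet> x = 0")
        case False
        have "a \<bullet> L (u, 0) \<le> norm a * norm (L (u, 0))" by (rule norm_cauchy_schwarz)
        also have "\<dots> \<le> norm a * (B * gsin X r)"
          using B(2)[of "(u, 0)"] u by (intro mult_left_mono) auto
        finally have "a \<bullet> L (u, gcos X r) < 0"
          using elim a x(2) False by (fastforce simp: Lu inner_right_distrib mult.assoc)
        then show ?thesis using False by simp
      qed (simp add: Lu inner_right_distrib)
      then show ?thesis by (auto simp: T_def T0_def K_def tangent_cone_def)
    qed
    have Tscale: "t *\<^sub>R w \<in> T \<longleftrightarrow> w \<in> T" if "t > 0" for t w
      using that by (auto simp: T_def tangent_cone_def mult_le_0_iff)
    have T0: "T0 \<in> sets borel" "\<And>t u. t > 0 \<Longrightarrow> t *\<^sub>R u \<in> T0 \<longleftrightarrow> u \<in> T0"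
    proof -
      have "closed T0" unfolding T0_def T_def by (rule closed_tangent_cone_slice[OF L(1)])
      then show "T0 \<in> sets borel" by simp
      show "t *\<^sub>R u \<in> T0 \<longleftrightarrow> u \<in> T0" if "t > 0" for t u
        using Tscale[OF that, of "L (u, 0)"] lin(1)[of t "(u, 0)"] by (simp add: T0_def)
    qed
    let ?D = "pole_sector X r :: ('a \<times> real) set"
    have radial: "(u, s) \<in> ?D \<longleftrightarrow> (u', s) \<in> ?D" if "norm u = norm u'" for u u' s
      using that by (cases X) (auto simp: pole_sector_def norm_Pair dot_square_norm)
    have DT: "{p \<in> ?D. fst p \<in> T0} \<in> sets borel" "bounded {p \<in> ?D. fst p \<in> T0}"
    proof -
      have "fst -` T0 \<in> sets (borel :: ('a \<times> real) measure)"
        by (rule measurable_sets_borel[OF borel_measurable_continuous_onI T0(1)]) (intro continuous_intros)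
      moreover have "{p \<in> ?D. fst p \<in> T0} = ?D \<inter> fst -` T0" by auto
      ultimately show "{p \<in> ?D. fst p \<in> T0} \<in> sets borel"
        using pole_sector_borel[of X r, where 'a = 'a] by simp
      show "bounded {p \<in> ?D. fst p \<in> T0}"
        by (rule bounded_subset[OF pole_sector_bounded[OF r]]) auto
    qed
    have PK: "gsphere X x r \<inter> (points X \<inter> K) = gsphere X x r \<inter> K"
      by (auto simp: gsphere_def)
    have num: "gvolume (\<Union>y \<in> gsphere X x r \<inter> (points X \<inter> K). geodesic_segment X x y) =
        (DIM('a) + 1) * measure lborel {p \<in> ?D. fst p \<in> T0}"
      unfolding gvolume_def PK
      by (subst measure_swept_set[OF L(1-3) DT])
        (subst mem_swept_iff[OF r L(1,2,4-6) Kiff Tscale], auto simp: T0_def)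
    \<comment> \<open>The full sphere is the unconstrained case, with both sets taken to be
      \<open>UNIV\<close>.\<close>
    have den: "gvolume (\<Union>y \<in> gsphere X x r. geodesic_segment X x y) = (DIM('a) + 1) * measure lborel ?D"
      unfolding gvolume_def
      using mem_swept_iff[OF r L(1,2,4-6), of UNIV UNIV]
      by (subst measure_swept_set[OF L(1-3) pole_sector_borel pole_sector_bounded[OF r]]) auto
    have "emeasure lborel {p \<in> ?D. fst p \<in> T0} = ennreal (ball_fraction T0) * emeasure lborel ?D"
      by (rule emeasure_cone_times_radial[OF T0 pole_sector_borel radial])
    then have "measure lborel {p \<in> ?D. fst p \<in> T0} = ball_fraction T0 * measure lborel ?D"
      by (simp add: measure_def enn2real_mult ball_fraction_nonneg)
    then show ?case
      using pole_sector_measure_pos[OF r, of X, where 'a = 'a]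
      unfolding sphere_fraction_def K_def[symmetric] T_def[symmetric] T0_def[symmetric] num den by simp
  qed
qed

subsection \<open>Interior angles and faces of simplices\<close>

abbreviation trace_cone :: "geometry \<Rightarrow> ('a::euclidean_space \<times> real) set \<Rightarrow> ('a \<times> real) set" where
  "trace_cone X W \<equiv> points X \<inter> convex_cone hull W"

text \<open>Describing the tangent cone by short moves makes it depend on the cone alone, so tangent
  cones given by different normals can be compared.\<close>

lemma tangent_cone_iff_eventually:
  assumes "finite N" "\<forall>a\<in>N. a \<bullet> x \<le> 0"
  shows "w \<in> tangent_cone N x \<longleftrightarrow> (\<forall>\<^sub>F \<epsilon> in at_right 0. x + \<epsilon> *\<^sub>R w \<in> {p. \<forall>a\<in>N. a \<bullet> p \<le> 0})"
proof -
  have "(a \<bullet> x = 0 \<longrightarrow> a \<bullet> w \<le> 0) \<longleftrightarrow> (\<forall>\<^sub>F \<epsilon> in at_right 0. a \<bullet> (x + \<epsilon> *\<^sub>R w) \<le> 0)" if a: "a \<in> N" for a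
  proof (cases "a \<bullet> x = 0")
    case True
    have "(\<forall>\<^sub>F \<epsilon>::real in at_right 0. \<epsilon> * (a \<bullet> w) \<le> 0) \<longleftrightarrow> (\<forall>\<^sub>F \<epsilon>::real in at_right 0. a \<bullet> w \<le> 0)"
      by (rule eventually_cong[OF eventually_at_right_less]) (auto simp: mult_le_0_iff)
    then show ?thesis using True by (simp add: inner_right_distrib)
  next
    case False
    then have "a \<bullet> x < 0" using assms a by (simp add: less_le)
    moreover have "((\<lambda>\<epsilon>. a \<bullet> (x + \<epsilon> *\<^sub>R w)) \<longlongrightarrow> a \<bullet> (x + 0 *\<^sub>R w)) (at_right 0)"
      by (intro tendsto_intros)
    ultimately have "\<forall>\<^sub>F \<epsilon> in at_right 0. a \<bullet> (x + \<epsilon> *\<^sub>R w) < 0"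
      by (auto dest: order_tendstoD)
    then show ?thesis using False by (auto elim: eventually_mono)
  qed
  then show ?thesis
    by (simp add: tangent_cone_def eventually_ball_finite_distrib[OF assms(1)])
qed

text \<open>
  The centre chosen in \<^const>\<open>interior_angle\<close> depends only on \<open>X\<close> and the face \<open>F\<close>, so one and the same
  centre serves all polytopes that contain \<open>F\<close> as a face.
\<close>

lemma interior_angle_eq_ball_fraction:
  fixes N :: "('a::euclidean_space \<times> real) set" and L :: "'a \<times> real \<Rightarrow> 'a \<times> real"
  assumes "finite N" "x = (SOME x. x \<in> rel_interior_in X F)" "x \<in> points X" "\<forall>a\<in>N. a \<bullet> x \<le> 0"
    and L: "linear L" "bij L" "distr lborel borel L = lborel" "L (0, 1) = x"
    "\<And>p. L p \<in> points X \<longleftrightarrow> p \<in> points X" "\<And>p. p \<in> points X \<Longrightarrow> gdist X x (L p) = gdist X (0, 1) p"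
  shows "interior_angle X F (points X \<inter> {p. \<forall>a\<in>N. a \<bullet> p \<le> 0}) =
    ball_fraction {u. L (u, 0) \<in> tangent_cone N x}"
proof -
  let ?P = "points X \<inter> {p. \<forall>a\<in>N. a \<bullet> p \<le> 0}" and ?\<theta> = "ball_fraction {u. L (u, 0) \<in> tangent_cone N x}"
  have ev: "\<forall>\<^sub>F r in at_right 0. sphere_fraction X x r ?P = ?\<theta>"
    by (rule eventually_sphere_fraction[OF assms(1,3,4) L])
  have "(THE c. \<forall>\<^sub>F r in at_right 0. sphere_fraction X x r ?P = c) = ?\<theta>"
  proof (rule the_equality, rule ev)
    fix c assume "\<forall>\<^sub>F r in at_right 0. sphere_fraction X x r ?P = c"
    with ev have "\<forall>\<^sub>F r in at_right (0::real). c = ?\<theta>" by eventually_elim simp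
    then show "c = ?\<theta>" by simp
  qed
  then show ?thesis unfolding interior_angle_def assms(2)[symmetric] Let_def .
qed

lemma span_trace_cone:
  assumes "W \<subseteq> points X" shows "span (trace_cone X W) = span W"
proof
  have "convex_cone hull W \<subseteq> span W"
    by (intro hull_minimal span_superset) (simp add: convex_cone_iff span_add span_mul span_zero)
  then show "span (trace_cone X W) \<subseteq> span W"
    by (intro span_minimal subspace_span) auto
  show "span W \<subseteq> span (trace_cone X W)"
    using assms by (intro span_mono) (auto intro: hull_inc)
qed

lemma dim_trace_cone:
  assumes "W \<subseteq> points X" "independent W" shows "dim (trace_cone X W) = card W"
  using span_trace_cone[OF assms(1)] assms(2) by (metis dim_span dim_eq_card_independent)

text \<open>If a coordinate of \<open>x\<close> vanished, normalizing \<open>x - \<epsilon> *\<^sub>R v\<close> would leave the simplex arbitrarily close to \<open>x\<close>.\<close>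

lemma rel_interior_point_of_simplex:
  fixes W :: "('a::euclidean_space \<times> real) set"
  assumes W: "W \<subseteq> points X" "independent W" "W \<noteq> {}" and dom: "convex_cone hull W - {0} \<subseteq> gdom X"
  defines "x \<equiv> SOME x. x \<in> rel_interior_in X (trace_cone X W)"
  shows "x \<in> trace_cone X W" "\<And>v. v \<in> W \<Longrightarrow> 0 < dual W v \<bullet> x"
proof -
  let ?F = "trace_cone X W" and ?U = "points X \<inter> span W"
  have fin: "finite W" using W finiteI_independent by blast
  have ri: "rel_interior_in X ?F = (top_of_set ?U) interior_of ?F"
    by (simp add: rel_interior_in_def span_trace_cone[OF W(1)])
  have cone_iff: "p \<in> convex_cone hull W \<longleftrightarrow> p \<in> span W \<and> (\<forall>v\<in>W. 0 \<le> dual W v \<bullet> p)" for p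
    by (rule mem_convex_cone_hull_iff[OF W(2)])
  obtain z where z: "z \<in> points X" "z \<in> span W" "\<forall>v\<in>W. 0 < dual W v \<bullet> z"
  proof -
    \<comment> \<open>The normalized sum of the generators has all coordinates positive. It shows
      that the relative interior is nonempty, so that the chosen centre really lies in it.\<close>
    define s where "s = (\<Sum>v\<in>W. v)"
    have d: "dual W v \<bullet> s = 1" if "v \<in> W" for v
      using dual_sum[OF W(2) that order_refl, of "\<lambda>_. 1"] that by (simp add: s_def)
    have s: "s \<in> span W" unfolding s_def by (intro span_sum span_base)
    then have "s \<in> convex_cone hull W" using d cone_iff by auto
    moreover have "s \<noteq> 0" using d W(3) by (metis all_not_in_conv inner_zero_right zero_neq_one)
    ultimately have sd: "s \<in> gdom X" using dom by blast
    show thesis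
    proof (rule that)
      show "inverse (gnorm X s) *\<^sub>R s \<in> points X" by (rule normalize_in_points[OF sd])
      show "inverse (gnorm X s) *\<^sub>R s \<in> span W" by (intro span_mul s)
      show "\<forall>v\<in>W. 0 < dual W v \<bullet> (inverse (gnorm X s) *\<^sub>R s)"
        using d gnorm_pos[OF sd] by simp
    qed
  qed
  have "z \<in> (top_of_set ?U) interior_of ?F"
    unfolding interior_of_def mem_Collect_eq
  proof (intro exI conjI)
    let ?O = "\<Inter>v\<in>W. {p. 0 < dual W v \<bullet> p}"
    have "open ?O" using fin by (intro open_INT ballI open_halfspace_gt)
    then show "openin (top_of_set ?U) (?U \<inter> ?O)" by (rule openin_open_Int)
    show "z \<in> ?U \<inter> ?O" using z by simp
    show "?U \<inter> ?O \<subseteq> ?F" using cone_iff by (auto simp: less_imp_le)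
  qed
  then have x: "x \<in> (top_of_set ?U) interior_of ?F"
    unfolding x_def ri by (rule someI)
  then show xF: "x \<in> ?F" by (rule subsetD[OF interior_of_subset])
  obtain S where S: "open S" "x \<in> S" "?U \<inter> S \<subseteq> ?F"
    using x by (auto simp: interior_of_def openin_open)
  show "0 < dual W v \<bullet> x" if v: "v \<in> W" for v
  proof (rule ccontr)
    assume "\<not> 0 < dual W v \<bullet> x"
    then have d0: "dual W v \<bullet> x = 0" using xF cone_iff v by (metis IntD2 less_le)
    have xp: "x \<in> gdom X" "gnorm X x = 1" using xF points_iff_gnorm by blast+
    have lim: "((\<lambda>\<epsilon>. x - \<epsilon> *\<^sub>R v) \<longlongrightarrow> x) (at_right 0)"
      by (rule tendsto_eq_intros refl | simp)+
    have "isCont (gnorm X) x"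
      using continuous_on_gnorm[of UNIV X] continuous_on_eq_continuous_at[OF open_UNIV] by blast
    then have "((\<lambda>\<epsilon>. gnorm X (x - \<epsilon> *\<^sub>R v)) \<longlongrightarrow> gnorm X x) (at_right 0)"
      by (rule isCont_tendsto_compose) (rule lim)
    then have "((\<lambda>\<epsilon>. inverse (gnorm X (x - \<epsilon> *\<^sub>R v)) *\<^sub>R (x - \<epsilon> *\<^sub>R v)) \<longlongrightarrow> inverse 1 *\<^sub>R x) (at_right 0)"
      using xp lim by (intro tendsto_intros) auto
    then have "\<forall>\<^sub>F \<epsilon> in at_right 0. inverse (gnorm X (x - \<epsilon> *\<^sub>R v)) *\<^sub>R (x - \<epsilon> *\<^sub>R v) \<in> S"
      using S by (intro topological_tendstoD) auto
    moreover have "\<forall>\<^sub>F \<epsilon> in at_right 0. x - \<epsilon> *\<^sub>R v \<in> gdom X"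
      using open_gdom xp(1) by (intro topological_tendstoD[OF lim])
    ultimately have "\<forall>\<^sub>F \<epsilon> in at_right (0::real). False"
      using eventually_at_right_less[of 0]
    proof eventually_elim
      case (elim \<epsilon>)
      let ?n = "inverse (gnorm X (x - \<epsilon> *\<^sub>R v))"
      have "x \<in> span W" using xF cone_iff by blast
      then have "?n *\<^sub>R (x - \<epsilon> *\<^sub>R v) \<in> span W" using v span_base[of v W] by (intro span_mul span_diff)
      then have "?n *\<^sub>R (x - \<epsilon> *\<^sub>R v) \<in> ?F"
        using normalize_in_points elim S(3) by blast
      then have "0 \<le> dual W v \<bullet> (?n *\<^sub>R (x - \<epsilon> *\<^sub>R v))" using cone_iff v by blast
      also have "\<dots> = - (?n * \<epsilon>)"
        using d0 dual[OF W(2) v v] by (simp add: inner_diff_right)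
      finally show False using elim gnorm_pos[OF elim(2)] by (simp add: mult_le_0_iff)
    qed
    then show False by simp
  qed
qed

text \<open>A functional that is nonpositive on all generators vanishes at a point exactly if it
  vanishes at every generator with positive coordinate, so exposed faces correspond to sets of
  generators.\<close>

lemma faces_of_simplex:
  fixes B :: "('a::euclidean_space \<times> real) set"
  assumes B: "independent B" "B \<subseteq> points X" and dom: "convex_cone hull B - {0} \<subseteq> gdom X"
  shows "faces k (trace_cone X B) = trace_cone X ` {W. W \<subseteq> B \<and> card W = k + 1}"
proof (intro equalityI subsetI)
  fix F assume "F \<in> faces k (trace_cone X B)"
  then obtain a where a: "\<And>p. p \<in> trace_cone X B \<Longrightarrow> a \<bullet> p \<le> 0"
    "F = {p \<in> trace_cone X B. a \<bullet> p = 0}" and dimF: "dim F = k + 1"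
    by (auto simp: faces_def nonempty_face_def)
  let ?W = "{v \<in> B. a \<bullet> v = 0}"
  have fin: "finite B" using B finiteI_independent by blast
  have BT: "v \<in> trace_cone X B" if "v \<in> B" for v using that B by (auto intro: hull_inc)
  have "a \<bullet> p = 0 \<longleftrightarrow> p \<in> convex_cone hull ?W" if p: "p \<in> convex_cone hull B" for p
  proof -
    have ge: "\<forall>v\<in>B. 0 \<le> dual B v \<bullet> p" and eq: "p = (\<Sum>v\<in>B. (dual B v \<bullet> p) *\<^sub>R v)"
      using p mem_convex_cone_hull_iff[OF B(1)] dual_expansion[OF B(1)] by blast+
    have "a \<bullet> p = (\<Sum>v\<in>B. (dual B v \<bullet> p) * (a \<bullet> v))"
      by (subst eq) (simp add: inner_sum_right)
    then have "a \<bullet> p = 0 \<longleftrightarrow> (\<Sum>v\<in>B. - ((dual B v \<bullet> p) * (a \<bullet> v))) = 0"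
      by (simp add: sum_negf)
    also have "\<dots> \<longleftrightarrow> (\<forall>v\<in>B. - ((dual B v \<bullet> p) * (a \<bullet> v)) = 0)"
      using fin ge a(1) BT by (intro sum_nonneg_eq_0_iff) (auto intro: mult_nonneg_nonpos)
    also have "\<dots> \<longleftrightarrow> (\<forall>v\<in>B - ?W. dual B v \<bullet> p = 0)" by auto
    also have "\<dots> \<longleftrightarrow> p \<in> convex_cone hull ?W"
      using mem_convex_cone_hull_subset_iff[OF B(1), of ?W p] p by auto
    finally show ?thesis .
  qed
  moreover have "convex_cone hull ?W \<subseteq> convex_cone hull B" by (intro hull_mono) auto
  ultimately have F: "F = trace_cone X ?W" using a(2) by auto
  have "card ?W = dim (trace_cone X ?W)"
    using B independent_mono[OF B(1), of ?W] by (intro dim_trace_cone[symmetric]) auto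
  then show "F \<in> trace_cone X ` {W. W \<subseteq> B \<and> card W = k + 1}" using F dimF by auto
next
  fix F assume "F \<in> trace_cone X ` {W. W \<subseteq> B \<and> card W = k + 1}"
  then obtain W where W: "W \<subseteq> B" "card W = k + 1" "F = trace_cone X W" by blast
  have "dim F = k + 1" unfolding W(3)
    using W B independent_mono[OF B(1)] by (subst dim_trace_cone) auto
  moreover have "W \<noteq> {}" using W(2) by auto
  then have "F \<noteq> {}" using W B by (auto intro: hull_inc)
  moreover have "\<exists>a. (\<forall>p\<in>trace_cone X B. a \<bullet> p \<le> 0) \<and> F = {p \<in> trace_cone X B. a \<bullet> p = 0}"
  proof (intro exI conjI)
    note exposed = convex_cone_hull_exposed[OF B(1) W(1)]
    show "\<forall>p\<in>trace_cone X B. (- (\<Sum>v\<in>B - W. dual B v)) \<bullet> p \<le> 0" using exposed(1) by blast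
    show "F = {p \<in> trace_cone X B. (- (\<Sum>v\<in>B - W. dual B v)) \<bullet> p = 0}" using exposed(2) W(3) by blast
  qed
  ultimately show "F \<in> faces k (trace_cone X B)" by (simp add: faces_def nonempty_face_def)
qed

lemma trace_cone_eq_iff:
  assumes "independent B" "B \<subseteq> points X" "W \<subseteq> B" "W' \<subseteq> B"
  shows "trace_cone X W = trace_cone X W' \<longleftrightarrow> W = W'"
proof
  have sub: "V \<subseteq> V'" if "trace_cone X V = trace_cone X V'" "V \<subseteq> B" "V' \<subseteq> B" for V V'
  proof
    fix v assume v: "v \<in> V"
    then have "v \<in> trace_cone X V" using assms(2) that(2) hull_inc[of v V convex_cone] by blast
    then have "v \<in> convex_cone hull V'" using that by blast
    then have "\<forall>w\<in>B - V'. dual B w \<bullet> v = 0"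
      using mem_convex_cone_hull_subset_iff[OF assms(1) that(3)] by blast
    moreover have "v \<in> B" using v that(2) by blast
    moreover from this have "dual B v \<bullet> v = 1" using dual[OF assms(1), of v v] by simp
    ultimately show "v \<in> V'" by (metis DiffI zero_neq_one)
  qed
  assume eq: "trace_cone X W = trace_cone X W'"
  show "W = W'"
    using sub[OF eq assms(3,4)] sub[OF eq[symmetric] assms(4,3)] by (rule equalityI)
qed simp

subsection \<open>Additivity of interior angles\<close>

text \<open>The functional pulled back by \<open>L\<close> kills the pole, so a vanishing first
  component would make it zero altogether, contrary to surjectivity of \<open>L\<close>. The slice
  is therefore a hyperplane.\<close>

lemma negligible_slice_hyperplane:
  fixes L :: "'a::euclidean_space \<times> real \<Rightarrow> 'a \<times> real"
  assumes L: "linear L" "surj L" and b: "b \<noteq> 0" "b \<bullet> L (0, 1) = 0"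
  shows "negligible {u. b \<bullet> L (u, 0) = 0}"
proof -
  define a where "a = adjoint L b"
  have a: "b \<bullet> L p = a \<bullet> p" for p
    using adjoint_works[OF L(1), of p b] by (simp add: a_def inner_commute)
  have "fst a \<noteq> 0"
  proof
    assume "fst a = 0"
    moreover have "a \<bullet> (0, 1) = 0" using b(2) a by metis
    then have "snd a = 0" by (simp add: inner_prod_def)
    ultimately have "a = 0" by (simp add: prod_eq_iff)
    then have "b \<bullet> L p = 0" for p by (simp add: a)
    then have "b \<bullet> b = 0" using L(2) by (metis surjD)
    then show False using b(1) by simp
  qed
  moreover have "b \<bullet> L (u, 0) = fst a \<bullet> u" for u unfolding a by (simp add: inner_prod_def)
  ultimately show ?thesis by (simp add: negligible_hyperplane)
qed

text \<open>The normals \<open>N\<close> are kept as a parameter because tangent cones are formed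
  from them. By \<open>K_gdom\<close> every nonzero point of \<open>K\<close> can be rescaled into
  the space, so cone and polytope determine each other.\<close>

locale star_triangulation = simplicial_cone K \<G> c
  for K :: "('a::euclidean_space \<times> real) set" and \<G> c +
  fixes X :: geometry and N
  assumes K_eq: "K = {p. \<forall>a\<in>N. a \<bullet> p \<le> 0}" and finite_N: "finite N"
    and K_gdom: "K - {0} \<subseteq> gdom X"
    and vertices: "\<Union>\<G> \<subseteq> points X" "c \<in> points X"
begin

lemma insert_c_points: "G \<in> \<G> \<Longrightarrow> insert c G \<subseteq> points X"
  using vertices by blast

lemma hull_gdom: "G \<in> \<G> \<Longrightarrow> W \<subseteq> insert c G \<Longrightarrow> convex_cone hull W - {0} \<subseteq> gdom X"
  using hull_insert_c_subset[of G] K_gdom hull_mono[of W "insert c G" convex_cone] by blast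

text \<open>One centre \<open>x\<close> and one map \<open>L\<close> serve \<open>K\<close> and all
  simplices containing \<open>W\<close>. In the unit ball the slices of the simplices' tangent cones
  cover that of \<open>K\<close> and overlap in a null set, since a generic direction enters exactly
  one simplex. If \<open>c \<in> W\<close>, the centre is interior to \<open>K\<close> and every
  direction is feasible.\<close>

lemma interior_angle_split:
  assumes G0: "G0 \<in> \<G>" "W \<subseteq> insert c G0" "W \<noteq> {}"
  shows "(\<Sum>G | G \<in> \<G> \<and> W \<subseteq> insert c G.
      interior_angle X (trace_cone X W) (trace_cone X (insert c G))) =
    interior_angle X (trace_cone X W) (points X \<inter> K)"
    and "c \<in> W \<Longrightarrow> interior_angle X (trace_cone X W) (points X \<inter> K) = 1"
proof -
  define x where "x = (SOME x. x \<in> rel_interior_in X (trace_cone X W))"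
  have W: "W \<subseteq> points X" "independent W"
    using G0 insert_c_points independent_mono[OF independent_insert_c] by blast+
  note ri = rel_interior_point_of_simplex[OF W G0(3) hull_gdom[OF G0(1,2)], folded x_def]
  define u where "u v = dual W v \<bullet> x" for v
  have u: "\<And>v. v \<in> W \<Longrightarrow> 0 < u v" using ri(2) by (simp add: u_def)
  have x_eq: "x = (\<Sum>v\<in>W. u v *\<^sub>R v)"
    unfolding u_def using ri(1) mem_convex_cone_hull_iff[OF W(2)] by (intro dual_expansion[OF W(2)]) blast
  have xp: "x \<in> points X" using ri(1) by blast
  have xW: "x \<in> convex_cone hull W" using ri(1) by blast
  obtain L :: "'a \<times> real \<Rightarrow> 'a \<times> real" where L: "linear L" "bij L" "distr lborel borel L = lborel" "L (0, 1) = x"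
    "\<And>p. L p \<in> points X \<longleftrightarrow> p \<in> points X" "\<And>p. p \<in> points X \<Longrightarrow> gdist X x (L p) = gdist X (0, 1) p"
    using point_isometry[OF xp] by metis
  \<comment> \<open>Outer normals of the simplicial cone are the negated coordinate
    functionals.\<close>
  define NG where "NG G = (\<lambda>v. - dual (insert c G) v) ` insert c G" for G
  define Gs where "Gs = {G. G \<in> \<G> \<and> W \<subseteq> insert c G}"
  define A where "A M = {u. L (u, 0) \<in> tangent_cone M x} \<inter> cball 0 1" for M
  have finGs: "finite Gs" using finite_facets by (simp add: Gs_def)
  have finNG: "finite (NG G)" if "G \<in> \<G>" for G using finite_facet[OF that] by (simp add: NG_def)
  have hull_NG: "convex_cone hull (insert c G) = {p. \<forall>a\<in>NG G. a \<bullet> p \<le> 0}" if "G \<in> \<G>" for G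
    using hull_insert_c_iff[OF that] by (auto simp: NG_def)
  have xK: "x \<in> K" using xW G0 hull_insert_c_subset[of G0] hull_mono[OF G0(2), of convex_cone] by blast
  have xG: "x \<in> convex_cone hull (insert c G)" if "G \<in> Gs" for G
    using xW that hull_mono[of W "insert c G" convex_cone] by (auto simp: Gs_def)
  have angle_K: "interior_angle X (trace_cone X W) (points X \<inter> K) = ball_fraction {u. L (u, 0) \<in> tangent_cone N x}"
    using xK unfolding K_eq
    by (intro interior_angle_eq_ball_fraction[OF finite_N x_def xp _ L]) auto
  have angle_G: "interior_angle X (trace_cone X W) (trace_cone X (insert c G)) =
      ball_fraction {u. L (u, 0) \<in> tangent_cone (NG G) x}" if G: "G \<in> Gs" for G
  proof -
    have "G \<in> \<G>" using G by (simp add: Gs_def)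
    then show ?thesis
      using xG[OF G] finNG unfolding hull_NG[OF \<open>G \<in> \<G>\<close>]
      by (intro interior_angle_eq_ball_fraction[OF _ x_def xp _ L]) auto
  qed
  have tK: "w \<in> tangent_cone N x \<longleftrightarrow> (\<forall>\<^sub>F \<epsilon> in at_right 0. x + \<epsilon> *\<^sub>R w \<in> K)" for w
    using xK unfolding K_eq by (intro tangent_cone_iff_eventually finite_N) auto
  have tG_sub: "tangent_cone (NG G) x \<subseteq> tangent_cone N x" if G: "G \<in> Gs" for G
  proof
    fix w assume w: "w \<in> tangent_cone (NG G) x"
    have "G \<in> \<G>" using G by (simp add: Gs_def)
    have "\<forall>\<^sub>F \<epsilon> in at_right 0. x + \<epsilon> *\<^sub>R w \<in> convex_cone hull (insert c G)"
      using w xG[OF G] tangent_cone_iff_eventually[OF finNG[OF \<open>G \<in> \<G>\<close>]]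
      unfolding hull_NG[OF \<open>G \<in> \<G>\<close>] by blast
    then show "w \<in> tangent_cone N x"
      unfolding tK by (rule eventually_mono) (use hull_insert_c_subset[OF \<open>G \<in> \<G>\<close>] in blast)
  qed
  have coord: "dual (insert c G) v \<bullet> x = (if v \<in> W then u v else 0)" if "G \<in> Gs" "v \<in> insert c G" for G v
    unfolding x_eq using that by (subst dual_sum[OF independent_insert_c]) (auto simp: Gs_def)
  have tG: "w \<in> tangent_cone (NG G) x \<longleftrightarrow> (\<forall>v\<in>insert c G - W. 0 \<le> dual (insert c G) v \<bullet> w)"
    if G: "G \<in> Gs" for G w
  proof -
    have "dual (insert c G) v \<bullet> x = 0 \<longleftrightarrow> v \<notin> W" if "v \<in> insert c G" for v
      using coord[OF G that] u[of v] by (cases "v \<in> W") auto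
    then show ?thesis by (simp add: tangent_cone_def NG_def) blast
  qed
  \<comment> \<open>The directions that are not generic. Coordinates off \<open>W\<close> vanish at
    \<open>x\<close>, the image of the pole, so each condition cuts a hyperplane out of the
    slice.\<close>
  define Z where "Z = (\<Union>G\<in>Gs. \<Union>v\<in>insert c G - W. {u. dual (insert c G) v \<bullet> L (u, 0) = 0})"
  have negZ: "negligible Z"
    unfolding Z_def
  proof (intro negligible_Union finite_imageI finGs ballI; clarify?)
    fix G assume G: "G \<in> Gs"
    then have "G \<in> \<G>" by (simp add: Gs_def)
    show "negligible (\<Union>v\<in>insert c G - W. {u. dual (insert c G) v \<bullet> L (u, 0) = 0})"
    proof (intro negligible_Union finite_imageI ballI; clarify?)
      show "finite (insert c G - W)" using finite_facet[OF \<open>G \<in> \<G>\<close>] by simp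
      fix v assume v: "v \<in> insert c G" "v \<notin> W"
      have "dual (insert c G) v \<bullet> v = 1"
        using dual[OF independent_insert_c[OF \<open>G \<in> \<G>\<close>] v(1) v(1)] by simp
      then have "dual (insert c G) v \<noteq> 0" by auto
      moreover have "dual (insert c G) v \<bullet> L (0, 1) = 0" using coord[OF G v(1)] v(2) L(4) by simp
      ultimately show "negligible {u. dual (insert c G) v \<bullet> L (u, 0) = 0}"
        using L(1,2) by (intro negligible_slice_hyperplane bij_is_surj)
    qed
  qed
  have unique: "\<exists>!G. G \<in> Gs \<and> L (y, 0) \<in> tangent_cone (NG G) x"
    if y: "y \<notin> Z" "L (y, 0) \<in> tangent_cone N x" for y
  proof -
    have nz: "dual (insert c G) v \<bullet> L (y, 0) \<noteq> 0" if "G \<in> Gs" "v \<in> insert c G - W" for G v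
      using y(1) that by (auto simp: Z_def)
    have "\<exists>!G. G \<in> \<G> \<and> W \<subseteq> insert c G \<and> (\<forall>v\<in>insert c G - W. 0 < dual (insert c G) v \<bullet> L (y, 0))"
      using y(2) nz unfolding tK
      by (intro unique_simplex_towards[OF G0(1,2) x_eq u]) (auto simp: Gs_def)
    moreover have "(G \<in> \<G> \<and> W \<subseteq> insert c G \<and> (\<forall>v\<in>insert c G - W. 0 < dual (insert c G) v \<bullet> L (y, 0))) \<longleftrightarrow>
        (G \<in> Gs \<and> L (y, 0) \<in> tangent_cone (NG G) x)" for G
    proof (cases "G \<in> Gs")
      case True
      then have "(\<forall>v\<in>insert c G - W. 0 < dual (insert c G) v \<bullet> L (y, 0)) \<longleftrightarrow>
          (\<forall>v\<in>insert c G - W. 0 \<le> dual (insert c G) v \<bullet> L (y, 0))"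
        using nz by (metis less_le)
      then show ?thesis using True tG[OF True] by (simp add: Gs_def)
    qed (auto simp: Gs_def)
    ultimately show ?thesis by simp
  qed
  have lmeas: "A M \<in> lmeasurable" for M
    unfolding A_def
    by (rule lmeasurable_compact) (intro closed_Int_compact closed_tangent_cone_slice L compact_cball)
  have "measure lebesgue (\<Union>G\<in>Gs. A (NG G)) = (\<Sum>G\<in>Gs. measure lebesgue (A (NG G)))"
  proof (rule measure_negligible_finite_Union_image[OF finGs lmeas])
    show "pairwise (\<lambda>G H. negligible (A (NG G) \<inter> A (NG H))) Gs"
    proof (rule pairwiseI)
      fix G H assume GH: "G \<in> Gs" "H \<in> Gs" "G \<noteq> H"
      have "A (NG G) \<inter> A (NG H) \<subseteq> Z"
      proof
        fix y assume y: "y \<in> A (NG G) \<inter> A (NG H)"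
        show "y \<in> Z"
        proof (rule ccontr)
          assume "y \<notin> Z"
          moreover have "L (y, 0) \<in> tangent_cone N x" using y tG_sub[OF GH(1)] by (auto simp: A_def)
          ultimately show False using unique y GH by (auto simp: A_def)
        qed
      qed
      then show "negligible (A (NG G) \<inter> A (NG H))" using negZ negligible_subset by blast
    qed
  qed
  moreover have "measure lebesgue (A N) = measure lebesgue (\<Union>G\<in>Gs. A (NG G))"
  proof (rule measure_negligible_symdiff)
    show "(\<Union>G\<in>Gs. A (NG G)) \<in> lmeasurable" using finGs lmeas by (intro fmeasurable.finite_UN) auto
    have "(\<Union>G\<in>Gs. A (NG G)) \<subseteq> A N" using tG_sub by (auto simp: A_def)
    moreover have "A N - Z \<subseteq> (\<Union>G\<in>Gs. A (NG G))" using unique by (fastforce simp: A_def)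
    ultimately have "(\<Union>G\<in>Gs. A (NG G)) - A N \<union> (A N - (\<Union>G\<in>Gs. A (NG G))) \<subseteq> Z" by blast
    then show "negligible ((\<Union>G\<in>Gs. A (NG G)) - A N \<union> (A N - (\<Union>G\<in>Gs. A (NG G))))"
      using negZ negligible_subset by blast
  qed
  ultimately have sum: "measure lebesgue (A N) = (\<Sum>G\<in>Gs. measure lebesgue (A (NG G)))" by simp
  have frac: "ball_fraction {u. L (u, 0) \<in> tangent_cone M x} =
      measure lebesgue (A M) / measure lborel (cball 0 1 :: 'a set)" for M
  proof -
    have "A M \<in> sets borel"
      using closed_tangent_cone_slice[OF L(1), of M x] by (simp add: A_def)
    then show ?thesis by (simp add: ball_fraction_def A_def measure_completion)
  qed
  show "(\<Sum>G | G \<in> \<G> \<and> W \<subseteq> insert c G.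
      interior_angle X (trace_cone X W) (trace_cone X (insert c G))) =
    interior_angle X (trace_cone X W) (points X \<inter> K)"
    unfolding Gs_def[symmetric] using angle_G angle_K sum frac by (simp add: sum_divide_distrib)
  assume cW: "c \<in> W"
  have "x = (\<Sum>v\<in>W - {c}. u v *\<^sub>R v) + u c *\<^sub>R c"
    using sum.remove[OF finiteI_independent[OF W(2)] cW, of "\<lambda>v. u v *\<^sub>R v"]
    by (simp add: x_eq add.commute)
  moreover have "(\<Sum>v\<in>W - {c}. u v *\<^sub>R v) \<in> K"
    using u G0 W(2) finiteI_independent
    by (intro subsetD[OF facet_hull_subset[OF G0(1)]] convex_cone_hull_sum) (auto simp: less_imp_le)
  ultimately have "x \<in> interior K" using add_c_in_interior u[OF cW] by simp
  then have "{u. L (u, 0) \<in> tangent_cone N x} = UNIV"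
    using tK eventually_towards_of_interior by blast
  then show "interior_angle X (trace_cone X W) (points X \<inter> K) = 1"
    unfolding angle_K using measure_lborel_cball_pos[where 'a = 'a] by (simp add: ball_fraction_def)
qed

end

subsection \<open>Summing over the star triangulation\<close>

context star_triangulation
begin

lemma span_polytope: "span (points X \<inter> K) = UNIV"
proof -
  have "K \<subseteq> span (points X \<inter> K)"
  proof
    fix p assume p: "p \<in> K"
    show "p \<in> span (points X \<inter> K)"
    proof (cases "p = 0")
      case False
      then have d: "p \<in> gdom X" using p K_gdom by blast
      let ?q = "inverse (gnorm X p) *\<^sub>R p"
      have pos: "gnorm X p > 0" by (rule gnorm_pos[OF d])
      have "?q \<in> K" using pos p convex_cone by (intro convex_cone_scaleR) auto
      then have "gnorm X p *\<^sub>R ?q \<in> span (points X \<inter> K)"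
        using normalize_in_points[OF d] by (intro span_mul span_base) auto
      then show ?thesis using pos by simp
    qed (simp add: span_zero)
  qed
  moreover have "dim K = DIM('a \<times> real)"
    using c(1) empty_interior_lowdim[of K] dim_subset_UNIV[of K] by fastforce
  ultimately have "dim (points X \<inter> K) = DIM('a \<times> real)"
    using dim_subset_UNIV[of "points X \<inter> K"] by (metis dim_span dim_subset le_antisym)
  then show ?thesis by (simp only: dim_eq_full)
qed

lemma exposing_functional_on_cone:
  assumes "\<And>p. p \<in> points X \<inter> K \<Longrightarrow> a \<bullet> p \<le> 0" "p \<in> K"
  shows "a \<bullet> p \<le> 0"
proof (cases "p = 0")
  case False
  then have d: "p \<in> gdom X" using assms(2) K_gdom by blast
  have pos: "gnorm X p > 0" by (rule gnorm_pos[OF d])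
  have "inverse (gnorm X p) *\<^sub>R p \<in> K" using pos assms(2) convex_cone by (intro convex_cone_scaleR) auto
  then have "a \<bullet> (inverse (gnorm X p) *\<^sub>R p) \<le> 0" using normalize_in_points[OF d] assms(1) by blast
  then show ?thesis using pos by (simp add: mult_le_0_iff)
qed simp

lemma finite_boundary_complex: "finite boundary_complex"
  using finite_facets finite_facet by auto

text \<open>An exposing functional on the polytope also exposes a face of \<open>K\<close>; being
  proper, that face lies in a facet and so comes from a face of a simplex. Conversely, a face of a
  facet is a face of \<open>K\<close>, and faces of a polyhedron are exposed.\<close>

lemma faces_polytope:
  assumes k: "k + 1 \<le> DIM('a)"
  shows "faces k (points X \<inter> K) = trace_cone X ` {W \<in> boundary_complex. card W = k + 1}"
proof (intro equalityI subsetI)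
  fix F assume "F \<in> faces k (points X \<inter> K)"
  then obtain a where a: "\<And>p. p \<in> points X \<inter> K \<Longrightarrow> a \<bullet> p \<le> 0"
    "F = {p \<in> points X \<inter> K. a \<bullet> p = 0}" and F: "F \<noteq> {}" "dim F = k + 1"
    by (auto simp: faces_def nonempty_face_def)
  let ?C = "K \<inter> {p. a \<bullet> p = 0}"
  have "?C face_of K"
    using exposing_functional_on_cone[OF a(1)] polyhedron polyhedron_imp_convex
    by (intro face_of_Int_supporting_hyperplane_le) auto
  moreover have "?C \<noteq> {}" using F a(2) by blast
  \<comment> \<open>The dimension bound enters here: the whole polytope spans all
    \<open>DIM('a) + 1\<close> dimensions, more than \<open>k + 1\<close>.\<close>
  moreover have "?C \<noteq> K"
  proof
    assume "?C = K"
    then have "F = points X \<inter> K" using a(2) by blast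
    then have "dim F = DIM('a \<times> real)" using span_polytope by (metis dim_span dim_UNIV)
    then show False using F(2) k by simp
  qed
  ultimately obtain H where "H facet_of K" "?C \<subseteq> H"
    using face_of_polyhedron_subset_facet[OF polyhedron] by metis
  then obtain G where G: "G \<in> \<G>" "?C \<subseteq> convex_cone hull G" using facet_cases by metis
  have FG: "F = {p \<in> trace_cone X G. a \<bullet> p = 0}"
    using G facet_hull_subset[OF G(1)] a(2) by blast
  moreover have "\<forall>p\<in>trace_cone X G. a \<bullet> p \<le> 0"
    using a(1) facet_hull_subset[OF G(1)] by blast
  ultimately have "F \<in> faces k (trace_cone X G)"
    using F unfolding faces_def nonempty_face_def by blast
  then show "F \<in> trace_cone X ` {W \<in> boundary_complex. card W = k + 1}"
    using faces_of_simplex[OF indep[OF G(1)] _ hull_gdom[OF G(1) subset_insertI], of k] insert_c_points[OF G(1)] G(1)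
    by auto
next
  fix F assume "F \<in> trace_cone X ` {W \<in> boundary_complex. card W = k + 1}"
  then obtain W G where W: "G \<in> \<G>" "W \<subseteq> G" "card W = k + 1" "F = trace_cone X W" by blast
  have Wp: "W \<subseteq> points X" "independent W"
    using W vertices indep independent_mono by blast+
  have "convex_cone hull W face_of K"
    using convex_cone_hull_face_of[OF indep[OF W(1)] W(2)] facet[OF W(1)] face_of_trans facet_of_imp_face_of
    by blast
  then have "convex_cone hull W exposed_face_of K"
    using exposed_face_of_polyhedron[OF polyhedron] by blast
  moreover have zero: "0 \<in> convex_cone hull W" by (rule convex_cone_hull_contains_0)
  ultimately have "\<exists>a. K \<subseteq> {x. a \<bullet> x \<le> 0} \<and> convex_cone hull W = K \<inter> {x. a \<bullet> x = 0}"
  proof (unfold exposed_face_of, elim conjE disjE exE)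
    assume "convex_cone hull W = K"
    then show ?thesis by (intro exI[of _ 0]) simp
  next
    fix a b assume *: "K \<subseteq> {x. a \<bullet> x \<le> b}" "convex_cone hull W = K \<inter> {x. a \<bullet> x = b}"
    then have "b = 0" using zero by auto
    then show ?thesis using * by blast
  qed auto
  moreover have "dim F = k + 1" using dim_trace_cone[OF Wp] W by simp
  moreover have "F \<noteq> {}"
  proof -
    have "W \<noteq> {}" using W(3) by auto
    then obtain v where "v \<in> W" by blast
    then have "v \<in> F" using W(4) Wp hull_inc[of v W convex_cone] by blast
    then show ?thesis by blast
  qed
  ultimately show "F \<in> faces k (points X \<inter> K)"
    using W(4) unfolding faces_def nonempty_face_def by blast
qed

text \<open>The sum of the vertices of one set lies in the hull of the other, hence in the hull of
  the other's facet. Both sets therefore consist of vertices of one facet, where coordinates tell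
  them apart.\<close>

lemma inj_on_trace_cone: "inj_on (trace_cone X) {W \<in> boundary_complex. W \<noteq> {}}"
proof (rule inj_onI)
  have sub: "V \<subseteq> G'" if V: "G \<in> \<G>" "V \<subseteq> G" "V \<noteq> {}" and V': "G' \<in> \<G>" "V' \<subseteq> G'"
    and eq: "trace_cone X V = trace_cone X V'" for V V' G G'
  proof -
    have Vp: "V \<subseteq> points X" using V vertices by blast
    have "V \<subseteq> convex_cone hull V'"
      using Vp eq hull_subset[of V convex_cone] by blast
    then have "convex_cone hull V \<subseteq> convex_cone hull V'"
      by (simp add: convex_cone_convex_cone_hull hull_minimal)
    moreover have "(\<Sum>v\<in>V. 1 *\<^sub>R v) \<in> convex_cone hull V"
      using V(2) finite_facet[OF V(1)] by (intro convex_cone_hull_sum) (auto intro: finite_subset)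
    moreover have "convex_cone hull V' \<subseteq> convex_cone hull G'" by (rule hull_mono[OF V'(2)])
    ultimately show ?thesis
      using facet_contains_support[OF V(1) V'(1) V(2), of "\<lambda>_. 1"] by auto
  qed
  fix W W' assume W: "W \<in> {W \<in> boundary_complex. W \<noteq> {}}" "W' \<in> {W \<in> boundary_complex. W \<noteq> {}}"
    and eq: "trace_cone X W = trace_cone X W'"
  obtain G G' where G: "G \<in> \<G>" "W \<subseteq> G" "G' \<in> \<G>" "W' \<subseteq> G'" using W by blast
  have "W \<subseteq> G'" using sub[OF G(1,2) _ G(3,4) eq] W by blast
  then show "W = W'"
    using trace_cone_eq_iff[OF indep[OF G(3)] _ _ G(4)] vertices G(3) eq by blast
qed

section \<open>Counting faces and angles of the polytope and of the star\<close>

lemma angle_sum_polytope: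
  assumes "k + 1 \<le> DIM('a)"
  shows "angle_sum X k (points X \<inter> K) =
    (\<Sum>W | W \<in> boundary_complex \<and> card W = k + 1. interior_angle X (trace_cone X W) (points X \<inter> K))"
proof -
  have "inj_on (trace_cone X) {W \<in> boundary_complex. card W = k + 1}"
    by (rule inj_on_subset[OF inj_on_trace_cone]) auto
  then show ?thesis by (simp add: angle_sum_def faces_polytope[OF assms] sum.reindex)
qed

lemma num_faces_polytope:
  assumes "k + 1 \<le> DIM('a)"
  shows "num_faces k (points X \<inter> K) = card {W \<in> boundary_complex. card W = k + 1}"
proof -
  have "inj_on (trace_cone X) {W \<in> boundary_complex. card W = k + 1}"
    by (rule inj_on_subset[OF inj_on_trace_cone]) auto
  then show ?thesis by (simp add: num_faces_def faces_polytope[OF assms] card_image)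
qed

lemma faces_star_simplex:
  assumes "G \<in> \<G>"
  shows "faces k (trace_cone X (insert c G)) = trace_cone X ` {W. W \<subseteq> insert c G \<and> card W = k + 1}"
    and "inj_on (trace_cone X) {W. W \<subseteq> insert c G \<and> card W = k + 1}"
  using faces_of_simplex[OF independent_insert_c[OF assms] insert_c_points[OF assms] hull_gdom[OF assms order_refl]]
    trace_cone_eq_iff[OF independent_insert_c[OF assms] insert_c_points[OF assms]]
  by (auto simp: inj_on_def)

lemma num_faces_star_simplex:
  assumes "G \<in> \<G>"
  shows "num_faces k (trace_cone X (insert c G)) = (DIM('a) + 1) choose (k + 1)"
  using faces_star_simplex[OF assms, of k] card_insert_c[OF assms] finite_facet[OF assms]
  by (simp add: num_faces_def card_image n_subsets)

text \<open>Exchanging the sums over simplices and faces collects the angles at each face of the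
  star. A boundary set of size \<open>j + 1\<close> yields its angle in the polytope; the others are
  \<open>insert c W\<close> with \<open>W\<close> of size \<open>j\<close>, each yielding 1. For
  \<open>j = 0\<close> the extra face is the vertex \<open>c\<close>, coming from the empty
  set.\<close>

lemma sum_angle_sum_star_simplices:
  assumes j: "j + 1 \<le> DIM('a)"
  shows "(\<Sum>G\<in>\<G>. angle_sum X j (trace_cone X (insert c G))) =
    angle_sum X j (points X \<inter> K) + real (card {W \<in> boundary_complex. card W = j})"
proof -
  define B where "B = {W \<in> boundary_complex. card W = j + 1}"
  define I where "I = {W \<in> boundary_complex. card W = j}"
  let ?IA = "\<lambda>W. interior_angle X (trace_cone X W)"
  have fin: "finite B" "finite I"
    unfolding B_def I_def by (rule finite_subset[OF _ finite_boundary_complex], blast)+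
  have cI: "c \<notin> W" "finite W" if "W \<in> boundary_complex" for W
    using that c_notin_facet finite_facet finite_subset by blast+
  have star: "W \<in> B \<union> insert c ` I" if "G \<in> \<G>" "W \<subseteq> insert c G" "card W = j + 1" for W G
  proof (cases "c \<in> W")
    case True
    have "W - {c} \<in> I"
      using that True finite_facet[OF that(1)] finite_subset[OF that(2)] by (auto simp: I_def)
    then show ?thesis using True by (metis UnI2 imageI insert_Diff)
  qed (use that in \<open>auto simp: B_def\<close>)
  have "card (insert c W) = j + 1" if "W \<in> I" for W
    using that cI[of W] by (simp add: I_def)
  then have cardW: "card W = j + 1" "\<exists>G\<in>\<G>. W \<subseteq> insert c G" if "W \<in> B \<union> insert c ` I" for W
    using that by (auto simp: B_def I_def)
  have "(\<Sum>G\<in>\<G>. angle_sum X j (trace_cone X (insert c G))) =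
      (\<Sum>G\<in>\<G>. \<Sum>W | W \<in> B \<union> insert c ` I \<and> W \<subseteq> insert c G. ?IA W (trace_cone X (insert c G)))"
  proof (intro sum.cong refl)
    fix G assume G: "G \<in> \<G>"
    have "{W. W \<subseteq> insert c G \<and> card W = j + 1} = {W. W \<in> B \<union> insert c ` I \<and> W \<subseteq> insert c G}"
      using star[OF G] cardW(1) by blast
    then show "angle_sum X j (trace_cone X (insert c G)) =
        (\<Sum>W | W \<in> B \<union> insert c ` I \<and> W \<subseteq> insert c G. ?IA W (trace_cone X (insert c G)))"
      using faces_star_simplex[OF G, of j] by (simp add: angle_sum_def sum.reindex)
  qed
  also have "\<dots> = (\<Sum>W\<in>B \<union> insert c ` I. \<Sum>G | G \<in> \<G> \<and> W \<subseteq> insert c G. ?IA W (trace_cone X (insert c G)))"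
    using fin finite_facets by (intro sum.swap_restrict) auto
  also have "\<dots> = (\<Sum>W\<in>B \<union> insert c ` I. ?IA W (points X \<inter> K))"
  proof (intro sum.cong refl)
    fix W assume W: "W \<in> B \<union> insert c ` I"
    then obtain G where "G \<in> \<G>" "W \<subseteq> insert c G" using cardW(2) by blast
    moreover have "W \<noteq> {}" using cardW(1)[OF W] by auto
    ultimately show "(\<Sum>G | G \<in> \<G> \<and> W \<subseteq> insert c G. ?IA W (trace_cone X (insert c G))) = ?IA W (points X \<inter> K)"
      by (rule interior_angle_split)
  qed
  also have "\<dots> = (\<Sum>W\<in>B. ?IA W (points X \<inter> K)) + (\<Sum>W\<in>insert c ` I. ?IA W (points X \<inter> K))"
    using fin cI by (intro sum.union_disjoint) (auto simp: B_def)
  also have "(\<Sum>W\<in>insert c ` I. ?IA W (points X \<inter> K)) = (\<Sum>W\<in>insert c ` I. 1)"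
  proof (intro sum.cong refl)
    fix W assume W: "W \<in> insert c ` I"
    then obtain G where "G \<in> \<G>" "W \<subseteq> insert c G" using cardW(2) by blast
    moreover have "W \<noteq> {}" "c \<in> W" using W by auto
    ultimately show "?IA W (points X \<inter> K) = 1" by (rule interior_angle_split)
  qed
  also have "(\<Sum>W\<in>insert c ` I. 1) = real (card I)"
  proof -
    have "inj_on (insert c) I" using cI(1) by (intro inj_onI) (simp add: I_def insert_ident)
    then show ?thesis by (simp add: card_image)
  qed
  finally show ?thesis using angle_sum_polytope[OF j] by (simp add: B_def I_def)
qed

lemma sum_by_card_boundary_complex:
  "(\<Sum>W\<in>boundary_complex. f (card W)) =
    (\<Sum>j\<le>DIM('a). f j * real (card {W \<in> boundary_complex. card W = j}))"
proof -
  have "card W \<le> DIM('a)" if "W \<in> boundary_complex" for W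
    using that card_facet card_mono[OF finite_facet] by fastforce
  then have "(\<Sum>W\<in>boundary_complex. f (card W)) =
      (\<Sum>j\<le>DIM('a). \<Sum>W | W \<in> boundary_complex \<and> card W = j. f (card W))"
    using finite_boundary_complex by (intro sum.group[symmetric]) auto
  also have "\<dots> = (\<Sum>j\<le>DIM('a). f j * real (card {W \<in> boundary_complex. card W = j}))"
    by (intro sum.cong) auto
  finally show ?thesis .
qed

text \<open>Summing the relations of the simplices brings in \<open>n j\<close> through the faces at
  \<open>c\<close> and \<open>n d\<close> as the number of simplices; the Dehn-Sommerville equations
  remove everything except \<open>n (k + 1)\<close>, the number of \<open>k\<close>-faces.\<close>

lemma perles_relation_of_simplices:
  assumes k: "k + 1 \<le> DIM('a)"
    and simplices: "\<And>G. G \<in> \<G> \<Longrightarrow>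
      (\<Sum>j=k..DIM('a) - 1. (-1) ^ j * real ((j + 1) choose (k + 1)) * angle_sum X j (trace_cone X (insert c G)))
        = (-1) ^ DIM('a) * (angle_sum X k (trace_cone X (insert c G))
            - real (num_faces k (trace_cone X (insert c G))))"
  shows "(\<Sum>j=k..DIM('a) - 1. (-1) ^ j * real ((j + 1) choose (k + 1)) * angle_sum X j (points X \<inter> K))
    = (-1) ^ DIM('a) * (angle_sum X k (points X \<inter> K) - real (num_faces k (points X \<inter> K)))"
proof -
  define d where "d = DIM('a)"
  define n where "n j = real (card {W \<in> boundary_complex. card W = j})" for j
  define q where "q j = (-1) ^ j * real ((j + 1) choose (k + 1))" for j
  let ?a = "\<lambda>j. angle_sum X j (points X \<inter> K)"
  have "(\<Sum>j=k..d-1. q j * (?a j + n j)) = (\<Sum>j=k..d-1. q j * (\<Sum>G\<in>\<G>. angle_sum X j (trace_cone X (insert c G))))"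
    using k by (intro sum.cong refl) (subst sum_angle_sum_star_simplices, auto simp: n_def d_def)
  also have "\<dots> = (\<Sum>G\<in>\<G>. \<Sum>j=k..d-1. q j * angle_sum X j (trace_cone X (insert c G)))"
    unfolding sum_distrib_left by (rule sum.swap)
  also have "\<dots> = (\<Sum>G\<in>\<G>. (-1) ^ d * (angle_sum X k (trace_cone X (insert c G)) - real ((d + 1) choose (k + 1))))"
    using simplices num_faces_star_simplex by (intro sum.cong refl) (simp add: q_def d_def)
  also have "\<dots> = (-1) ^ d * ((\<Sum>G\<in>\<G>. angle_sum X k (trace_cone X (insert c G)))
      - real (card \<G>) * real ((d + 1) choose (k + 1)))"
    by (simp add: sum_subtractf flip: sum_distrib_left)
  also have "(\<Sum>G\<in>\<G>. angle_sum X k (trace_cone X (insert c G))) = ?a k + n k"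
    using k by (simp add: sum_angle_sum_star_simplices n_def)
  also have "real (card \<G>) = n d"
  proof -
    have "{W \<in> boundary_complex. card W = d} = \<G>"
      using card_facet finite_facet by (auto simp: d_def) (metis card_subset_eq add_right_cancel)
    then show ?thesis by (simp add: n_def)
  qed
  finally have angles: "(\<Sum>j=k..d-1. q j * ?a j) + (\<Sum>j=k..d-1. q j * n j) =
      (-1) ^ d * (?a k + n k - n d * real ((d + 1) choose (k + 1)))"
    by (simp add: sum.distrib distrib_left)
  have "(\<Sum>j\<le>d. q j * n j) = (\<Sum>W\<in>boundary_complex. q (card W))"
    unfolding d_def n_def by (rule sum_by_card_boundary_complex[symmetric])
  \<comment> \<open>Pascal's rule. The two sums are the cases \<open>m = k\<close> and
    \<open>m = k + 1\<close> of the Dehn-Sommerville equations for the ambient dimension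
    \<open>d + 1\<close>, whence the sign \<open>(-1) ^ d\<close>.\<close>
  also have "\<dots> = (\<Sum>W\<in>boundary_complex. (-1) ^ card W * real (card W choose k))
      + (\<Sum>W\<in>boundary_complex. (-1) ^ card W * real (card W choose (k + 1)))"
    by (simp add: q_def distrib_left flip: sum.distrib)
  also have "\<dots> = (-1) ^ d * (n k + n (k + 1))"
    unfolding dehn_sommerville by (simp add: d_def n_def distrib_left)
  finally have "(\<Sum>j\<le>d. q j * n j) = (-1) ^ d * (n k + n (k + 1))" .
  moreover have "(\<Sum>j\<le>d. q j * n j) = (\<Sum>j=k..d. q j * n j)"
  proof (rule sum.mono_neutral_right)
    have "q j = 0" if "j < k" for j
      unfolding q_def using that by (subst binomial_eq_0) auto
    then show "\<forall>j\<in>{..d} - {k..d}. q j * n j = 0" by auto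
  qed auto
  \<comment> \<open>The top term, absent from the angle relation, equals the total face count of the
    simplices up to the sign \<open>(-1) ^ d\<close>, and the two cancel.\<close>
  moreover have "(\<Sum>j=k..d. q j * n j) = (\<Sum>j=k..d-1. q j * n j) + q d * n d"
    using k by (cases d) (simp_all add: d_def)
  ultimately have "(\<Sum>j=k..d-1. q j * n j) = (-1) ^ d * (n k + n (k + 1) - n d * real ((d + 1) choose (k + 1)))"
    by (simp add: q_def algebra_simps)
  with angles have "(\<Sum>j=k..d-1. q j * ?a j) = (-1) ^ d * (?a k - n (k + 1))"
    by (simp add: algebra_simps)
  then show ?thesis using num_faces_polytope[OF k] by (simp add: q_def d_def n_def)
qed

end

subsection \<open>Polytopes as traces of polyhedral cones\<close>

lemma halfspace_cone:
  assumes "finite N"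
  shows "polyhedron {p::'b::euclidean_space. \<forall>a\<in>N. a \<bullet> p \<le> 0}" "convex_cone {p::'b. \<forall>a\<in>N. a \<bullet> p \<le> 0}"
proof -
  have eq: "{p::'b. \<forall>a\<in>N. a \<bullet> p \<le> 0} = \<Inter>((\<lambda>a. {p. a \<bullet> p \<le> 0}) ` N)" by auto
  show "polyhedron {p::'b. \<forall>a\<in>N. a \<bullet> p \<le> 0}"
    unfolding eq using assms by (intro polyhedron_Inter) (auto simp: polyhedron_halfspace_le)
  show "convex_cone {p::'b. \<forall>a\<in>N. a \<bullet> p \<le> 0}"
    unfolding eq by (intro convex_cone_Inter) (auto simp: convex_cone_halfspace_le)
qed

text \<open>Radial projection is continuous on the open set \<open>gdom X\<close>, so a relatively
  open piece of the trace pulls back to an open subset of the cone.\<close>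

lemma interior_of_trace:
  fixes K :: "('a::euclidean_space \<times> real) set"
  assumes "(top_of_set (points X)) interior_of (points X \<inter> K) \<noteq> {}" "convex_cone K"
  shows "interior K \<noteq> {}"
proof -
  obtain S x where S: "open S" "points X \<inter> S \<subseteq> points X \<inter> K" "x \<in> points X \<inter> S"
    using assms(1) by (auto simp: interior_of_def openin_open)
  let ?f = "\<lambda>p. inverse (gnorm X p) *\<^sub>R p"
  let ?O = "gdom X \<inter> ?f -` S"
  have "continuous_on (gdom X) ?f"
    using gnorm_pos by (intro continuous_intros continuous_on_gnorm) force
  then have "open ?O" using open_gdom S(1) by (intro continuous_open_preimage)
  moreover have "x \<in> ?O" using S(3) by (simp add: points_iff_gnorm)
  moreover have "?O \<subseteq> K"
  proof
    fix p assume p: "p \<in> ?O"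
    then have pos: "gnorm X p > 0" using gnorm_pos by blast
    have "?f p \<in> K" using p S(2) normalize_in_points by blast
    then have "gnorm X p *\<^sub>R ?f p \<in> K" by (rule convex_cone_scaleR[OF assms(2) less_imp_le[OF pos]])
    then show "p \<in> K" using pos by simp
  qed
  ultimately show ?thesis using interior_maximal by blast
qed

text \<open>A nonzero vector of height 0 in \<open>K\<close> would be a recession direction of the
  bounded polytope.\<close>

lemma euclidean_cone_in_gdom:
  fixes K :: "('a::euclidean_space \<times> real) set"
  assumes K: "convex_cone K" "\<And>p. p \<in> K \<Longrightarrow> 0 \<le> snd p" and ne: "points Euclidean \<inter> K \<noteq> {}"
    and bound: "\<And>p. p \<in> points Euclidean \<inter> K \<Longrightarrow> dist x p \<le> r"
  shows "K - {0} \<subseteq> gdom Euclidean"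
proof
  fix q assume q: "q \<in> K - {0}"
  obtain p0 where p0: "p0 \<in> K" "snd p0 = 1" using ne by auto
  show "q \<in> gdom Euclidean"
  proof (rule ccontr)
    assume "q \<notin> gdom Euclidean"
    then have sq: "snd q = 0" using K(2)[of q] q by simp
    \<comment> \<open>Long enough for \<open>p0 + t *\<^sub>R q\<close> to be farther than
      \<open>r\<close> from \<open>x\<close>, whatever the direction of \<open>q\<close>.\<close>
    define t where "t = (r + norm (p0 - x) + 1) / norm q"
    have "dist x p0 \<le> r" using bound p0 by simp
    then have "r \<ge> 0" using zero_le_dist order_trans by blast
    then have t: "t \<ge> 0" "norm (t *\<^sub>R q) = r + norm (p0 - x) + 1"
      using q by (auto simp: t_def)
    have "p0 + t *\<^sub>R q \<in> points Euclidean \<inter> K"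
      using p0 q sq t(1) K(1) by (auto intro!: convex_cone_add convex_cone_scaleR)
    then have "norm ((p0 - x) + t *\<^sub>R q) \<le> r"
      using bound by (fastforce simp: dist_norm norm_minus_commute algebra_simps)
    moreover have "norm (t *\<^sub>R q) \<le> norm ((p0 - x) + t *\<^sub>R q) + norm (p0 - x)"
      using norm_triangle_ineq4[of "(p0 - x) + t *\<^sub>R q" "p0 - x"] by simp
    ultimately show False using t(2) by simp
  qed
qed

text \<open>
  Boundedness keeps the timelike part of \<open>K\<close> inside a cone of slope \<open>\<kappa> < 1\<close>. A segment in \<open>K\<close> from
  there to a vector that is not timelike would have to pass through slopes strictly between
  \<open>\<kappa>\<close> and 1.
\<close>

lemma hyperbolic_cone_in_gdom:
  fixes K :: "('a::euclidean_space \<times> real) set"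
  assumes K: "convex_cone K" "\<And>p. p \<in> K \<Longrightarrow> 0 \<le> snd p" and ne: "points Hyperbolic \<inter> K \<noteq> {}"
    and x: "x \<in> points Hyperbolic"
    and bound: "\<And>p. p \<in> points Hyperbolic \<inter> K \<Longrightarrow> gdist Hyperbolic x p \<le> r"
  shows "K - {0} \<subseteq> gdom Hyperbolic"
proof -
  \<comment> \<open>The Lorentz product of \<open>x\<close> with a point at height \<open>s\<close>
    is at least \<delta> s, so the distance bound limits heights to \<open>M\<close>. On the
    hyperboloid up to height \<open>M\<close> the slope is at most \<kappa>; the summand 1 in
    \<open>M\<close> gives \<open>M > 1\<close>.\<close>
  define \<delta> where "\<delta> = snd x - norm (fst x)"
  define M where "M = 1 + cosh r / \<delta>"
  have \<delta>: "\<delta> > 0" using x points_iff_gnorm[of x Hyperbolic] by (simp add: \<delta>_def)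
  have M: "M > 1" using \<delta> by (simp add: M_def)
  define \<kappa> where "\<kappa> = sqrt (1 - 1 / M\<^sup>2)"
  have \<kappa>: "0 \<le> \<kappa>" "\<kappa> < 1"
    using M by (auto simp: \<kappa>_def power2_eq_square divide_le_eq mult_ge1_I less_imp_le)
  have slope_points: "norm (fst p) \<le> \<kappa> * snd p" if p: "p \<in> points Hyperbolic \<inter> K" for p
  proof -
    have pp: "snd p > 0" "fst p \<bullet> fst p - (snd p)\<^sup>2 = -1" "norm (fst p) < snd p"
      using p points_iff_gnorm[of p Hyperbolic] by auto
    let ?b = "snd x * snd p - fst x \<bullet> fst p"
    have "?b \<le> cosh r"
    \<comment> \<open>\<open>arcosh\<close> inverts \<open>cosh\<close> only from 1 upwards; below 1
      the bound is immediate.\<close>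
    proof (cases "?b \<ge> 1")
      case True
      then have "0 \<le> arcosh ?b" by (rule arcosh_nonneg_real)
      moreover have "arcosh ?b \<le> r" using bound[OF p] by simp
      ultimately have "cosh (arcosh ?b) \<le> cosh r" by (subst cosh_real_nonneg_le_iff) linarith+
      then show ?thesis using True by (simp add: cosh_arcosh_real)
    qed (use cosh_real_ge_1[of r] in linarith)
    moreover have "fst x \<bullet> fst p \<le> norm (fst x) * snd p"
      using norm_cauchy_schwarz[of "fst x" "fst p"] pp(3)
      by (meson less_imp_le mult_left_mono norm_ge_zero order_trans)
    ultimately have "\<delta> * snd p \<le> cosh r" by (simp add: \<delta>_def algebra_simps)
    then have "snd p \<le> M" using \<delta> by (simp add: M_def field_simps add_increasing)
    then have "(snd p)\<^sup>2 \<le> M\<^sup>2" using pp(1) by (intro power_mono) auto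
    then have "(snd p)\<^sup>2 / M\<^sup>2 \<le> 1" using M by simp
    then have "(norm (fst p))\<^sup>2 \<le> (snd p)\<^sup>2 * (1 - 1 / M\<^sup>2)"
      using pp(2) by (simp add: dot_square_norm algebra_simps)
    then have "sqrt ((norm (fst p))\<^sup>2) \<le> sqrt ((snd p)\<^sup>2 * (1 - 1 / M\<^sup>2))" by (rule real_sqrt_le_mono)
    then show ?thesis using pp(1) by (simp add: real_sqrt_mult \<kappa>_def mult.commute)
  qed
  have slope: "norm (fst p) \<le> \<kappa> * snd p" if p: "p \<in> K" "p \<in> gdom Hyperbolic" for p
  proof -
    let ?n = "inverse (gnorm Hyperbolic p)"
    have n: "?n > 0" using gnorm_pos[OF p(2)] by simp
    have "?n *\<^sub>R p \<in> points Hyperbolic \<inter> K"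
      using p n K(1) normalize_in_points[OF p(2)] by (auto intro!: convex_cone_scaleR)
    from slope_points[OF this] have "?n * norm (fst p) \<le> ?n * (\<kappa> * snd p)"
      using n by (simp add: mult.left_commute)
    then show ?thesis using n by (simp only: mult_le_cancel_left_pos)
  qed
  obtain p0 where p0: "p0 \<in> K" "p0 \<in> points Hyperbolic" using ne by blast
  then have p0': "p0 \<in> gdom Hyperbolic" "snd p0 > 0" using points_iff_gnorm[of p0 Hyperbolic] by auto
  show ?thesis
  proof
    fix q assume q: "q \<in> K - {0}"
    show "q \<in> gdom Hyperbolic"
    proof (rule ccontr)
      assume "q \<notin> gdom Hyperbolic"
      then have fq: "norm (fst q) \<ge> snd q" by simp
      define \<kappa>' where "\<kappa>' = (1 + \<kappa>) / 2"
      have \<kappa>': "\<kappa> < \<kappa>'" "\<kappa>' < 1" using \<kappa> by (auto simp: \<kappa>'_def)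
      define s where "s t = (1 - t) *\<^sub>R p0 + t *\<^sub>R q" for t
      define g where "g t = norm (fst (s t)) - \<kappa>' * snd (s t)" for t
      have sK: "s t \<in> K" if "0 \<le> t" "t \<le> 1" for t
        using that p0 q K(1) by (auto simp: s_def intro!: convex_cone_add convex_cone_scaleR)
      have "\<kappa> * snd p0 < \<kappa>' * snd p0" using \<kappa>' p0' by simp
      then have g0: "g 0 \<le> 0" using slope[OF p0(1) p0'(1)] by (simp add: g_def s_def)
      have g1: "g 1 > 0"
      proof (cases "snd q = 0")
        case True
        then have "fst q \<noteq> 0" using q by (auto simp: prod_eq_iff)
        then show ?thesis using True by (simp add: g_def s_def)
      next
        case False
        then have "snd q > 0" using K(2)[of q] q by simp
        then have "\<kappa>' * snd q < 1 * snd q" using \<kappa>'(2) by (intro mult_strict_right_mono)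
        then show ?thesis using fq by (simp add: g_def s_def)
      qed
      have "continuous_on {0..1} g"
        unfolding g_def s_def by (intro continuous_intros)
      then obtain t where t: "0 \<le> t" "t \<le> 1" "g t = 0"
        using IVT'[of g 0 0 1] g0 g1 by auto
      have "t < 1" using t g1 by (metis less_le less_irrefl)
      then have "snd (s t) > 0"
        using t(1) p0'(2) K(2)[of q] q by (auto simp: s_def intro!: add_pos_nonneg)
      then have "\<kappa> * snd (s t) < \<kappa>' * snd (s t)" "\<kappa>' * snd (s t) < 1 * snd (s t)"
        using \<kappa>' by (intro mult_strict_right_mono; simp)+
      moreover have "norm (fst (s t)) = \<kappa>' * snd (s t)" using t(3) by (simp add: g_def)
      ultimately have "s t \<in> gdom Hyperbolic" "\<not> norm (fst (s t)) \<le> \<kappa> * snd (s t)" by simp_all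
      then show False using slope[OF sK[OF t(1,2)]] by blast
    qed
  qed
qed

text \<open>The last conclusion says that the cone is pointed. On the sphere this is part of the
  definition of a polytope; otherwise it follows because \<open>gdom X\<close> contains no pair of
  opposite vectors.\<close>

lemma gpolytope_cone:
  fixes P :: "('a::euclidean_space \<times> real) set"
  assumes "gpolytope X P"
  obtains N where "finite N" "P = points X \<inter> {p. \<forall>a\<in>N. a \<bullet> p \<le> 0}"
    "{p. \<forall>a\<in>N. a \<bullet> p \<le> 0} - {0} \<subseteq> gdom X" "interior {p. \<forall>a\<in>N. a \<bullet> p \<le> 0} \<noteq> {}"
    "\<forall>p. (\<forall>a\<in>N. a \<bullet> p \<le> 0) \<longrightarrow> (\<forall>a\<in>N. a \<bullet> (- p) \<le> 0) \<longrightarrow> p = 0"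
proof (cases "X = Spherical")
  case True
  then have "spherical_polytope P" using assms by simp
  then obtain N where N: "finite N" "{p. \<forall>a\<in>N. a \<bullet> p = 0} = {0}"
    "interior {p. \<forall>a\<in>N. a \<bullet> p \<le> 0} \<noteq> {}" "P = points Spherical \<inter> {p. \<forall>a\<in>N. a \<bullet> p \<le> 0}"
    unfolding spherical_polytope_def by blast
  have "p = 0" if "\<forall>a\<in>N. a \<bullet> p \<le> 0" "\<forall>a\<in>N. a \<bullet> (- p) \<le> 0" for p
  proof -
    have "p \<in> {p. \<forall>a\<in>N. a \<bullet> p = 0}" using that by force
    then show ?thesis using N(2) by blast
  qed
  then show thesis using N True by (intro that[of N]) auto
next
  case False
  then have "bounded_polytope X P" using assms by (cases X) auto
  then obtain \<H> x r where \<H>: "finite \<H>" "\<forall>H\<in>\<H>. closed_half_space X H" "P = points X \<inter> \<Inter>\<H>"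
    and x: "x \<in> points X" "\<forall>p\<in>P. gdist X x p \<le> r"
    and int: "(top_of_set (points X)) interior_of P \<noteq> {}"
    unfolding bounded_polytope_def by blast
  have "\<forall>H\<in>\<H>. \<exists>a. H = {p \<in> points X. a \<bullet> p \<le> 0}"
    using \<H>(2) unfolding closed_half_space_def by blast
  then obtain a where a: "\<And>H. H \<in> \<H> \<Longrightarrow> H = {p \<in> points X. a H \<bullet> p \<le> 0}" by metis
  \<comment> \<open>The extra normal keeps the cone in the upper half-space; the given half-spaces
    restrict only points of the space and might admit vectors of negative height.\<close>
  define N where "N = insert (0, -1) (a ` \<H>)"
  define K where "K = {p. \<forall>a\<in>N. a \<bullet> p \<le> 0}"
  have finN: "finite N" using \<H>(1) by (simp add: N_def)
  have cone: "convex_cone K" unfolding K_def by (rule halfspace_cone[OF finN])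
  have snd_nonneg: "0 \<le> snd p" if "p \<in> K" for p
    using that by (auto simp: K_def N_def inner_prod_def)
  have points_snd: "0 < snd p" if "p \<in> points X" for p using that False by (cases X) auto
  have P: "P = points X \<inter> K"
  proof (intro equalityI subsetI)
    fix p assume p: "p \<in> P"
    then have "p \<in> points X" using \<H>(3) by blast
    moreover have "a H \<bullet> p \<le> 0" if "H \<in> \<H>" for H using p \<H>(3) a[OF that] that by blast
    moreover have "(0, -1) \<bullet> p \<le> 0" using points_snd[OF \<open>p \<in> points X\<close>] by (simp add: inner_prod_def)
    ultimately show "p \<in> points X \<inter> K" by (auto simp: K_def N_def)
  next
    fix p assume p: "p \<in> points X \<inter> K"
    then have "p \<in> H" if "H \<in> \<H>" for H using a[OF that] that by (auto simp: K_def N_def)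
    then show "p \<in> P" using p \<H>(3) by blast
  qed
  have "P \<noteq> {}" using int interior_of_subset[of "top_of_set (points X)" P] by blast
  then have ne: "points X \<inter> K \<noteq> {}" using P by simp
  have dom: "K - {0} \<subseteq> gdom X"
  proof (cases X)
    case Euclidean
    then show ?thesis
      using euclidean_cone_in_gdom[OF cone snd_nonneg, of x r] ne x P by simp
  next
    case Hyperbolic
    then show ?thesis
      using hyperbolic_cone_in_gdom[OF cone snd_nonneg, of x r] ne x P by blast
  qed (use False in simp)
  have "p = 0" if p: "p \<in> K" "- p \<in> K" for p
  proof (rule ccontr)
    assume "p \<noteq> 0"
    then have "p \<in> gdom X" "- p \<in> gdom X" using dom p by auto
    then show False
      using False norm_ge_zero[of "fst p"] by (cases X) (auto simp: order_less_le_trans)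
  qed
  moreover have "interior K \<noteq> {}" using interior_of_trace[OF _ cone] int P by blast
  ultimately show thesis using finN P dom unfolding K_def by (intro that[of N]) auto
qed

text \<open>The trace of a facet of the cone spans the same linear space as the facet, so it is a
  face of the polytope of dimension \<open>DIM('a) - 1\<close>, to which simpliciality applies;
  rescaling carries its vertex description back to the cone.\<close>

lemma facet_of_polytope_cone:
  fixes K :: "('a::euclidean_space \<times> real) set"
  assumes P: "simplicial_polytope X (points X \<inter> K)"
    and K: "polyhedron K" "convex_cone K" "K - {0} \<subseteq> gdom X" "interior K \<noteq> {}"
    and F: "F facet_of K"
  obtains V where "V \<subseteq> points X" "independent V" "card V = DIM('a)" "F = convex_cone hull V"
proof -
  have scale: "inverse (gnorm X p) *\<^sub>R p \<in> points X \<inter> K" "gnorm X p > 0" if "p \<in> K" "p \<noteq> 0" for p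
  proof -
    have p: "p \<in> gdom X" using that K(3) by blast
    show "gnorm X p > 0" by (rule gnorm_pos[OF p])
    then have "inverse (gnorm X p) *\<^sub>R p \<in> K" using that(1) by (intro convex_cone_scaleR[OF K(2)]) auto
    then show "inverse (gnorm X p) *\<^sub>R p \<in> points X \<inter> K" using normalize_in_points[OF p] by blast
  qed
  have "F exposed_face_of K"
    using F exposed_face_of_polyhedron[OF K(1)] facet_of_imp_face_of by blast
  moreover have "F \<noteq> {}" "F \<noteq> K" using F by (auto simp: facet_of_def)
  ultimately obtain a b where ab: "K \<subseteq> {x. a \<bullet> x \<le> b}" "F = K \<inter> {x. a \<bullet> x = b}"
    unfolding exposed_face_of by blast
  have K0: "0 \<in> K" by (rule convex_cone_contains_0[OF K(2)])
  have b: "b = 0"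
  proof (rule ccontr)
    assume "b \<noteq> 0"
    obtain p where p: "p \<in> K" "a \<bullet> p = b" using \<open>F \<noteq> {}\<close> ab(2) by blast
    have "a \<bullet> (2 *\<^sub>R p) \<le> b" using ab(1) p(1) convex_cone_scaleR[OF K(2), of 2 p] by auto
    moreover have "0 \<le> b" using ab(1) K0 by auto
    ultimately show False using \<open>b \<noteq> 0\<close> p(2) by simp
  qed
  have F_eq: "F = K \<inter> {x. a \<bullet> x = 0}" using ab b by simp
  have "F = K \<inter> {x. a \<bullet> x \<le> 0} \<inter> {x. - a \<bullet> x \<le> 0}" using F_eq by auto
  then have coneF: "convex_cone F"
    using convex_cone_Inter[of "{K, {x. a \<bullet> x \<le> 0}, {x. - a \<bullet> x \<le> 0}}"] K(2)
      convex_cone_halfspace_le[of a] convex_cone_halfspace_le[of "- a"] by (auto simp: Int_assoc)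
  have "0 \<in> F" using K0 F_eq by simp
  \<comment> \<open>The facet contains 0, so its linear and affine dimensions agree; both are one
    below the ambient dimension.\<close>
  then have "int (dim F) = aff_dim F" by (simp add: aff_dim_zero hull_inc)
  also have "\<dots> = int (DIM('a \<times> real)) - 1"
    using F K(4) by (simp add: facet_of_def aff_dim_nonempty_interior)
  finally have dimF: "dim F = DIM('a)" by simp
  define F' where "F' = points X \<inter> F"
  have "F \<subseteq> span F'"
  proof
    fix p assume p: "p \<in> F"
    show "p \<in> span F'"
    proof (cases "p = 0")
      case False
      have "inverse (gnorm X p) *\<^sub>R p \<in> F'"
        using scale[of p] p False F_eq coneF by (auto simp: F'_def)
      then have "gnorm X p *\<^sub>R inverse (gnorm X p) *\<^sub>R p \<in> span F'" by (intro span_mul span_base)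
      then show ?thesis using scale(2)[of p] p False F_eq by simp
    qed (simp add: span_zero)
  qed
  then have "span F' = span F"
    by (metis F'_def inf_le2 span_mono span_span subset_antisym)
  then have dimF': "dim F' = DIM('a)" using dimF by (metis dim_span)
  then have "F' \<noteq> {}" using DIM_positive[where 'a = 'a] by force
  moreover have "F' = {p \<in> points X \<inter> K. a \<bullet> p = 0}" "\<forall>p\<in>points X \<inter> K. a \<bullet> p \<le> 0"
    using F_eq ab(1) b by (auto simp: F'_def)
  ultimately have "nonempty_face F' (points X \<inter> K)" unfolding nonempty_face_def by blast
  then have "F' \<in> faces (DIM('a) - 1) (points X \<inter> K)"
    using dimF' by (simp add: faces_def)
  then have "gsimplex X (DIM('a) - 1) F'" using P unfolding simplicial_polytope_def by blast
  then obtain V where V: "V \<subseteq> points X" "independent V" "card V = DIM('a)" "F' = points X \<inter> convex_cone hull V"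
    unfolding gsimplex_def by auto
  have "F = convex_cone hull V"
  proof
    have "V \<subseteq> F" using V hull_subset[of V convex_cone] by (auto simp: F'_def)
    then show "convex_cone hull V \<subseteq> F" using coneF by (simp add: hull_minimal)
    show "F \<subseteq> convex_cone hull V"
    proof
      fix p assume p: "p \<in> F"
      show "p \<in> convex_cone hull V"
      proof (cases "p = 0")
        case False
        have "inverse (gnorm X p) *\<^sub>R p \<in> F'"
          using scale[of p] p False F_eq coneF by (auto simp: F'_def)
        then have "inverse (gnorm X p) *\<^sub>R p \<in> convex_cone hull V" using V(4) by blast
        then have "gnorm X p *\<^sub>R inverse (gnorm X p) *\<^sub>R p \<in> convex_cone hull V"
          by (rule convex_cone_hull_mul) (use scale(2)[of p] p False F_eq in auto)
        then show ?thesis using scale(2)[of p] p False F_eq by simp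
      qed (simp add: convex_cone_hull_contains_0)
    qed
  qed
  then show thesis using V that by blast
qed

text \<open>An interior point of the cone, rescaled into the space, serves as \<open>c\<close>, and
  one vertex set is chosen per facet. Each ray meets the space at most once, which makes the
  vertices normalized.\<close>

lemma simplicial_polytope_star_triangulation:
  fixes P :: "('a::euclidean_space \<times> real) set"
  assumes "simplicial_polytope X P"
  obtains K \<G> c N where "star_triangulation K \<G> c X N" "P = points X \<inter> K"
proof -
  have "gpolytope X P" using assms by (simp add: simplicial_polytope_def)
  then obtain N where N: "finite N" "P = points X \<inter> {p. \<forall>a\<in>N. a \<bullet> p \<le> 0}"
    "{p. \<forall>a\<in>N. a \<bullet> p \<le> 0} - {0} \<subseteq> gdom X" "interior {p. \<forall>a\<in>N. a \<bullet> p \<le> 0} \<noteq> {}"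
    "\<forall>p. (\<forall>a\<in>N. a \<bullet> p \<le> 0) \<longrightarrow> (\<forall>a\<in>N. a \<bullet> (- p) \<le> 0) \<longrightarrow> p = 0"
    by (rule gpolytope_cone)
  define K where "K = {p. \<forall>a\<in>N. a \<bullet> p \<le> 0}"
  note NK = N[folded K_def]
  have K: "polyhedron K" "convex_cone K" unfolding K_def by (rule halfspace_cone[OF N(1)])+
  have pointed: "p = 0" if "p \<in> K" "- p \<in> K" for p using that N(5) unfolding K_def by blast
  obtain c0 where c0: "c0 \<in> interior K" using NK(4) by blast
  have "c0 \<noteq> 0"
  proof
    assume "c0 = 0"
    then obtain e where e: "e > 0" "ball 0 e \<subseteq> K" using c0 mem_interior by blast
    obtain b :: "'a \<times> real" where b: "b \<in> Basis" using nonempty_Basis by blast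
    have "(e / 2) *\<^sub>R b \<in> ball 0 e" "- ((e / 2) *\<^sub>R b) \<in> ball 0 e" using e(1) b by auto
    then have "(e / 2) *\<^sub>R b = 0" using pointed e(2) by blast
    then show False using e(1) b by auto
  qed
  then have c0d: "c0 \<in> gdom X" using c0 NK(3) interior_subset by blast
  define c where "c = inverse (gnorm X c0) *\<^sub>R c0"
  have pos: "inverse (gnorm X c0) > 0" using gnorm_pos[OF c0d] by simp
  have c: "c \<in> points X" unfolding c_def by (rule normalize_in_points[OF c0d])
  have c_int: "c \<in> interior K"
  proof -
    have "open ((*\<^sub>R) (inverse (gnorm X c0)) ` interior K)" using pos by (intro open_scaling) auto
    moreover have "(*\<^sub>R) (inverse (gnorm X c0)) ` interior K \<subseteq> K"
    proof (rule image_subsetI)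
      fix p assume "p \<in> interior K"
      then have "p \<in> K" using interior_subset by blast
      then show "inverse (gnorm X c0) *\<^sub>R p \<in> K"
        by (rule convex_cone_scaleR[OF K(2) less_imp_le[OF pos]])
    qed
    ultimately show ?thesis using c0 interior_maximal unfolding c_def by blast
  qed
  have "c \<noteq> 0" using \<open>c0 \<noteq> 0\<close> pos by (simp add: c_def)
  then have c_neg: "- c \<notin> K" using pointed c_int interior_subset by blast
  define Q where "Q F V \<longleftrightarrow> V \<subseteq> points X \<and> independent V \<and> card V = DIM('a) \<and> F = convex_cone hull V" for F V :: "('a \<times> real) set"
  have "simplicial_polytope X (points X \<inter> K)" using assms NK(2) by simp
  from facet_of_polytope_cone[OF this K NK(3,4)] have "\<exists>V. Q F V" if "F facet_of K" for F
    unfolding Q_def using that by metis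
  then obtain V where V: "\<And>F. F facet_of K \<Longrightarrow> Q F (V F)" by metis
  have "star_triangulation K (V ` {F. F facet_of K}) c X N"
  proof
    show "finite (V ` {F. F facet_of K})" using finite_polyhedron_facets[OF K(1)] by simp
    show "independent G" "card G + 1 = DIM('a \<times> real)" "convex_cone hull G facet_of K"
      if "G \<in> V ` {F. F facet_of K}" for G
      using that V unfolding Q_def by auto
    show "\<exists>G\<in>V ` {F. F facet_of K}. F = convex_cone hull G" if "F facet_of K" for F
      using V[OF that] that unfolding Q_def by blast
    show verts: "\<Union>(V ` {F. F facet_of K}) \<subseteq> points X" using V unfolding Q_def by blast
    show "t = 1" if "v \<in> \<Union>(V ` {F. F facet_of K})" "t > 0" "t *\<^sub>R v \<in> \<Union>(V ` {F. F facet_of K})" for v t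
      using points_scaleR_unique[of v X t] that verts by blast
  qed (use K c c_int c_neg N NK K_def in auto)
  then show thesis using NK(2) by (rule that)
qed

theorem mainTheorem11:
  fixes X :: geometry and d :: nat
  assumes "d = DIM('a::euclidean_space)" and "d \<ge> 1"
    and simplices: "\<And>\<Delta> :: ('a \<times> real) set. gsimplex X d \<Delta> \<Longrightarrow>
      \<forall>k. 0 \<le> k \<and> k \<le> d - 1 \<longrightarrow>
        (\<Sum>j=k..d-1. (-1) ^ j * real ((j + 1) choose (k + 1)) * angle_sum X j \<Delta>)
          = (-1) ^ d * (angle_sum X k \<Delta> - real (num_faces k \<Delta>))"
  shows "\<And>P :: ('a \<times> real) set. simplicial_polytope X P \<Longrightarrow>
      \<forall>k. 0 \<le> k \<and> k \<le> d - 1 \<longrightarrow>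
        (\<Sum>j=k..d-1. (-1) ^ j * real ((j + 1) choose (k + 1)) * angle_sum X j P)
          = (-1) ^ d * (angle_sum X k P - real (num_faces k P))"
proof (intro allI impI)
  fix P :: "('a \<times> real) set" and k
  assume P: "simplicial_polytope X P" and k: "0 \<le> k \<and> k \<le> d - 1"
  obtain K \<G> c N where star: "star_triangulation K \<G> c X N" and P_eq: "P = points X \<inter> K"
    by (rule simplicial_polytope_star_triangulation[OF P])
  interpret star_triangulation K \<G> c X N by (rule star)
  have "gsimplex X d (trace_cone X (insert c G))" if "G \<in> \<G>" for G
    using independent_insert_c[OF that] insert_c_points[OF that] card_insert_c[OF that] assms(1)
    unfolding gsimplex_def by (intro exI[of _ "insert c G"]) auto
  then have "\<And>G. G \<in> \<G> \<Longrightarrow>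
      (\<Sum>j=k..d-1. (-1) ^ j * real ((j + 1) choose (k + 1)) * angle_sum X j (trace_cone X (insert c G)))
        = (-1) ^ d * (angle_sum X k (trace_cone X (insert c G)) - real (num_faces k (trace_cone X (insert c G))))"
    using simplices k by blast
  moreover have "k + 1 \<le> DIM('a)" using k assms(1,2) by linarith
  ultimately show "(\<Sum>j=k..d-1. (-1) ^ j * real ((j + 1) choose (k + 1)) * angle_sum X j P)
      = (-1) ^ d * (angle_sum X k P - real (num_faces k P))"
    unfolding P_eq assms(1) by (intro perles_relation_of_simplices)
qed

end
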